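(* Let $f\in\mathbb{C}[x_1,\ldots,x_n]$ be a homogeneous polynomial of degree $d\ge 3$ with $t$ monomial terms. The center-based criterion (described in the context) for determining whether $f$ is diagonalizable requires at most $O(n^3d^3t+n^{d+4})$ arithmetic operations. Its complexity is polynomially bounded when either $n$ or $d$ is fixed (in the other parameter).
   Context: Complexity is counted in arithmetic operations over $\mathbb{C}$; the parameters are the number of variables $n$, the degree $d$, and the number $t$ of monomial terms of $f$ (so $t\le\binom{n+d-1}{d}$). A homogeneous polynomial $f\in\mathbb{C}[x_1,\ldots,x_n]$ of degree $d$ is diagonalizable if after an invertible linear change of variables $x=Py$ it can be written as $f(Py)=\lambda_1y_1^d+\cdots+\lambda_ny_n^d$ with $\lambda_i\in\mathbb{C}$. It is nondegenerate if no variable can be removed by an invertible linear change of variables; equivalently, its first-order partial derivatives $\frac{\partial f}{\partial x_1},\ldots,\frac{\partial f}{\partial x_n}$ are linearly independent. The center of $f$ is $Z(f)=\{X\in\mathbb{C}^{n\times n}\mid (HX)^T=HX\}$, where $H=\left(\frac{\partial^2 f}{\partial x_i\partial x_j}\right)_{1\le i,j\le n}$ is the Hessian matrix of $f$ and the equation is an identity of matrices of polynomials. The criterion consists of three steps. (1) Detect nondegeneracy: determine whether the partial derivatives of $f$ are linearly independent; if not, reduce $f$ by a linear change of variables to a nondegenerate form in fewer variables, which then replaces $f$ (and its number of variables replaces $n$). (2) Compute center: solve the linear system $(HX)^T=HX$ by Gaussian elimination to obtain $Z(f)$; if $\dim Z(f)\ne n$, report that $f$ is not diagonalizable; otherwise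 obtain a basis $X_1,\ldots,X_n$ of $Z(f)$. (3) Detect diagonalizability: compute the minimal polynomial $p_i(\lambda)$ of each $X_i$ and use the Euclid algorithm to compute $\gcd(p_i,p_i')$; report that $f$ is diagonalizable if and only if $\gcd(p_i,p_i')=1$ for all $i$. *)

theory Defs
  imports
    "Jordan_Normal_Form.VS_Connect"
    "HOL-Library.Poly_Mapping"
    "HOL-Library.Monad_Syntax"
    "HOL-Computational_Algebra.Polynomial_Factorial"
    "HOL-Computational_Algebra.Field_as_Ring"
begin

alias keys = Poly_Mapping.keys
alias lookup = Poly_Mapping.lookup
alias single = Poly_Mapping.single

section \<open>Homogeneous forms, nondegeneracy, center\<close>

text \<open>The variables \<open>x\<^sub>1, \<dots>, x\<^sub>n\<close> are indexed by \<open>0, \<dots>, n - 1\<close>. A polynomial maps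
  exponent vectors to coefficients, so \<open>card (keys f)\<close> is its number of monomial terms.\<close>

type_synonym monom = "nat \<Rightarrow>\<^sub>0 nat"
type_synonym cpoly = "monom \<Rightarrow>\<^sub>0 complex"

definition mdeg :: "monom \<Rightarrow> nat" where
  "mdeg m = (\<Sum>i\<in>keys m. lookup m i)"

definition vars :: "cpoly \<Rightarrow> nat set" where
  "vars f = (\<Union>m\<in>keys f. keys m)"

definition homogeneous :: "nat \<Rightarrow> nat \<Rightarrow> cpoly \<Rightarrow> bool" where
  "homogeneous n d f \<longleftrightarrow> vars f \<subseteq> {..<n} \<and> (\<forall>m\<in>keys f. mdeg m = d)"

abbreviation const :: "complex \<Rightarrow> cpoly" where
  "const c \<equiv> single 0 c"

abbreviation var :: "nat \<Rightarrow> cpoly" where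
  "var i \<equiv> single (single i 1) 1"

definition partial :: "nat \<Rightarrow> cpoly \<Rightarrow> cpoly" where
  "partial i f = (\<Sum>m\<in>keys f. single (m - single i 1) (of_nat (lookup m i) * lookup f m))"

text \<open>\<open>lin_subst n P f\<close> is \<open>f(Py)\<close>, written in the variables \<open>y\<close>.\<close>

definition lin_subst :: "nat \<Rightarrow> complex mat \<Rightarrow> cpoly \<Rightarrow> cpoly" where
  "lin_subst n P f =
    (\<Sum>m\<in>keys f. const (lookup f m) *
       (\<Prod>i<n. (\<Sum>j<n. const (P $$ (i, j)) * var j) ^ lookup m i))"

definition nondegenerate :: "nat \<Rightarrow> cpoly \<Rightarrow> bool" where
  "nondegenerate n f \<longleftrightarrow>
    \<not> (\<exists>P\<in>carrier_mat n n. invertible_mat P \<and> (\<exists>j<n. j \<notin> vars (lin_subst n P f)))"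

definition partials_independent :: "nat \<Rightarrow> cpoly \<Rightarrow> bool" where
  "partials_independent n f \<longleftrightarrow>
    (\<forall>c. (\<Sum>i<n. const (c i) * partial i f) = 0 \<longrightarrow> (\<forall>i<n. c i = 0))"

definition hessian :: "nat \<Rightarrow> cpoly \<Rightarrow> cpoly mat" where
  "hessian n f = mat n n (\<lambda>(i, j). partial i (partial j f))"

definition center :: "nat \<Rightarrow> cpoly \<Rightarrow> complex mat set" where
  "center n f = {X \<in> carrier_mat n n.
     transpose_mat (hessian n f * map_mat const X) = hessian n f * map_mat const X}"

definition center_space :: "nat \<Rightarrow> cpoly \<Rightarrow> (complex, complex mat) module" where
  "center_space n f = (module_mat TYPE(complex) n n)\<lparr>carrier := center n f\<rparr>"

definition poly_at_mat :: "complex poly \<Rightarrow> complex mat \<Rightarrow> complex mat" where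
  "poly_at_mat p X = mat (dim_row X) (dim_row X)
     (\<lambda>(a, b). \<Sum>k\<le>degree p. coeff p k * (X ^\<^sub>m k) $$ (a, b))"

definition is_min_poly :: "complex mat \<Rightarrow> complex poly \<Rightarrow> bool" where
  "is_min_poly X p \<longleftrightarrow> lead_coeff p = 1 \<and>
     poly_at_mat p X = 0\<^sub>m (dim_row X) (dim_row X) \<and>
     (\<forall>q. q \<noteq> 0 \<and> poly_at_mat q X = 0\<^sub>m (dim_row X) (dim_row X) \<longrightarrow> degree p \<le> degree q)"


section \<open>Arithmetic computations\<close>

text \<open>A computation is an algebraic computation tree. Programs are written polymorphically in the
  type \<open>'v\<close> of scalars, so that a scalar can only be created by \<open>Const\<close> or by an arithmetic
  operation and can only influence the control flow through a zero test. Only the interpretation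
  below instantiates \<open>'v\<close> to the complex numbers. Zero tests are charged like arithmetic
  operations; constants and bookkeeping on indices and exponents are free.\<close>

datatype arith = Add | Sub | Mul | Div

datatype ('v, 'a) comp =
    Return 'a
  | Const complex "'v \<Rightarrow> ('v, 'a) comp"
  | Arith arith 'v 'v "'v \<Rightarrow> ('v, 'a) comp"
  | Is_Zero 'v "bool \<Rightarrow> ('v, 'a) comp"

primrec comp_bind :: "('v, 'a) comp \<Rightarrow> ('a \<Rightarrow> ('v, 'b) comp) \<Rightarrow> ('v, 'b) comp" where
  "comp_bind (Return a) h = h a"
| "comp_bind (Const c k) h = Const c (\<lambda>x. comp_bind (k x) h)"
| "comp_bind (Arith e x y k) h = Arith e x y (\<lambda>z. comp_bind (k z) h)"
| "comp_bind (Is_Zero x k) h = Is_Zero x (\<lambda>b. comp_bind (k b) h)"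

adhoc_overloading Monad_Syntax.bind \<rightleftharpoons> comp_bind

fun arith_eval :: "arith \<Rightarrow> complex \<Rightarrow> complex \<Rightarrow> complex" where
  "arith_eval Add x y = x + y"
| "arith_eval Sub x y = x - y"
| "arith_eval Mul x y = x * y"
| "arith_eval Div x y = x / y"

primrec result :: "(complex, 'a) comp \<Rightarrow> 'a" where
  "result (Return a) = a"
| "result (Const c k) = result (k c)"
| "result (Arith e x y k) = result (k (arith_eval e x y))"
| "result (Is_Zero x k) = result (k (x = 0))"

primrec cost :: "(complex, 'a) comp \<Rightarrow> nat" where
  "cost (Return a) = 0"
| "cost (Const c k) = cost (k c)"
| "cost (Arith e x y k) = Suc (cost (k (arith_eval e x y)))"
| "cost (Is_Zero x k) = Suc (cost (k (x = 0)))"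

definition cconst :: "complex \<Rightarrow> ('v, 'v) comp" where "cconst c = Const c Return"
definition cadd :: "'v \<Rightarrow> 'v \<Rightarrow> ('v, 'v) comp" where "cadd x y = Arith Add x y Return"
definition csub :: "'v \<Rightarrow> 'v \<Rightarrow> ('v, 'v) comp" where "csub x y = Arith Sub x y Return"
definition cmul :: "'v \<Rightarrow> 'v \<Rightarrow> ('v, 'v) comp" where "cmul x y = Arith Mul x y Return"
definition cdiv :: "'v \<Rightarrow> 'v \<Rightarrow> ('v, 'v) comp" where "cdiv x y = Arith Div x y Return"
definition is_zero :: "'v \<Rightarrow> ('v, bool) comp" where "is_zero x = Is_Zero x Return"
definition cneg :: "'v \<Rightarrow> ('v, 'v) comp" where "cneg x = do { z \<leftarrow> cconst 0; csub z x }"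

primrec mapM :: "('a \<Rightarrow> ('v, 'b) comp) \<Rightarrow> 'a list \<Rightarrow> ('v, 'b list) comp" where
  "mapM h [] = Return []"
| "mapM h (x # xs) = do { y \<leftarrow> h x; ys \<leftarrow> mapM h xs; Return (y # ys) }"

primrec foldM :: "('a \<Rightarrow> 's \<Rightarrow> ('v, 's) comp) \<Rightarrow> 'a list \<Rightarrow> 's \<Rightarrow> ('v, 's) comp" where
  "foldM h [] s = Return s"
| "foldM h (x # xs) s = do { s' \<leftarrow> h x s; foldM h xs s' }"


section \<open>Gaussian elimination\<close>

text \<open>Matrices are lists of rows.\<close>

primrec find_pivot :: "nat \<Rightarrow> 'v list list \<Rightarrow> ('v, ('v list \<times> 'v list list) option) comp" where
  "find_pivot c [] = Return None"
| "find_pivot c (r # rs) = do {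
     z \<leftarrow> is_zero (r ! c);
     if z then do {
       q \<leftarrow> find_pivot c rs;
       Return (map_option (\<lambda>(p, rest). (p, r # rest)) q) }
     else Return (Some (r, rs)) }"

definition clear_entry :: "nat \<Rightarrow> 'v list \<Rightarrow> 'v list \<Rightarrow> ('v, 'v list) comp" where
  "clear_entry c p r = mapM (\<lambda>(x, y). do { u \<leftarrow> cmul (r ! c) y; csub x u }) (zip r p)"

definition rref_column ::
  "nat \<Rightarrow> (nat \<times> 'v list) list \<times> 'v list list
     \<Rightarrow> ('v, (nat \<times> 'v list) list \<times> 'v list list) comp" where
  "rref_column c = (\<lambda>(piv, rest). do {
     q \<leftarrow> find_pivot c rest;
     case q of
       None \<Rightarrow> Return (piv, rest)
     | Some (p, rest') \<Rightarrow> do {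
         p' \<leftarrow> mapM (\<lambda>x. cdiv x (p ! c)) p;
         piv' \<leftarrow> mapM (\<lambda>(j, r). do { r' \<leftarrow> clear_entry c p' r; Return (j, r') }) piv;
         rest'' \<leftarrow> mapM (clear_entry c p') rest';
         Return (piv' @ [(c, p')], rest'') } })"

text \<open>The nonzero rows of the reduced row echelon form, each with its pivot column.\<close>

definition rref :: "nat \<Rightarrow> 'v list list \<Rightarrow> ('v, (nat \<times> 'v list) list) comp" where
  "rref ncols A = do { (piv, rest) \<leftarrow> foldM rref_column [0..<ncols] ([], A); Return piv }"

definition nullspace_basis :: "nat \<Rightarrow> (nat \<times> 'v list) list \<Rightarrow> ('v, 'v list list) comp" where
  "nullspace_basis ncols R =
     mapM (\<lambda>j. mapM (\<lambda>k. if k = j then cconst 1 else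
                 (case map_of R k of None \<Rightarrow> cconst 0 | Some r \<Rightarrow> cneg (r ! j))) [0..<ncols])
       (filter (\<lambda>j. j \<notin> fst ` set R) [0..<ncols])"


section \<open>Step 1: nondegeneracy\<close>

type_synonym 'v terms = "(monom \<times> 'v) list"

definition partial_terms :: "nat \<Rightarrow> 'v terms \<Rightarrow> ('v, 'v terms) comp" where
  "partial_terms i ts =
     mapM (\<lambda>(m, a). do { e \<leftarrow> cconst (of_nat (lookup m i)); b \<leftarrow> cmul e a; Return (m - single i 1, b) })
       (filter (\<lambda>(m, a). lookup m i \<noteq> 0) ts)"

definition coeff_of :: "'v terms \<Rightarrow> monom \<Rightarrow> ('v, 'v) comp" where
  "coeff_of ts m = (case map_of ts m of None \<Rightarrow> cconst 0 | Some a \<Rightarrow> Return a)"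

text \<open>The matrix of partial derivatives has one column per variable, so its pivot columns \<open>I\<close> are
  a maximal set of independent partial derivatives. For \<open>j \<notin> I\<close> the entries \<open>c\<^sub>i\<close> of column \<open>j\<close> give
  \<open>\<partial>\<^sub>j f = (\<Sum>i\<in>I. c\<^sub>i \<partial>\<^sub>i f)\<close>, that is, \<open>f\<close> is invariant under translation along
  \<open>e\<^sub>j - (\<Sum>i\<in>I. c\<^sub>i e\<^sub>i)\<close>. Taking these vectors and the \<open>e\<^sub>i\<close>, \<open>i \<in> I\<close>, as the columns of \<open>P\<close>, the form
  \<open>f(Py)\<close> does not involve \<open>y\<^sub>j\<close> for \<open>j \<notin> I\<close>, and hence equals \<open>f\<close> with \<open>x\<^sub>j = 0\<close> for \<open>j \<notin> I\<close>:
  its coefficients are read off from \<open>f\<close>.\<close>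

definition restrict_vars :: "nat list \<Rightarrow> 'v terms \<Rightarrow> 'v terms" where
  "restrict_vars I ts =
     map (\<lambda>(m, a). (\<Sum>k<length I. single k (lookup m (I ! k)), a))
       (filter (\<lambda>(m, a). keys m \<subseteq> set I) ts)"

definition reduce_form :: "nat \<Rightarrow> 'v terms \<Rightarrow> ('v, nat \<times> 'v terms) comp" where
  "reduce_form n ts = do {
     ps \<leftarrow> mapM (\<lambda>i. partial_terms i ts) [0..<n];
     A \<leftarrow> mapM (\<lambda>m. mapM (\<lambda>p. coeff_of p m) ps) (remdups (concat (map (map fst) ps)));
     R \<leftarrow> rref n A;
     let I = map fst R in
     Return (if length I = n then (n, ts) else (length I, restrict_vars I ts)) }"


section \<open>Step 2: center\<close>

definition monomials :: "nat \<Rightarrow> nat \<Rightarrow> monom list" where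
  "monomials n k = sorted_list_of_set {m. keys m \<subseteq> {..<n} \<and> mdeg m = k}"

text \<open>The unknown \<open>X\<^sub>a\<^sub>b\<close> is number \<open>a * n + b\<close>. There is one equation for each \<open>i < j\<close> and each
  monomial \<open>m\<close> of degree \<open>d - 2\<close>: the coefficient of \<open>m\<close> in \<open>(HX)\<^sub>i\<^sub>j - (HX)\<^sub>j\<^sub>i\<close> vanishes.\<close>

definition center_equation ::
  "nat \<Rightarrow> 'v terms list list \<Rightarrow> nat \<Rightarrow> nat \<Rightarrow> monom \<Rightarrow> ('v, 'v list) comp" where
  "center_equation n H i j m =
     mapM (\<lambda>(a, b).
         if b = j then coeff_of (H ! i ! a) m
         else if b = i then do { h \<leftarrow> coeff_of (H ! j ! a) m; cneg h }
         else cconst 0)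
       (List.product [0..<n] [0..<n])"

definition compute_center :: "nat \<Rightarrow> nat \<Rightarrow> 'v terms \<Rightarrow> ('v, 'v list list list) comp" where
  "compute_center n d ts = do {
     ps \<leftarrow> mapM (\<lambda>j. partial_terms j ts) [0..<n];
     H \<leftarrow> mapM (\<lambda>i. mapM (partial_terms i) ps) [0..<n];
     A \<leftarrow> mapM (\<lambda>((i, j), m). center_equation n H i j m)
       (List.product (filter (\<lambda>(i, j). i < j) (List.product [0..<n] [0..<n])) (monomials n (d - 2)));
     R \<leftarrow> rref (n * n) A;
     vs \<leftarrow> nullspace_basis (n * n) R;
     Return (map (\<lambda>v. map (\<lambda>a. map (\<lambda>b. v ! (a * n + b)) [0..<n]) [0..<n]) vs) }"


section \<open>Step 3: minimal polynomials and their gcd with the derivative\<close>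

definition mat_mult :: "nat \<Rightarrow> 'v list list \<Rightarrow> 'v list list \<Rightarrow> ('v, 'v list list) comp" where
  "mat_mult n A B =
     mapM (\<lambda>a. mapM (\<lambda>b. do {
         z \<leftarrow> cconst 0;
         foldM (\<lambda>k s. do { u \<leftarrow> cmul (A ! a ! k) (B ! k ! b); cadd s u }) [0..<n] z })
       [0..<n]) [0..<n]"

definition mat_one :: "nat \<Rightarrow> ('v, 'v list list) comp" where
  "mat_one n = mapM (\<lambda>a. mapM (\<lambda>b. cconst (if a = b then 1 else 0)) [0..<n]) [0..<n]"

text \<open>\<open>mat_powers n X k Q\<close> computes \<open>[Q, XQ, \<dots>, X\<^sup>kQ]\<close>.\<close>

primrec mat_powers ::
  "nat \<Rightarrow> 'v list list \<Rightarrow> nat \<Rightarrow> 'v list list \<Rightarrow> ('v, 'v list list list) comp" where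
  "mat_powers n X 0 Q = Return [Q]"
| "mat_powers n X (Suc k) Q = do {
     Q' \<leftarrow> mat_mult n X Q;
     Qs \<leftarrow> mat_powers n X k Q';
     Return (Q # Qs) }"

text \<open>Univariate polynomials are coefficient lists with the leading coefficient first. The first
  column \<open>k\<close> without pivot belongs to the first power \<open>X\<^sup>k\<close> that depends linearly on the preceding
  ones, and contains the coefficients of that dependence.\<close>

definition min_poly :: "nat \<Rightarrow> 'v list list \<Rightarrow> ('v, 'v list) comp" where
  "min_poly n X = do {
     Q \<leftarrow> mat_one n;
     Qs \<leftarrow> mat_powers n X n Q;
     R \<leftarrow> rref (n + 1) (map (\<lambda>(a, b). map (\<lambda>Q. Q ! a ! b) Qs) (List.product [0..<n] [0..<n]));
     let k = (LEAST k. k \<notin> fst ` set R) in do {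
     one \<leftarrow> cconst 1;
     cs \<leftarrow> mapM (\<lambda>i. cneg (snd (R ! i) ! k)) [0..<k];
     Return (one # rev cs) } }"

primrec strip :: "'v list \<Rightarrow> ('v, 'v list) comp" where
  "strip [] = Return []"
| "strip (x # xs) = do { z \<leftarrow> is_zero x; if z then strip xs else Return (x # xs) }"

definition poly_deriv :: "'v list \<Rightarrow> ('v, 'v list) comp" where
  "poly_deriv p = do {
     q \<leftarrow> mapM (\<lambda>i. do { e \<leftarrow> cconst (of_nat (length p - 1 - i)); cmul e (p ! i) }) [0..<length p - 1];
     strip q }"

definition division_step :: "'v list \<Rightarrow> 'v list \<Rightarrow> ('v, 'v list) comp" where
  "division_step b a = do {
     q \<leftarrow> cdiv (hd a) (hd b);
     us \<leftarrow> mapM (\<lambda>(x, y). do { u \<leftarrow> cmul q y; csub x u }) (zip (tl a) (tl b));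
     Return (us @ drop (length b) a) }"

definition poly_rem :: "'v list \<Rightarrow> 'v list \<Rightarrow> ('v, 'v list) comp" where
  "poly_rem a b = do {
     c \<leftarrow> foldM (\<lambda>_. division_step b) [0..<length a + 1 - length b] a;
     strip c }"

text \<open>The first argument bounds the number of divisions; the length of \<open>b\<close> suffices, because the
  remainders become strictly shorter.\<close>

primrec euclid :: "nat \<Rightarrow> 'v list \<Rightarrow> 'v list \<Rightarrow> ('v, 'v list) comp" where
  "euclid 0 a b = Return a"
| "euclid (Suc k) a b = (if b = [] then Return a else do { c \<leftarrow> poly_rem a b; euclid k b c })"

definition poly_gcd :: "'v list \<Rightarrow> 'v list \<Rightarrow> ('v, 'v list) comp" where
  "poly_gcd a b = do { g \<leftarrow> euclid (length b) a b; mapM (\<lambda>x. cdiv x (hd g)) g }"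


section \<open>The center-based criterion\<close>

record 'v outcome =
  red_vars :: nat
  red_form :: "'v terms"
  center_basis :: "'v list list list"
  min_polys :: "'v list list"
  gcds :: "'v list list"
  reports_diagonalizable :: bool

definition center_criterion :: "nat \<Rightarrow> nat \<Rightarrow> 'v terms \<Rightarrow> ('v, 'v outcome) comp" where
  "center_criterion n d ts = do {
     (r, g) \<leftarrow> reduce_form n ts;
     Xs \<leftarrow> compute_center r d g;
     if length Xs \<noteq> r then
       Return \<lparr>red_vars = r, red_form = g, center_basis = Xs, min_polys = [], gcds = [],
               reports_diagonalizable = False\<rparr>
     else do {
       ps \<leftarrow> mapM (min_poly r) Xs;
       gs \<leftarrow> mapM (\<lambda>p. do { p' \<leftarrow> poly_deriv p; poly_gcd p p' }) ps;
       Return \<lparr>red_vars = r, red_form = g, center_basis = Xs, min_polys = ps, gcds = gs,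
               reports_diagonalizable = (\<forall>q\<in>set gs. length q = 1)\<rparr> } }"

definition criterion_result :: "nat \<Rightarrow> nat \<Rightarrow> cpoly \<Rightarrow> complex outcome" where
  "criterion_result n d f = result (center_criterion n d (Poly_Mapping.items f))"

definition criterion_cost :: "nat \<Rightarrow> nat \<Rightarrow> cpoly \<Rightarrow> nat" where
  "criterion_cost n d f = cost (center_criterion n d (Poly_Mapping.items f))"

text \<open>What the three steps of the criterion have to produce when applied to \<open>f\<close>.\<close>

definition carries_out_criterion :: "nat \<Rightarrow> cpoly \<Rightarrow> complex outcome \<Rightarrow> bool" where
  "carries_out_criterion n f out \<longleftrightarrow>
    (let r = red_vars out;
         g = Poly_Mapping.the_value (red_form out);
         V = center_space r g;
         Xs = map (mat_of_rows_list r) (center_basis out);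
         ps = map (\<lambda>p. Poly (rev p)) (min_polys out);
         gs = map (\<lambda>q. Poly (rev q)) (gcds out)
     in
       (if partials_independent n f then r = n \<and> g = f else r < n) \<and>
       (\<exists>P\<in>carrier_mat n n. invertible_mat P \<and> lin_subst n P f = g) \<and>
       vars g \<subseteq> {..<r} \<and> nondegenerate r g \<and>
       distinct Xs \<and> vectorspace.basis class_ring V (set Xs) \<and>
       (if vectorspace.dim class_ring V \<noteq> r then \<not> reports_diagonalizable out
        else list_all2 is_min_poly Xs ps \<and>
             gs = map (\<lambda>p. gcd p (pderiv p)) ps \<and>
             (reports_diagonalizable out \<longleftrightarrow> (\<forall>p\<in>set ps. gcd p (pderiv p) = 1))))"

end

theory Submission
  imports Defs "Jordan_Normal_Form.Char_Poly"
begin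

text \<open>
  A program is analysed through its interpretations \<open>result\<close> and \<open>cost\<close>, which distribute over
  sequencing; \<open>result\<close> turns every program into an ordinary function on complex numbers, and
  \<open>cost\<close> into a sum over its loops. Correctness and cost are then proved separately for
  Gaussian elimination, on which all three steps rest, and for each step.

  Elimination (\<open>rref_correct\<close>) preserves the kernel of the matrix and delivers rows from which the
  kernel can be read off: the coordinates in the non-pivot columns are free and determine the others.

  Step 1. A form is invariant under translation along \<open>c\<close> iff \<open>\<Sum>\<^sub>i c\<^sub>i \<partial>\<^sub>i f = 0\<close>
  (\<open>invariant_along_iff\<close>), because the derivative of \<open>t \<mapsto> f (x + t c)\<close> is \<open>\<Sum>\<^sub>i c\<^sub>i \<partial>\<^sub>i f\<close> evaluated at
  \<open>x + t c\<close>. So the kernel of the matrix of partial derivatives consists of the directions along which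
  \<open>f\<close> is constant. Projecting along the kernel basis onto the pivot coordinates does not change \<open>f\<close>,
  which shows that \<open>f\<close> restricted to the pivot variables is \<open>f(Py)\<close> for an invertible \<open>P\<close>; and a direction
  of invariance of the restriction would be a kernel vector supported on pivot columns, hence zero
  (\<open>reduce_form_correct\<close>). Identities of polynomials are checked by evaluation, as a polynomial over the
  complex numbers is determined by its values (\<open>eval_eq_0_imp\<close>).

  Step 2. The linear system has one equation for every coefficient of \<open>(HX)\<^sub>i\<^sub>j - (HX)\<^sub>j\<^sub>i\<close>, and the
  coefficients of \<open>H\<close> live on monomials of degree \<open>d - 2\<close>. So its kernel is the center, and the null
  space vectors of elimination form a basis (\<open>compute_center_correct\<close>).

  Step 3. The powers \<open>X\<^sup>0, \<dots>, X\<^sup>n\<close> are linearly dependent by Cayley-Hamilton. The kernel vector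
  belonging to the first column without pivot is the monic annihilator of least degree
  (\<open>min_poly_correct\<close>). The Euclidean algorithm is correct since a chain of division steps subtracts a
  multiple of the divisor (\<open>poly_gcd_correct\<close>).

  The cost is dominated by eliminating the \<open>n\<^sup>2\<close> unknowns of the center from \<open>O(n\<^sup>2 M)\<close> equations, where
  \<open>M\<close> is the number of monomials of degree \<open>d - 2\<close>; this takes \<open>O(n\<^sup>6 M)\<close> operations. Step 1 takes
  \<open>O(n\<^sup>3 t)\<close> operations and step 3 takes \<open>O(n\<^sup>5)\<close> operations (\<open>criterion_cost_le\<close>). Bounding \<open>M\<close> by
  \<open>n\<^bsup>d-2\<^esup>\<close> gives the claimed bound and its polynomiality for fixed \<open>d\<close>; for fixed \<open>n\<close> the bound
  \<open>M \<le> (d - 1)\<^sup>n\<close> is used, and \<open>t\<close> is bounded in the same two ways.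
\<close>

section \<open>Results and costs of computations\<close>

lemma result_bind [simp]: "result (comp_bind c h) = result (h (result c))"
  by (induction c) auto

lemma cost_bind [simp]: "cost (comp_bind c h) = cost c + cost (h (result c))"
  by (induction c) auto

lemma result_ops [simp]:
  "result (cconst a) = a" "result (cadd x y) = x + y" "result (csub x y) = x - y"
  "result (cmul x y) = x * y" "result (cdiv x y) = x / y" "result (is_zero x) = (x = 0)"
  "result (cneg x) = - x"
  by (simp_all add: cconst_def cadd_def csub_def cmul_def cdiv_def is_zero_def cneg_def)

lemma cost_ops [simp]:
  "cost (cconst a) = 0" "cost (cadd x y) = 1" "cost (csub x y) = 1"
  "cost (cmul x y) = 1" "cost (cdiv x y) = 1" "cost (is_zero x) = 1"
  "cost (cneg x) = 1"
  by (simp_all add: cconst_def cadd_def csub_def cmul_def cdiv_def is_zero_def cneg_def)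

lemma result_mapM [simp]: "result (mapM h xs) = map (\<lambda>x. result (h x)) xs"
  by (induction xs) auto

lemma cost_mapM [simp]: "cost (mapM h xs) = (\<Sum>x\<leftarrow>xs. cost (h x))"
  by (induction xs) auto

lemma result_foldM [simp]: "result (foldM h xs s) = fold (\<lambda>x s. result (h x s)) xs s"
  by (induction xs arbitrary: s) auto

lemma cost_foldM_append [simp]:
  "cost (foldM h (xs @ ys) s) = cost (foldM h xs s) + cost (foldM h ys (result (foldM h xs s)))"
  by (induction xs arbitrary: s) auto

lemma sum_list_le_length:
  fixes h :: "'a \<Rightarrow> nat"
  assumes "\<And>x. x \<in> set xs \<Longrightarrow> h x \<le> B"
  shows "(\<Sum>x\<leftarrow>xs. h x) \<le> length xs * B"
  using assms by (induction xs) (auto simp: add_mono)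

section \<open>Gaussian elimination and null spaces\<close>

lemma result_find_pivot:
  "case result (find_pivot c rs) of
     None \<Rightarrow> \<forall>r\<in>set rs. r ! c = 0
   | Some (p, rest) \<Rightarrow> p ! c \<noteq> 0 \<and> set rs = insert p (set rest) \<and> length rs = Suc (length rest)"
  by (induction rs) (auto split: option.splits simp: insert_commute)

lemma cost_find_pivot: "cost (find_pivot c rs) \<le> length rs"
  by (induction rs) auto

lemma length_clear_entry [simp]: "length (result (clear_entry c p r)) = min (length r) (length p)"
  by (simp add: clear_entry_def)

lemma nth_clear_entry:
  "l < length r \<Longrightarrow> l < length p \<Longrightarrow> result (clear_entry c p r) ! l = r ! l - r ! c * p ! l"
  by (simp add: clear_entry_def)

lemma cost_clear_entry: "cost (clear_entry c p r) \<le> 2 * length p"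
proof -
  have "cost (clear_entry c p r) \<le> length (zip r p) * 2"
    unfolding clear_entry_def cost_mapM by (rule sum_list_le_length) auto
  also have "\<dots> \<le> 2 * length p" by simp
  finally show ?thesis .
qed

definition row_form :: "nat \<Rightarrow> complex list \<Rightarrow> (nat \<Rightarrow> complex) \<Rightarrow> complex" where
  "row_form N r x = (\<Sum>l<N. r ! l * x l)"

text \<open>The rows that are not yet pivot rows vanish in all processed columns, also in those of the
  pivots. After the last column they are zero, so the pivot rows alone carry the kernel. The number of
  rows does not grow, which bounds the cost of each column.\<close>

definition rref_inv ::
  "nat \<Rightarrow> complex list list \<Rightarrow> nat \<Rightarrow> (nat \<times> complex list) list \<times> complex list list \<Rightarrow> bool" where
  "rref_inv N A c = (\<lambda>(piv, rest).
     sorted_wrt (<) (map fst piv) \<and>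
     (\<forall>(j, r)\<in>set piv. j < c \<and> length r = N \<and> (\<forall>l<j. r ! l = 0) \<and>
        (\<forall>(j', r')\<in>set piv. r ! j' = (if j' = j then 1 else 0))) \<and>
     (\<forall>r\<in>set rest. length r = N \<and> (\<forall>l<c. r ! l = 0)) \<and>
     (\<forall>x. (\<forall>r\<in>snd ` set piv \<union> set rest. row_form N r x = 0) \<longleftrightarrow> (\<forall>r\<in>set A. row_form N r x = 0)) \<and>
     length piv + length rest = length A)"

lemma row_form_clear_entry:
  assumes "length r = N" "length p = N"
  shows "row_form N (result (clear_entry c p r)) x = row_form N r x - r ! c * row_form N p x"
  unfolding row_form_def using assms
  by (simp add: nth_clear_entry sum_distrib_left sum_subtractf[symmetric] algebra_simps)

lemma rref_inv_step:
  assumes inv: "rref_inv N A c S" and c: "c < N"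
  shows "rref_inv N A (Suc c) (result (rref_column c S))"
    and "cost (rref_column c S) \<le> length A * (2 * N + 1)"
proof -
  obtain piv rest where S: "S = (piv, rest)" by force
  note I = inv[unfolded S rref_inv_def prod.case]
  have sorted: "sorted_wrt (<) (map fst piv)"
    and piv: "\<And>j r. (j, r) \<in> set piv \<Longrightarrow> j < c \<and> length r = N"
    and piv0: "\<And>j r l. (j, r) \<in> set piv \<Longrightarrow> l < j \<Longrightarrow> r ! l = 0"
    and piv1: "\<And>j r j' r'. (j, r) \<in> set piv \<Longrightarrow> (j', r') \<in> set piv \<Longrightarrow> r ! j' = (if j' = j then 1 else 0)"
    and rest: "\<And>r. r \<in> set rest \<Longrightarrow> length r = N" "\<And>r l. r \<in> set rest \<Longrightarrow> l < c \<Longrightarrow> r ! l = 0"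
    and ker: "\<And>x. (\<forall>r\<in>snd ` set piv \<union> set rest. row_form N r x = 0) \<longleftrightarrow> (\<forall>r\<in>set A. row_form N r x = 0)"
    and len: "length piv + length rest = length A"
    using I by fast+
  have "rref_inv N A (Suc c) (result (rref_column c S)) \<and>
    cost (rref_column c S) \<le> length A * (2 * N + 1)"
  proof (cases "result (find_pivot c rest)")
    case None
    have z: "\<forall>r\<in>set rest. r ! c = 0" using result_find_pivot[of rest c] None by simp
    have "cost (rref_column c S) \<le> length rest" using cost_find_pivot[of c rest] None
      by (simp add: S rref_column_def)
    also have "\<dots> \<le> length A * (2 * N + 1)" using len by (simp add: trans_le_add2)
    finally show ?thesis using I None z len
      by (auto simp: S rref_column_def rref_inv_def less_Suc_eq)
  next
    case (Some q)
    obtain p rest' where q: "q = (p, rest')" by force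
    have p0: "p ! c \<noteq> 0" and rs: "set rest = insert p (set rest')" "length rest = Suc (length rest')"
      using result_find_pivot[of rest c] Some q by auto
    define p' where "p' = map (\<lambda>x. x / p ! c) p"
    define cl where "cl = (\<lambda>r. result (clear_entry c p' r))"
    have lp: "length p = N" "length p' = N" using rest rs by (auto simp: p'_def)
    have p'l: "p' ! l = 0" if "l < c" for l using rest(2)[of p l] rs that c lp by (simp add: p'_def)
    have p'c: "p' ! c = 1" using c lp p0 by (simp add: p'_def)
    have res: "result (rref_column c S) =
      (map (\<lambda>(j, r). (j, cl r)) piv @ [(c, p')], map cl rest')"
      by (simp add: S rref_column_def Some q p'_def cl_def case_prod_unfold)
    have cll: "length (cl r) = N" if "length r = N" for r using that lp by (simp add: cl_def)
    have cln: "cl r ! l = r ! l - r ! c * p' ! l" if "length r = N" "l < N" for r l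
      using that lp by (simp add: cl_def nth_clear_entry)
    have clf: "row_form N (cl r) x = row_form N r x - r ! c * row_form N p' x" if "length r = N" for r x
      using that lp by (simp add: cl_def row_form_clear_entry)
    have pf: "row_form N p' x = row_form N p x / p ! c" for x
      using lp by (simp add: row_form_def p'_def sum_divide_distrib)
    have cost: "cost (rref_column c S) \<le> length A * (2 * N + 1)"
    proof -
      have "cost (rref_column c S) = cost (find_pivot c rest) + N
          + (\<Sum>(j, r)\<leftarrow>piv. cost (clear_entry c p' r)) + (\<Sum>r\<leftarrow>rest'. cost (clear_entry c p' r))"
        using lp by (simp add: S rref_column_def Some q p'_def case_prod_unfold sum_list_triv)
      also have "\<dots> \<le> length rest + N + length piv * (2 * N) + length rest' * (2 * N)"
        using cost_clear_entry[of c p'] lp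
        by (intro add_mono cost_find_pivot sum_list_le_length order_refl) auto
      also have "\<dots> \<le> length A * (2 * N + 1)"
      proof -
        have "length A = Suc (length piv + length rest')" using len rs by simp
        thus ?thesis using rs by (simp add: algebra_simps)
      qed
      finally show ?thesis .
    qed
    have pl: "j < N" if "(j, r) \<in> set piv" for j r using piv[OF that] c by simp
    have 1: "sorted_wrt (<) (map fst (map (\<lambda>(j, r). (j, cl r)) piv @ [(c, p')]))"
      using sorted piv by (auto simp: sorted_wrt_append case_prod_unfold comp_def)
    have 2: "\<forall>(j, r)\<in>set (map (\<lambda>(j, r). (j, cl r)) piv @ [(c, p')]). j < Suc c \<and> length r = N \<and>
        (\<forall>l<j. r ! l = 0) \<and>
        (\<forall>(j', r')\<in>set (map (\<lambda>(j, r). (j, cl r)) piv @ [(c, p')]). r ! j' = (if j' = j then 1 else 0))"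
    proof -
      have old: "j < Suc c \<and> length (cl r) = N \<and> (\<forall>l<j. cl r ! l = 0) \<and> cl r ! c = 0 \<and>
          (\<forall>(j', r')\<in>set piv. cl r ! j' = (if j' = j then 1 else 0))"
        if jr: "(j, r) \<in> set piv" for j r
      proof (intro conjI)
        note r = piv[OF jr]
        show "j < Suc c" "length (cl r) = N" using r cll by auto
        show "\<forall>l<j. cl r ! l = 0" using r c p'l piv0[OF jr] by (simp add: cln)
        show "cl r ! c = 0" using r c p'c by (simp add: cln)
        show "\<forall>(j', r')\<in>set piv. cl r ! j' = (if j' = j then 1 else 0)"
        proof safe
          fix j' r' assume j': "(j', r') \<in> set piv"
          thus "cl r ! j' = (if j' = j then 1 else 0)"
            using r piv1[OF jr j'] piv[OF j'] c p'l by (simp add: cln)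
        qed
      qed
      have new: "length p' = N \<and> (\<forall>l<c. p' ! l = 0) \<and> p' ! c = 1" using lp p'l p'c by blast
      have nc: "j < c" if "(j, r) \<in> set piv" for j r using piv[OF that] by blast
      have ball: "(\<forall>(j, r)\<in>set (map (\<lambda>(j, r). (j, cl r)) piv @ [(c, p')]). P j r) \<longleftrightarrow>
          P c p' \<and> (\<forall>(j, r)\<in>set piv. P j (cl r))" for P by auto
      have 1: "\<forall>(j', r')\<in>set piv. p' ! j' = (if j' = c then 1 else 0)"
      proof safe
        fix j' r' assume "(j', r') \<in> set piv"
        from nc[OF this] show "p' ! j' = (if j' = c then 1 else 0)" using p'l by simp
      qed
      have 2: "\<forall>(j, r)\<in>set piv. j < Suc c \<and> length (cl r) = N \<and> (\<forall>l<j. cl r ! l = 0) \<and>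
          cl r ! c = (if c = j then 1 else 0) \<and>
          (\<forall>(j', r')\<in>set piv. cl r ! j' = (if j' = j then 1 else 0))"
      proof (rule ballI, unfold case_prod_unfold, goal_cases)
        case (1 x)
        hence "(fst x, snd x) \<in> set piv" by simp
        from old[OF this] nc[OF this] show ?case by (simp add: case_prod_unfold)
      qed
      show ?thesis unfolding ball using new 1 2 by simp
    qed
    have 3: "\<forall>r\<in>set (map cl rest'). length r = N \<and> (\<forall>l<Suc c. r ! l = 0)"
      using rest rs c p'l p'c by (auto simp: cll cln less_Suc_eq)
    have 4: "(\<forall>r\<in>snd ` set (map (\<lambda>(j, r). (j, cl r)) piv @ [(c, p')]) \<union> set (map cl rest').
        row_form N r x = 0) \<longleftrightarrow> (\<forall>r\<in>set A. row_form N r x = 0)" for x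
    proof -
      have "(\<forall>r\<in>snd ` set (map (\<lambda>(j, r). (j, cl r)) piv @ [(c, p')]) \<union> set (map cl rest').
          row_form N r x = 0) \<longleftrightarrow> (\<forall>r\<in>snd ` set piv \<union> set rest. row_form N r x = 0)"
        using piv rest p0 by (auto simp: rs clf pf ball_Un image_Un)
      thus ?thesis using ker by simp
    qed
    show ?thesis unfolding res rref_inv_def prod.case
      using 1 2 3 4 cost len rs by (intro conjI allI; simp)
  qed
  thus "rref_inv N A (Suc c) (result (rref_column c S))"
    "cost (rref_column c S) \<le> length A * (2 * N + 1)" by auto
qed
lemma rref_fold_inv:
  assumes "\<forall>r\<in>set A. length r = N" "c \<le> N"
  shows "rref_inv N A c (result (foldM rref_column [0..<c] ([], A))) \<and>
    cost (foldM rref_column [0..<c] ([], A)) \<le> c * (length A * (2 * N + 1))"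
  using assms(2)
proof (induction c)
  case 0
  show ?case using assms(1) by (simp add: rref_inv_def)
next
  case (Suc c)
  hence IH: "rref_inv N A c (result (foldM rref_column [0..<c] ([], A)))"
    "cost (foldM rref_column [0..<c] ([], A)) \<le> c * (length A * (2 * N + 1))" by auto
  show ?case using rref_inv_step[OF IH(1)] Suc.prems IH(2)
    by (auto simp: add.commute[of _ "c * _"] intro: add_mono)
qed

lemma cost_rref:
  assumes "\<forall>r\<in>set A. length r = N"
  shows "cost (rref N A) \<le> N * (length A * (2 * N + 1))"
  using rref_fold_inv[OF assms order_refl] by (simp add: rref_def case_prod_unfold)

text \<open>That a pivot row vanishes before its pivot makes the null space vector of a free column express
  this column by preceding ones.\<close>

locale reduced_rows =
  fixes N :: nat and A :: "complex list list" and R :: "(nat \<times> complex list) list"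
  assumes sorted_pivots: "sorted_wrt (<) (map fst R)"
    and pivot_less: "(j, r) \<in> set R \<Longrightarrow> j < N"
    and length_row: "(j, r) \<in> set R \<Longrightarrow> length r = N"
    and nth_pivot: "(j, r) \<in> set R \<Longrightarrow> (j', r') \<in> set R \<Longrightarrow> r ! j' = (if j' = j then 1 else 0)"
    and nth_before_pivot: "(j, r) \<in> set R \<Longrightarrow> l < j \<Longrightarrow> r ! l = 0"
    and kernel_iff: "(\<forall>r\<in>snd ` set R. row_form N r x = 0) \<longleftrightarrow> (\<forall>r\<in>set A. row_form N r x = 0)"

lemma rref_correct:
  assumes "\<forall>r\<in>set A. length r = N"
  shows "reduced_rows N A (result (rref N A))"
proof -
  define S where "S = result (foldM rref_column [0..<N] ([], A))"
  obtain piv rest where S: "S = (piv, rest)" by force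
  have inv: "rref_inv N A N (piv, rest)"
    using rref_fold_inv[OF assms order_refl] S by (simp add: S_def)
  note I = inv[unfolded rref_inv_def prod.case]
  have res: "result (rref N A) = piv"
    using S by (simp add: rref_def S_def)
  have "row_form N r x = 0" if "r \<in> set rest" for r x
    using I that by (simp add: row_form_def)
  moreover have "r ! j' = (if j' = j then 1 else 0)"
    if "(j, r) \<in> set piv" "(j', r') \<in> set piv" for j r j' r'
    using I that by fast
  ultimately show ?thesis unfolding res
    using I by unfold_locales (auto simp: ball_Un simp del: if_split)
qed

context reduced_rows
begin

definition "pivots = fst ` set R"
definition "free = filter (\<lambda>j. j \<notin> pivots) [0..<N]"

lemma distinct_pivots: "distinct (map fst R)"
  using sorted_pivots strict_sorted_iff by blast

lemma pivots_less: "j \<in> pivots \<Longrightarrow> j < N"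
  using pivot_less by (auto simp: pivots_def)

lemma set_free: "set free = {..<N} - pivots"
  by (auto simp: free_def)

lemma row_form_row:
  assumes "(j, r) \<in> set R"
  shows "row_form N r x = x j + (\<Sum>l\<in>set free. r ! l * x l)"
proof -
  have "row_form N r x = (\<Sum>l\<in>pivots. r ! l * x l) + (\<Sum>l\<in>set free. r ! l * x l)"
    unfolding row_form_def set_free using pivots_less
    by (subst sum.subset_diff[of pivots "{..<N}"]) auto
  also have "(\<Sum>l\<in>pivots. r ! l * x l) = (\<Sum>l\<in>pivots. if l = j then x l else 0)"
    using nth_pivot[OF assms] by (intro sum.cong) (auto simp: pivots_def)
  also have "\<dots> = x j" using assms by (force simp: pivots_def)
  finally show ?thesis .
qed

definition kernel :: "(nat \<Rightarrow> complex) \<Rightarrow> bool" where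
  "kernel x \<longleftrightarrow> (\<forall>r\<in>set A. row_form N r x = 0)"

lemma kernel_rows:
  "kernel x \<longleftrightarrow> (\<forall>(j, r)\<in>set R. x j = - (\<Sum>l\<in>set free. r ! l * x l))"
  unfolding kernel_def kernel_iff[symmetric]
  by (auto simp: row_form_row eq_neg_iff_add_eq_0)

text \<open>The \<open>j\<close>-th null space vector as a function of the coordinate.\<close>

definition basis_entry :: "nat \<Rightarrow> nat \<Rightarrow> complex" where
  "basis_entry j k = (if k = j then 1 else
     (case map_of R k of None \<Rightarrow> 0 | Some r \<Rightarrow> - (r ! j)))"

lemma basis_entry_free: "k \<in> set free \<Longrightarrow> basis_entry j k = (if k = j then 1 else 0)"
  by (auto simp: basis_entry_def set_free pivots_def map_of_eq_None_iff[symmetric] split: option.splits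
      dest: map_of_SomeD)

lemma basis_entry_pivot:
  "(k, r) \<in> set R \<Longrightarrow> j \<in> set free \<Longrightarrow> basis_entry j k = - (r ! j)"
  using distinct_pivots by (force simp: basis_entry_def set_free pivots_def)

text \<open>A kernel vector is determined by its free coordinates, which can be arbitrary.\<close>

lemma kernel_expansion:
  "kernel x \<longleftrightarrow> (\<forall>k<N. x k = (\<Sum>j\<in>set free. x j * basis_entry j k))"
proof
  assume x: "kernel x"
  show "\<forall>k<N. x k = (\<Sum>j\<in>set free. x j * basis_entry j k)"
  proof (intro allI impI)
    fix k assume k: "k < N"
    show "x k = (\<Sum>j\<in>set free. x j * basis_entry j k)"
    proof (cases "k \<in> pivots")
      case True
      then obtain r where r: "(k, r) \<in> set R" by (auto simp: pivots_def)
      have "x k = - (\<Sum>l\<in>set free. r ! l * x l)" using x r unfolding kernel_rows by auto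
      also have "\<dots> = (\<Sum>j\<in>set free. x j * basis_entry j k)"
        unfolding sum_negf[symmetric] by (intro sum.cong) (auto simp: basis_entry_pivot[OF r])
      finally show ?thesis .
    next
      case False
      hence "k \<in> set free" using k by (simp add: set_free)
      thus ?thesis by (simp add: basis_entry_free if_distrib cong: if_cong)
    qed
  qed
next
  assume x: "\<forall>k<N. x k = (\<Sum>j\<in>set free. x j * basis_entry j k)"
  show "kernel x"
    unfolding kernel_rows
  proof safe
    fix j r assume r: "(j, r) \<in> set R"
    have "x j = (\<Sum>l\<in>set free. x l * basis_entry l j)" using x pivot_less[OF r] by blast
    also have "\<dots> = - (\<Sum>l\<in>set free. r ! l * x l)"
      unfolding sum_negf[symmetric] by (intro sum.cong) (auto simp: basis_entry_pivot[OF r])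
    finally show "x j = - (\<Sum>l\<in>set free. r ! l * x l)" .
  qed
qed

lemma kernel_basis_entry:
  assumes "j \<in> set free"
  shows "kernel (basis_entry j)"
  unfolding kernel_expansion using assms
  by (simp add: basis_entry_free if_distrib[of "\<lambda>c. c * _"] cong: if_cong)

text \<open>In other words, the pivot columns are linearly independent.\<close>

lemma kernel_eq_0:
  assumes "kernel x" "\<And>j. j \<in> set free \<Longrightarrow> x j = 0" "k < N"
  shows "x k = 0"
  using assms by (simp add: kernel_expansion)

lemma result_nullspace_basis:
  "result (nullspace_basis N R) = map (\<lambda>j. map (basis_entry j) [0..<N]) free"
proof -
  have "result (if P then cconst 1 else Q) = (if P then 1 else result Q)" for P Q by simp
  thus ?thesis
    by (auto simp: nullspace_basis_def free_def pivots_def basis_entry_def split: option.splits)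
qed

lemma cost_nullspace_basis: "cost (nullspace_basis N R) \<le> N * N"
proof -
  have "cost (if k = j then cconst 1 else case map_of R k of None \<Rightarrow> cconst 0 | Some r \<Rightarrow> cneg (r ! j)) \<le> 1"
    for k j by (auto split: option.splits)
  hence "cost (nullspace_basis N R) \<le> length free * (length [0..<N] * 1)"
    unfolding nullspace_basis_def cost_mapM pivots_def[symmetric] free_def[symmetric]
    by (intro sum_list_le_length)
  also have "\<dots> \<le> N * N" using length_filter_le[of _ "[0..<N]"] by (auto simp: free_def)
  finally show ?thesis .
qed

end

section \<open>Evaluating polynomials\<close>

definition mono_val :: "(nat \<Rightarrow> 'a::comm_semiring_1) \<Rightarrow> monom \<Rightarrow> 'a" where
  "mono_val x m = (\<Prod>i\<in>keys m. x i ^ lookup m i)"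

definition eval :: "(nat \<Rightarrow> complex) \<Rightarrow> cpoly \<Rightarrow> complex" where
  "eval x f = (\<Sum>m\<in>keys f. lookup f m * mono_val x m)"

lemma mono_val_superset:
  assumes "keys m \<subseteq> S" "finite S"
  shows "mono_val x m = (\<Prod>i\<in>S. x i ^ lookup m i)"
  unfolding mono_val_def by (rule prod.mono_neutral_left) (use assms in \<open>auto simp: in_keys_iff\<close>)

lemma mono_val_add: "mono_val x (a + b) = mono_val x a * mono_val x b"
proof -
  have "keys (a + b) \<subseteq> keys a \<union> keys b" by (rule keys_add)
  thus ?thesis
    by (simp add: mono_val_superset[of _ "keys a \<union> keys b"] lookup_add power_add prod.distrib)
qed

lemma eval_add [simp]: "eval x (f + g) = eval x f + eval x g"
  unfolding eval_def
  by (rule setsum_keys_plus_distrib) (auto simp: algebra_simps)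

lemma eval_0 [simp]: "eval x 0 = 0"
  by (simp add: eval_def)

lemma eval_sum [simp]: "eval x (sum h S) = (\<Sum>i\<in>S. eval x (h i))"
  by (induction S rule: infinite_finite_induct) auto

lemma eval_single: "eval x (single m a) = a * mono_val x m"
  by (simp add: eval_def)

lemma sum_singles: "(\<Sum>m\<in>keys f. single m (lookup f m)) = f"
  by (rule poly_mapping_eqI)
    (auto simp: lookup_sum lookup_single "when_def" in_keys_iff)

lemma eval_mult [simp]: "eval x (f * g) = eval x f * eval x g"
proof -
  have "eval x (f * g) = eval x ((\<Sum>a\<in>keys f. single a (lookup f a)) * (\<Sum>b\<in>keys g. single b (lookup g b)))"
    by (simp add: sum_singles)
  also have "\<dots> = (\<Sum>a\<in>keys f. \<Sum>b\<in>keys g. eval x (single (a + b) (lookup f a * lookup g b)))"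
    by (simp add: sum_product mult_single)
  also have "\<dots> = eval x f * eval x g"
    unfolding eval_single eval_def sum_product
    by (intro sum.cong refl) (simp add: mono_val_add algebra_simps)
  finally show ?thesis .
qed

lemma eval_1 [simp]: "eval x 1 = 1"
  using eval_single[of x 0 1] by (simp add: mono_val_def)

lemma eval_const [simp]: "eval x (const c) = c"
  by (simp add: eval_single mono_val_def)

lemma eval_var [simp]: "eval x (single (single i (Suc 0)) 1) = x i"
  by (simp add: eval_single mono_val_def)

lemma eval_power [simp]: "eval x (f ^ k) = eval x f ^ k"
  by (induction k) auto

lemma eval_prod [simp]: "eval x (prod h S) = (\<Prod>i\<in>S. eval x (h i))"
  by (induction S rule: infinite_finite_induct) auto

lemma eval_diff [simp]: "eval x (f - g) = eval x f - eval x g"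
  using eval_add[of x "f - g" g] by simp

lemma eval_cong: "(\<And>i. i \<in> vars f \<Longrightarrow> x i = y i) \<Longrightarrow> eval x f = eval y f"
  unfolding eval_def mono_val_def vars_def
  by (intro sum.cong refl arg_cong2[where f = "(*)"] prod.cong arg_cong2[where f = "(^)"]) auto

lemma eval_lin_subst:
  assumes "vars f \<subseteq> {..<n}"
  shows "eval y (lin_subst n P f) = eval (\<lambda>i. \<Sum>j<n. P $$ (i, j) * y j) f"
proof -
  have "keys m \<subseteq> {..<n}" if "m \<in> keys f" for m using assms that by (auto simp: vars_def)
  thus ?thesis unfolding lin_subst_def eval_def[of _ f]
    by (simp add: mono_val_superset[of _ "{..<n}"])
qed

lemma base_digits_unique:
  fixes a b :: "nat \<Rightarrow> nat"
  assumes "\<And>i. i < n \<Longrightarrow> a i < D" "\<And>i. i < n \<Longrightarrow> b i < D"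
    and "(\<Sum>i<n. a i * D ^ i) = (\<Sum>i<n. b i * D ^ i)" "i < n"
  shows "a i = b i"
  using assms
proof (induction n arbitrary: a b i)
  case (Suc n)
  define s where "s a = (\<Sum>i<n. a (Suc i) * D ^ i)" for a :: "nat \<Rightarrow> nat"
  have split: "(\<Sum>i<Suc n. a i * D ^ i) = a 0 + D * s a" for a
    unfolding s_def by (simp add: sum.lessThan_Suc_shift sum_distrib_left algebra_simps del: sum.lessThan_Suc)
  have eq: "a 0 + D * s a = b 0 + D * s b" using Suc.prems(3) unfolding split .
  have "(a 0 + D * s a) mod D = a 0" "(b 0 + D * s b) mod D = b 0"
    using Suc.prems(1,2)[of 0] by auto
  hence 0: "a 0 = b 0" using eq by metis
  show ?case
  proof (cases i)
    case 0
    thus ?thesis using \<open>a 0 = b 0\<close> by simp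
  next
    case (Suc k)
    have "D > 0" using Suc.prems(1)[of 0] by simp
    hence "s a = s b" using eq 0 by simp
    hence "a (Suc k) = b (Suc k)" unfolding s_def
      using Suc.IH[of "\<lambda>i. a (Suc i)" "\<lambda>i. b (Suc i)" k] Suc.prems Suc by auto
    thus ?thesis using Suc by simp
  qed
qed simp

text \<open>Kronecker substitution: with \<open>D\<close> larger than all exponents, \<open>x\<^sub>i = z\<^bsup>D^i\<^esup>\<close> maps different monomials to
  different powers of \<open>z\<close>, and a univariate polynomial with infinitely many roots is zero.\<close>

lemma eval_eq_0_imp:
  assumes "\<And>x. eval x f = 0"
  shows "f = 0"
proof -
  have fin: "finite (vars f)" by (simp add: vars_def)
  then obtain n where n: "vars f \<subseteq> {..<n}" using finite_nat_bounded by blast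
  define D where "D = Suc (\<Sum>m\<in>keys f. \<Sum>i\<in>keys m. lookup m i)"
  have D: "lookup m i < D" if "m \<in> keys f" for m i
  proof (cases "i \<in> keys m")
    case True
    have "lookup m i \<le> (\<Sum>i\<in>keys m. lookup m i)" using True by (intro member_le_sum) auto
    also have "\<dots> \<le> (\<Sum>m\<in>keys f. \<Sum>i\<in>keys m. lookup m i)" using that by (intro member_le_sum) auto
    finally show ?thesis by (simp add: D_def)
  qed (simp add: D_def in_keys_iff)
  define code where "code m = (\<Sum>i<n. lookup m i * D ^ i)" for m :: monom
  have inj: "inj_on code (keys f)"
  proof (rule inj_onI)
    fix m m' assume m: "m \<in> keys f" "m' \<in> keys f" "code m = code m'"
    show "m = m'"
    proof (rule poly_mapping_eqI)
      fix i
      show "lookup m i = lookup m' i"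
      proof (cases "i < n")
        case True
        thus ?thesis using base_digits_unique[of n "lookup m" D "lookup m'" i] m D
          by (simp add: code_def)
      next
        case False
        hence "i \<notin> keys m" "i \<notin> keys m'" using n m by (auto simp: vars_def)
        thus ?thesis by (simp add: in_keys_iff)
      qed
    qed
  qed
  define p where "p = (\<Sum>m\<in>keys f. Polynomial.monom (lookup f m) (code m))"
  have "poly p z = 0" for z
  proof -
    have "mono_val (\<lambda>i. z ^ (D ^ i)) m = z ^ code m" if "m \<in> keys f" for m
    proof -
      have "keys m \<subseteq> {..<n}" using n that by (auto simp: vars_def)
      hence "mono_val (\<lambda>i. z ^ (D ^ i)) m = (\<Prod>i<n. z ^ (lookup m i * D ^ i))"
        by (simp add: mono_val_superset power_mult[symmetric] mult.commute)
      thus ?thesis by (simp add: code_def power_sum)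
    qed
    hence "poly p z = eval (\<lambda>i. z ^ (D ^ i)) f"
      by (simp add: p_def eval_def poly_sum poly_monom)
    thus ?thesis using assms by simp
  qed
  hence p: "p = 0" by (simp add: poly_all_0_iff_0[symmetric])
  have "lookup f m = 0" if m: "m \<in> keys f" for m
  proof -
    have "0 = coeff p (code m)" by (simp add: p)
    also have "\<dots> = (\<Sum>m'\<in>keys f. if m' = m then lookup f m' else 0)"
      unfolding p_def coeff_sum
      by (intro sum.cong refl) (use inj m in \<open>auto dest: inj_onD\<close>)
    also have "\<dots> = lookup f m" using m by simp
    finally show ?thesis by simp
  qed
  thus "f = 0" by (metis in_keys_iff poly_mapping_eqI lookup_zero)
qed

lemma eval_ext: "(\<And>x. eval x f = eval x g) \<Longrightarrow> f = g"
  using eval_eq_0_imp[of "f - g"] by simp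

section \<open>Derivatives and directions of invariance\<close>

text \<open>Unlike in the definition, no truncated difference of exponents occurs here, and the formula
  holds for all \<open>m\<close>.\<close>

lemma lookup_partial:
  "lookup (partial i f) m = of_nat (lookup m i + 1) * lookup f (m + single i 1)"
proof -
  have *: "m' - single i 1 = m \<longleftrightarrow> m' = m + single i 1" if "lookup m' i \<noteq> 0" for m' :: monom
  proof
    assume "m' - single i 1 = m"
    thus "m' = m + single i 1" using that
      by (intro poly_mapping_eqI) (auto simp: lookup_add lookup_minus lookup_single "when_def")
  qed simp
  have "lookup (partial i f) m =
    (\<Sum>m'\<in>keys f. if m' = m + single i 1 then of_nat (lookup m' i) * lookup f m' else 0)"
    unfolding partial_def lookup_sum
    by (intro sum.cong refl) (use * in \<open>force simp: lookup_single "when_def"\<close>)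
  also have "\<dots> = of_nat (lookup m i + 1) * lookup f (m + single i 1)"
    by (auto simp: lookup_add in_keys_iff)
  finally show ?thesis .
qed

lemma keys_partial: "m \<in> keys (partial i f) \<Longrightarrow> m + single i 1 \<in> keys f"
  by (auto simp: in_keys_iff lookup_partial)

lemma keys_add_nat: "keys (a + b :: monom) = keys a \<union> keys b"
  by (auto simp: in_keys_iff lookup_add)

definition on_line :: "(nat \<Rightarrow> complex) \<Rightarrow> (nat \<Rightarrow> complex) \<Rightarrow> cpoly \<Rightarrow> complex poly" where
  "on_line x c f = (\<Sum>m\<in>keys f. Polynomial.smult (lookup f m) (mono_val (\<lambda>i. [:x i, c i:]) m))"

lemma poly_mono_val: "poly (mono_val x m) t = mono_val (\<lambda>i. poly (x i) t) m"
  by (simp add: mono_val_def poly_prod)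

lemma poly_on_line: "poly (on_line x c f) t = eval (\<lambda>i. x i + t * c i) f"
  by (simp add: on_line_def eval_def poly_sum poly_mono_val)

lemma pderiv_mono_val:
  assumes "keys m \<subseteq> {..<n}"
  shows "pderiv (mono_val (\<lambda>i. [:x i, c i:]) m) =
    (\<Sum>i<n. Polynomial.smult (c i * of_nat (lookup m i)) (mono_val (\<lambda>i. [:x i, c i:]) (m - single i 1)))"
proof -
  define X where "X i = [:x i, c i:]" for i
  have "pderiv (mono_val X m) = (\<Sum>i<n. (\<Prod>j\<in>{..<n} - {i}. X j ^ lookup m j) * pderiv (X i ^ lookup m i))"
    using assms by (simp add: mono_val_superset pderiv_prod)
  also have "\<dots> = (\<Sum>i<n. Polynomial.smult (c i * of_nat (lookup m i)) (mono_val X (m - single i 1)))"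
  proof (intro sum.cong refl)
    fix i assume i: "i \<in> {..<n}"
    have "keys (m - single i 1) \<subseteq> {..<n}"
      using assms by (auto simp: in_keys_iff lookup_minus subset_eq)
    hence "mono_val X (m - single i 1) = X i ^ (lookup m i - 1) * (\<Prod>j\<in>{..<n} - {i}. X j ^ lookup m j)"
      using i by (simp add: mono_val_superset prod.remove[of _ i] lookup_minus lookup_single_not_eq)
    moreover have "pderiv (X i) = [:c i:]" by (simp add: X_def pderiv_pCons)
    ultimately show "(\<Prod>j\<in>{..<n} - {i}. X j ^ lookup m j) * pderiv (X i ^ lookup m i) =
        Polynomial.smult (c i * of_nat (lookup m i)) (mono_val X (m - single i 1))"
    proof (cases "lookup m i")
      case (Suc k)
      have "pderiv (X i ^ Suc k) = Polynomial.smult (c i * of_nat (Suc k)) (X i ^ k)"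
        unfolding pderiv_power_Suc using \<open>pderiv (X i) = [:c i:]\<close> by (simp add: mult.commute)
      thus ?thesis using Suc \<open>mono_val X (m - single i 1) = _\<close> by (simp add: mult.commute del: power_Suc)
    qed simp
  qed
  finally show ?thesis by (simp add: X_def[abs_def])
qed

lemma pderiv_on_line:
  assumes "vars f \<subseteq> {..<n}"
  shows "pderiv (on_line x c f) = on_line x c (\<Sum>i<n. const (c i) * partial i f)"
proof -
  have lin_add: "on_line x c (f + g) = on_line x c f + on_line x c g" for f g
    unfolding on_line_def by (rule setsum_keys_plus_distrib) (auto simp: smult_add_left)
  have lin_sum: "on_line x c (sum h S) = (\<Sum>i\<in>S. on_line x c (h i))" for h and S :: "'b set"
    by (induction S rule: infinite_finite_induct) (auto simp: lin_add, auto simp: on_line_def)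
  have single: "on_line x c (single m a) = Polynomial.smult a (mono_val (\<lambda>i. [:x i, c i:]) m)" for m a
    by (simp add: on_line_def)
  have "on_line x c (\<Sum>i<n. const (c i) * partial i f) =
    (\<Sum>i<n. \<Sum>m\<in>keys f. Polynomial.smult (lookup f m) (Polynomial.smult (c i * of_nat (lookup m i))
       (mono_val (\<lambda>i. [:x i, c i:]) (m - single i 1))))"
    by (simp add: lin_sum partial_def sum_distrib_left mult_single single algebra_simps)
  also have "\<dots> = (\<Sum>m\<in>keys f. Polynomial.smult (lookup f m) (\<Sum>i<n. Polynomial.smult (c i * of_nat (lookup m i))
       (mono_val (\<lambda>i. [:x i, c i:]) (m - single i 1))))"
    by (subst sum.swap) (simp add: smult_sum2)
  also have "\<dots> = pderiv (on_line x c f)"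
  proof -
    have "keys m \<subseteq> {..<n}" if "m \<in> keys f" for m using assms that by (auto simp: vars_def)
    thus ?thesis by (simp add: on_line_def pderiv_sum pderiv_smult pderiv_mono_val[where n = n])
  qed
  finally show ?thesis by simp
qed

definition invariant_along :: "(nat \<Rightarrow> complex) \<Rightarrow> cpoly \<Rightarrow> bool" where
  "invariant_along c f \<longleftrightarrow> (\<forall>x t. eval (\<lambda>i. x i + t * c i) f = eval x f)"

text \<open>Both directions follow from the chain rule: \<open>t \<mapsto> f (x + t c)\<close> is a univariate polynomial, which
  in characteristic zero is constant iff its derivative vanishes.\<close>

lemma invariant_along_iff:
  assumes "vars f \<subseteq> {..<n}"
  shows "invariant_along c f \<longleftrightarrow> (\<Sum>i<n. const (c i) * partial i f) = 0"
proof
  let ?D = "\<Sum>i<n. const (c i) * partial i f"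
  assume inv: "invariant_along c f"
  show "?D = 0"
  proof (rule eval_eq_0_imp)
    fix x
    have "poly (on_line x c f) t = poly [:eval x f:] t" for t
      using inv by (simp add: poly_on_line invariant_along_def)
    hence "on_line x c f = [:eval x f:]" by (subst poly_eq_poly_eq_iff[symmetric]) (rule ext)
    hence "pderiv (on_line x c f) = 0" by simp
    hence "poly (on_line x c ?D) 0 = 0" by (simp only: pderiv_on_line[OF assms] poly_0)
    thus "eval x ?D = 0" by (simp add: poly_on_line del: eval_sum)
  qed
next
  assume D: "(\<Sum>i<n. const (c i) * partial i f) = 0"
  show "invariant_along c f"
    unfolding invariant_along_def
  proof (intro allI)
    fix x t
    have "pderiv (on_line x c f) = 0" by (simp add: pderiv_on_line[OF assms] D) (simp add: on_line_def)
    then obtain a where "on_line x c f = [:a:]" by (auto simp: pderiv_eq_0_iff elim: degree_eq_zeroE)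
    hence "poly (on_line x c f) t = poly (on_line x c f) 0" by simp
    thus "eval (\<lambda>i. x i + t * c i) f = eval x f" by (simp add: poly_on_line)
  qed
qed

lemma eval_diff_directions:
  assumes "\<And>j. j \<in> S \<Longrightarrow> invariant_along (c j) f" "finite S"
  shows "eval (\<lambda>i. x i + (\<Sum>j\<in>S. t j * c j i)) f = eval x f"
  using assms(2,1)
proof (induction S)
  case (insert j S)
  have "eval (\<lambda>i. x i + (\<Sum>j\<in>insert j S. t j * c j i)) f
    = eval (\<lambda>i. (x i + (\<Sum>j\<in>S. t j * c j i)) + t j * c j i) f"
    using insert by (simp add: algebra_simps)
  also have "\<dots> = eval x f"
    using insert by (simp add: invariant_along_def)
  finally show ?case .
qed simp

section \<open>Invertible substitutions and nondegeneracy\<close>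

lemma invertible_matI:
  fixes P :: "complex mat"
  assumes P: "P \<in> carrier_mat n n"
    and inj: "\<And>v. (\<And>i. i < n \<Longrightarrow> (\<Sum>k<n. P $$ (i, k) * v k) = 0) \<Longrightarrow> (\<And>k. k < n \<Longrightarrow> v k = 0)"
  shows "invertible_mat P"
proof -
  have "det P \<noteq> 0"
  proof
    assume "det P = 0"
    then obtain v where v: "v \<in> carrier_vec n" "v \<noteq> 0\<^sub>v n" "P *\<^sub>v v = 0\<^sub>v n"
      using det_0_iff_vec_prod_zero_field[OF P] by auto
    have "(\<Sum>k<n. P $$ (i, k) * v $ k) = 0" if "i < n" for i
    proof -
      have "(P *\<^sub>v v) $ i = (\<Sum>k<n. P $$ (i, k) * v $ k)"
        using P v(1) that by (simp add: scalar_prod_def atLeast0LessThan)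
      thus ?thesis using v that by simp
    qed
    hence "v $ k = 0" if "k < n" for k using inj[of "\<lambda>k. v $ k"] that by blast
    thus False using v by (auto simp: vec_eq_iff)
  qed
  from det_non_zero_imp_unit[OF P this, of "()"]
  obtain Q where "Q \<in> carrier_mat n n" "Q * P = 1\<^sub>m n" "P * Q = 1\<^sub>m n"
    by (auto simp: Units_def ring_mat_simps)
  thus ?thesis using P
    by (auto simp: invertible_mat_def inverts_mat_def square_mat.simps)
qed

lemma invertible_matE:
  fixes P :: "complex mat"
  assumes P: "P \<in> carrier_mat n n" and inv: "invertible_mat P"
  obtains Q where "\<And>i k. i < n \<Longrightarrow> k < n \<Longrightarrow> (\<Sum>j<n. P $$ (i, j) * Q j k) = (if i = k then 1 else 0)"
    and "\<And>i k. i < n \<Longrightarrow> k < n \<Longrightarrow> (\<Sum>j<n. Q i j * P $$ (j, k)) = (if i = k then 1 else 0)"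
proof -
  obtain Q where Q: "P * Q = 1\<^sub>m (dim_row P)" "Q * P = 1\<^sub>m (dim_row Q)"
    using inv by (auto simp: invertible_mat_def inverts_mat_def)
  have "dim_col Q = n" using arg_cong[OF Q(1), of dim_col] P by simp
  moreover have "dim_row Q = n" using arg_cong[OF Q(2), of dim_col] P by simp
  ultimately have Qc: "Q \<in> carrier_mat n n" by auto
  show ?thesis
  proof
    fix i k assume "i < n" "k < n"
    thus "(\<Sum>j<n. P $$ (i, j) * Q $$ (j, k)) = (if i = k then 1 else 0)"
      using arg_cong[OF Q(1), of "\<lambda>M. M $$ (i, k)"] P Qc by (simp add: scalar_prod_def atLeast0LessThan)
    show "(\<Sum>j<n. Q $$ (i, j) * P $$ (j, k)) = (if i = k then 1 else 0)"
      using arg_cong[OF Q(2), of "\<lambda>M. M $$ (i, k)"] P Qc \<open>i < n\<close> \<open>k < n\<close>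
      by (simp add: scalar_prod_def atLeast0LessThan)
  qed
qed

lemma invertible_mat_surj:
  fixes P :: "complex mat"
  assumes "P \<in> carrier_mat n n" "invertible_mat P"
  obtains y where "\<And>i. i < n \<Longrightarrow> (\<Sum>j<n. P $$ (i, j) * y j) = x i"
proof -
  obtain Q where Q: "\<And>i k. i < n \<Longrightarrow> k < n \<Longrightarrow> (\<Sum>j<n. P $$ (i, j) * Q j k) = (if i = k then 1 else 0)"
    using invertible_matE[OF assms] by metis
  show ?thesis
  proof
    fix i assume i: "i < n"
    have "(\<Sum>j<n. P $$ (i, j) * (\<Sum>k<n. Q j k * x k)) = (\<Sum>k<n. (\<Sum>j<n. P $$ (i, j) * Q j k) * x k)"
      by (simp add: sum_distrib_left sum_distrib_right mult.assoc) (rule sum.swap)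
    also have "\<dots> = x i" using i by (simp add: Q if_distrib[of "\<lambda>c. c * _"] cong: if_cong)
    finally show "(\<Sum>j<n. P $$ (i, j) * (\<Sum>k<n. Q j k * x k)) = x i" .
  qed
qed

text \<open>If \<open>g(Py)\<close> does not involve \<open>y\<^sub>j\<close>, then \<open>g\<close> is constant along the \<open>j\<close>-th column of \<open>P\<close>.\<close>

lemma nondegenerateI:
  assumes vars: "vars g \<subseteq> {..<r}"
    and rigid: "\<And>c. invariant_along c g \<Longrightarrow> (\<And>k. k < r \<Longrightarrow> c k = 0)"
  shows "nondegenerate r g"
  unfolding nondegenerate_def
proof (rule notI, elim bexE conjE exE)
  fix P j assume P: "P \<in> carrier_mat r r" "invertible_mat P" and j: "j < r" "j \<notin> vars (lin_subst r P g)"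
  define c where "c = (\<lambda>i. P $$ (i, j))"
  have "invariant_along c g"
    unfolding invariant_along_def
  proof (intro allI)
    fix x t
    obtain y where y: "\<And>i. i < r \<Longrightarrow> (\<Sum>j<r. P $$ (i, j) * y j) = x i"
      using invertible_mat_surj[OF P] by metis
    have "eval (\<lambda>i. x i + t * c i) g = eval (\<lambda>i. \<Sum>k<r. P $$ (i, k) * (y(j := y j + t)) k) g"
    proof (rule eval_cong)
      fix i assume "i \<in> vars g"
      hence i: "i < r" using vars by auto
      have "(\<Sum>k<r. P $$ (i, k) * (y(j := y j + t)) k)
        = (\<Sum>k<r. P $$ (i, k) * y k + (if k = j then P $$ (i, k) * t else 0))"
        by (intro sum.cong) (auto simp: algebra_simps)
      also have "\<dots> = x i + t * c i" using j(1) by (simp add: sum.distrib y[OF i] c_def)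
      finally show "x i + t * c i = (\<Sum>k<r. P $$ (i, k) * (y(j := y j + t)) k)" by simp
    qed
    also have "\<dots> = eval (y(j := y j + t)) (lin_subst r P g)" by (simp add: eval_lin_subst[OF vars])
    also have "\<dots> = eval y (lin_subst r P g)" using j(2) by (intro eval_cong) auto
    also have "\<dots> = eval x g" unfolding eval_lin_subst[OF vars] using y vars by (intro eval_cong) auto
    finally show "eval (\<lambda>i. x i + t * c i) g = eval x g" .
  qed
  hence c: "P $$ (i, j) = 0" if "i < r" for i using rigid[of c i] that by (simp add: c_def)
  obtain Q where "\<And>i k. i < r \<Longrightarrow> k < r \<Longrightarrow> (\<Sum>j<r. Q i j * P $$ (j, k)) = (if i = k then 1 else 0)"
    using invertible_matE[OF P] by metis
  from this[OF j(1) j(1)] show False by (simp add: c)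
qed

section \<open>Term lists\<close>

text \<open>Zero coefficients are allowed in the list, but repeated monomials are not.\<close>

definition represents :: "complex terms \<Rightarrow> cpoly \<Rightarrow> bool" where
  "represents ts f \<longleftrightarrow> distinct (map fst ts) \<and> (\<forall>(m, a)\<in>set ts. lookup f m = a) \<and> keys f \<subseteq> fst ` set ts"

lemma represents_map_of:
  assumes "represents ts f"
  shows "lookup f m = (case map_of ts m of None \<Rightarrow> 0 | Some a \<Rightarrow> a)"
proof (cases "map_of ts m")
  case None
  hence "m \<notin> keys f" using assms by (auto simp: represents_def map_of_eq_None_iff)
  thus ?thesis using None by (simp add: in_keys_iff)
next
  case (Some a)
  thus ?thesis using assms by (auto simp: represents_def dest: map_of_SomeD)
qed

lemma represents_the_value: "represents ts f \<Longrightarrow> Poly_Mapping.the_value ts = f"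
  by (rule poly_mapping_eqI) (simp add: lookup_the_value represents_map_of)

lemma represents_items: "represents (Poly_Mapping.items f) f"
  by (auto simp: represents_def Poly_Mapping.items_def comp_def image_image)

lemma represents_the_valueI: "distinct (map fst ts) \<Longrightarrow> represents ts (Poly_Mapping.the_value ts)"
  by (auto simp: represents_def lookup_the_value in_keys_iff map_of_eq_None_iff
     split: option.splits) (force dest: map_of_SomeD)

lemma length_items: "length (Poly_Mapping.items f) = card (keys f)"
  by (simp add: Poly_Mapping.items_def)

lemma coeff_of [simp]: "represents ts f \<Longrightarrow> result (coeff_of ts m) = lookup f m" "cost (coeff_of ts' m) = 0"
  by (auto simp: coeff_of_def represents_map_of split: option.splits)

lemma result_partial_terms:
  "result (partial_terms i ts) = map (\<lambda>(m, a). (m - single i 1, of_nat (lookup m i) * a))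
     (filter (\<lambda>(m, a). lookup m i \<noteq> 0) ts)"
  by (simp add: partial_terms_def case_prod_unfold)

lemma monom_minus_plus: "lookup m i \<noteq> 0 \<Longrightarrow> m - single i 1 + single i 1 = (m :: monom)"
  by (intro poly_mapping_eqI) (auto simp: lookup_add lookup_minus lookup_single "when_def")

lemma represents_partial_terms:
  assumes "represents ts f"
  shows "represents (result (partial_terms i ts)) (partial i f)"
proof -
  have "distinct (map fst (filter (\<lambda>(m, a). lookup m i \<noteq> 0) ts))"
    using assms by (simp add: represents_def distinct_map_filter)
  moreover have "inj_on (\<lambda>m. m - single i 1) (fst ` set (filter (\<lambda>(m, a). lookup m i \<noteq> 0) ts))"
    by (intro inj_onI) (auto, metis One_nat_def monom_minus_plus not_gr_zero)
  ultimately have "distinct (map (\<lambda>m. m - single i 1) (map fst (filter (\<lambda>(m, a). lookup m i \<noteq> 0) ts)))"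
    by (subst distinct_map) simp
  hence 1: "distinct (map fst (result (partial_terms i ts)))"
    by (simp add: result_partial_terms comp_def case_prod_unfold)
  have 2: "lookup (partial i f) m = a" if ma: "(m, a) \<in> set (result (partial_terms i ts))" for m a
  proof -
    obtain m' a' where m': "(m', a') \<in> set ts" "lookup m' i \<noteq> 0" "m = m' - single i 1"
      "a = of_nat (lookup m' i) * a'"
      using ma by (auto simp: result_partial_terms)
    have "lookup f m' = a'" using assms m'(1) by (auto simp: represents_def)
    thus ?thesis using m' monom_minus_plus[OF m'(2)] by (simp add: lookup_partial lookup_minus)
  qed
  have 3: "m \<in> fst ` set (result (partial_terms i ts))" if m: "m \<in> keys (partial i f)" for m
  proof -
    have "m + single i 1 \<in> keys f" using m by (rule keys_partial)
    then obtain a where "(m + single i 1, a) \<in> set ts" using assms by (auto simp: represents_def)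
    hence "(m, of_nat (lookup m i + 1) * a) \<in> set (result (partial_terms i ts))"
      by (auto simp: result_partial_terms lookup_add intro!: image_eqI[of _ _ "(m + single i 1, a)"])
    thus ?thesis by force
  qed
  show ?thesis using 1 2 3 by (auto simp: represents_def)
qed

lemma length_partial_terms: "length (result (partial_terms i ts)) \<le> length ts"
  by (simp add: result_partial_terms)

lemma cost_partial_terms: "cost (partial_terms i (ts :: complex terms)) \<le> length ts"
proof -
  have "cost (partial_terms i ts) \<le> length (filter (\<lambda>(m, a). lookup m i \<noteq> 0) ts) * 1"
    unfolding partial_terms_def cost_mapM by (rule sum_list_le_length) auto
  also have "\<dots> \<le> length ts" by simp
  finally show ?thesis .
qed

lemma eval_represents:
  assumes "represents ts f"
  shows "eval x f = (\<Sum>(m, a)\<leftarrow>ts. a * mono_val x m)"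
proof -
  have "eval x f = (\<Sum>m\<in>fst ` set ts. lookup f m * mono_val x m)"
    unfolding eval_def using assms
    by (intro sum.mono_neutral_left) (auto simp: represents_def in_keys_iff)
  also have "\<dots> = (\<Sum>m\<leftarrow>map fst ts. lookup f m * mono_val x m)"
    using assms by (subst sum_list_distinct_conv_sum_set) (auto simp: represents_def)
  also have "\<dots> = (\<Sum>(m, a)\<leftarrow>ts. a * mono_val x m)"
    unfolding map_map using assms
    by (intro arg_cong[of _ _ sum_list] map_cong) (auto simp: represents_def)
  finally show ?thesis .
qed

lemma lookup_const_mult: "lookup (const c * p) m = c * lookup p m"
  by (simp add: mult_map_scale_conv_mult[symmetric] Poly_Mapping.map.rep_eq "when_def")

section \<open>Reduction to a nondegenerate form\<close>

lemma mono_val_zero: "i \<in> keys m \<Longrightarrow> x i = 0 \<Longrightarrow> mono_val x m = 0"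
  by (auto simp: mono_val_def in_keys_iff intro!: prod_zero bexI[of _ i] zero_power)

text \<open>The point whose coordinate number \<open>I ! k\<close> is \<open>y k\<close> and whose other coordinates vanish. Restricting
  a polynomial to the variables in \<open>I\<close> amounts to evaluating it at such points.\<close>

definition spread :: "nat list \<Rightarrow> (nat \<Rightarrow> complex) \<Rightarrow> nat \<Rightarrow> complex" where
  "spread I y i = (\<Sum>k<length I. if I ! k = i then y k else 0)"

lemma spread_nth: "distinct I \<Longrightarrow> k < length I \<Longrightarrow> spread I y (I ! k) = y k"
  by (simp add: spread_def nth_eq_iff_index_eq cong: if_cong)

lemma spread_notin: "i \<notin> set I \<Longrightarrow> spread I y i = 0"
  by (auto simp: spread_def intro!: sum.neutral)

definition restrict_monom :: "nat list \<Rightarrow> monom \<Rightarrow> monom" where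
  "restrict_monom I m = (\<Sum>k<length I. single k (lookup m (I ! k)))"

lemma lookup_restrict_monom:
  "lookup (restrict_monom I m) k = (if k < length I then lookup m (I ! k) else 0)"
  by (simp add: restrict_monom_def lookup_sum lookup_single "when_def")

lemma keys_restrict_monom: "keys (restrict_monom I m) \<subseteq> {..<length I}"
  by (auto simp: in_keys_iff lookup_restrict_monom split: if_splits)

lemma prod_nth_distinct:
  assumes "distinct I"
  shows "(\<Prod>k<length I. h (I ! k)) = (\<Prod>i\<in>set I. h i)"
  by (rule prod.reindex_bij_betw) (rule bij_betw_nth[OF assms], auto)

lemma sum_nth_distinct:
  assumes "distinct I"
  shows "(\<Sum>k<length I. h (I ! k)) = (\<Sum>i\<in>set I. h i)"
  by (rule sum.reindex_bij_betw) (rule bij_betw_nth[OF assms], auto)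

lemma mono_val_restrict_monom:
  assumes "distinct I" "keys m \<subseteq> set I"
  shows "mono_val y (restrict_monom I m) = mono_val (spread I y) m"
proof -
  have "mono_val y (restrict_monom I m) = (\<Prod>k<length I. spread I y (I ! k) ^ lookup m (I ! k))"
    using keys_restrict_monom[of I m] assms(1)
    by (simp add: mono_val_superset lookup_restrict_monom spread_nth)
  also have "\<dots> = mono_val (spread I y) m"
    using assms by (simp add: prod_nth_distinct[of I "\<lambda>i. spread I y i ^ lookup m i"] mono_val_superset)
  finally show ?thesis .
qed

lemma mdeg_superset: "keys m \<subseteq> S \<Longrightarrow> finite S \<Longrightarrow> mdeg m = (\<Sum>i\<in>S. lookup m i)"
  unfolding mdeg_def by (rule sum.mono_neutral_left) (auto simp: in_keys_iff)

lemma mdeg_restrict_monom: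
  assumes "distinct I" "keys m \<subseteq> set I"
  shows "mdeg (restrict_monom I m) = mdeg m"
  using keys_restrict_monom[of I m] assms
  by (simp add: mdeg_superset lookup_restrict_monom sum_nth_distinct)

lemma restrict_vars_eq:
  "restrict_vars I ts = map (\<lambda>(m, a). (restrict_monom I m, a)) (filter (\<lambda>(m, a). keys m \<subseteq> set I) ts)"
  by (simp add: restrict_vars_def restrict_monom_def)

lemma restrict_vars_correct:
  assumes I: "distinct I" and f: "represents ts f"
  defines "g \<equiv> Poly_Mapping.the_value (restrict_vars I ts)"
  shows "represents (restrict_vars I ts) g"
    and "eval y g = eval (spread I y) f"
    and "homogeneous n d f \<Longrightarrow> homogeneous (length I) d g"
proof -
  let ?F = "filter (\<lambda>(m, a). keys m \<subseteq> set I) ts"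
  have inj: "inj_on (restrict_monom I) (fst ` set ?F)"
  proof (rule inj_onI, rule poly_mapping_eqI)
    fix m m' i assume m: "m \<in> fst ` set ?F" "m' \<in> fst ` set ?F" "restrict_monom I m = restrict_monom I m'"
    show "lookup m i = lookup m' i"
    proof (cases "i \<in> set I")
      case True
      then obtain k where "k < length I" "I ! k = i" by (auto simp: in_set_conv_nth)
      thus ?thesis using m(3) by (metis lookup_restrict_monom)
    next
      case False
      hence "i \<notin> keys m" "i \<notin> keys m'" using m by auto
      thus ?thesis by (simp add: in_keys_iff)
    qed
  qed
  have "distinct (map fst ?F)" using f by (simp add: represents_def distinct_map_filter)
  hence "distinct (map (restrict_monom I) (map fst ?F))" using inj by (subst distinct_map) simp
  hence "distinct (map fst (restrict_vars I ts))"
    by (simp add: restrict_vars_eq comp_def case_prod_unfold)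
  thus rep: "represents (restrict_vars I ts) g" unfolding g_def by (rule represents_the_valueI)
  have "eval (spread I y) f = (\<Sum>(m, a)\<leftarrow>?F. a * mono_val (spread I y) m)" for y
  proof -
    have z: "mono_val (spread I y) m = 0" if nk: "\<not> keys m \<subseteq> set I" for m
    proof -
      obtain i where "i \<in> keys m" "i \<notin> set I" using nk by blast
      thus ?thesis using mono_val_zero[of i m "spread I y"] spread_notin[of i I y] by simp
    qed
    show ?thesis unfolding eval_represents[OF f]
      by (rule sum_list_map_filter[symmetric]) (use z in \<open>simp add: case_prod_unfold\<close>)
  qed
  also have "(\<Sum>(m, a)\<leftarrow>?F. a * mono_val (spread I y) m) = eval y g" for y
    unfolding eval_represents[OF rep] restrict_vars_eq map_map
    by (intro arg_cong[of _ _ sum_list] map_cong) (auto simp: mono_val_restrict_monom I)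
  finally show "eval y g = eval (spread I y) f" by simp
  show "homogeneous (length I) d g" if h: "homogeneous n d f"
  proof -
    have "keys m \<subseteq> {..<length I} \<and> mdeg m = d" if m: "m \<in> keys g" for m
    proof -
      obtain a where a: "(m, a) \<in> set (restrict_vars I ts)" using rep m by (auto simp: represents_def)
      hence "a = lookup g m" using rep by (auto simp: represents_def)
      obtain m' where m': "(m', a) \<in> set ts" "keys m' \<subseteq> set I" "m = restrict_monom I m'"
        using a by (auto simp: restrict_vars_eq)
      have "lookup f m' = a" using m'(1) f by (auto simp: represents_def)
      hence "m' \<in> keys f" using m \<open>a = lookup g m\<close> by (simp add: in_keys_iff)
      thus ?thesis using h m' I keys_restrict_monom[of I m']
        by (simp add: homogeneous_def mdeg_restrict_monom)
    qed
    thus ?thesis by (auto simp: homogeneous_def vars_def)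
  qed
qed

text \<open>The matrix that the program \<open>reduce_form\<close> eliminates.\<close>

definition partials_matrix :: "nat \<Rightarrow> complex terms \<Rightarrow> complex list list" where
  "partials_matrix n ts = (let ps = map (\<lambda>i. result (partial_terms i ts)) [0..<n] in
     map (\<lambda>m. map (\<lambda>p. result (coeff_of p m)) ps) (remdups (concat (map (map fst) ps))))"

lemma partials_matrix_rows:
  assumes "r \<in> set (partials_matrix n ts)"
  shows "length r = n"
  using assms by (auto simp: partials_matrix_def Let_def)

lemma length_partials_matrix: "length (partials_matrix n ts) \<le> n * length ts"
proof -
  have "length (partials_matrix n ts) \<le> (\<Sum>i\<leftarrow>[0..<n]. length (result (partial_terms i ts)))"
    unfolding partials_matrix_def Let_def
    by (simp, rule order_trans[OF length_remdups_leq]) (simp add: length_concat comp_def)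
  also have "\<dots> \<le> length [0..<n] * length ts" by (rule sum_list_le_length) (rule length_partial_terms)
  finally show ?thesis by simp
qed

lemma partials_matrix_kernel:
  assumes f: "represents ts f"
  shows "(\<forall>r\<in>set (partials_matrix n ts). row_form n r x = 0) \<longleftrightarrow>
    (\<Sum>i<n. const (x i) * partial i f) = 0"
proof -
  let ?ms = "\<Union>i<n. fst ` set (result (partial_terms i ts))"
  note rep = represents_partial_terms[OF f]
  have "set (partials_matrix n ts) = (\<lambda>m. map (\<lambda>i. lookup (partial i f) m) [0..<n]) ` ?ms"
    using coeff_of(1)[OF rep] by (force simp: partials_matrix_def Let_def)
  hence "(\<forall>r\<in>set (partials_matrix n ts). row_form n r x = 0) \<longleftrightarrow>
    (\<forall>m\<in>?ms. (\<Sum>i<n. lookup (partial i f) m * x i) = 0)"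
    by (simp add: row_form_def)
  also have "\<dots> \<longleftrightarrow> (\<forall>m. (\<Sum>i<n. lookup (partial i f) m * x i) = 0)"
  proof -
    have "lookup (partial i f) m = 0" if "m \<notin> ?ms" "i < n" for m i
    proof -
      have "m \<notin> fst ` set (result (partial_terms i ts))" using that by simp
      hence "m \<notin> keys (partial i f)" using rep[of i] unfolding represents_def by blast
      thus ?thesis by (simp add: in_keys_iff)
    qed
    hence "(\<Sum>i<n. lookup (partial i f) m * x i) = 0" if "m \<notin> ?ms" for m
      using that by (intro sum.neutral) auto
    thus ?thesis by blast
  qed
  also have "\<dots> \<longleftrightarrow> (\<Sum>i<n. const (x i) * partial i f) = 0"
    by (simp add: poly_mapping_eq_iff fun_eq_iff lookup_sum lookup_const_mult mult.commute[of "lookup _ _"])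
  finally show ?thesis .
qed

lemma cost_reduce_form:
  fixes ts :: "complex terms"
  shows "cost (reduce_form n ts) \<le> n * length ts + n * (n * length ts * (2 * n + 1))"
proof -
  have A: "result (mapM (\<lambda>m. mapM (\<lambda>p. coeff_of p m) (map (\<lambda>i. result (partial_terms i ts)) [0..<n]))
      (remdups (concat (map (map fst) (map (\<lambda>i. result (partial_terms i ts)) [0..<n])))))
    = partials_matrix n ts"
    by (simp add: partials_matrix_def Let_def)
  have "cost (reduce_form n ts) = (\<Sum>i\<leftarrow>[0..<n]. cost (partial_terms i ts)) + cost (rref n (partials_matrix n ts))"
    unfolding reduce_form_def by (simp add: A[simplified] sum_list_triv Let_def)
  also have "\<dots> \<le> length [0..<n] * length ts + n * (length (partials_matrix n ts) * (2 * n + 1))"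
    by (intro add_mono sum_list_le_length cost_partial_terms cost_rref) (auto simp: partials_matrix_rows)
  also have "\<dots> \<le> n * length ts + n * (n * length ts * (2 * n + 1))"
    by (auto intro!: add_mono mult_mono length_partials_matrix)
  finally show ?thesis .
qed

lemma result_reduce_form:
  "result (reduce_form n ts) = (let I = map fst (result (rref n (partials_matrix n ts))) in
     if length I = n then (n, ts) else (length I, restrict_vars I ts))"
  by (simp add: reduce_form_def partials_matrix_def Let_def comp_def)

text \<open>The columns of \<open>P\<close> are the unit vectors of the pivot variables followed by the kernel basis. Since
  \<open>f\<close> is constant along the kernel, the coordinates belonging to the kernel basis drop out of \<open>f(Py)\<close>,
  and what remains is \<open>f\<close> at points that are supported on the pivot variables.\<close>

theorem reduce_form_correct:
  assumes h: "homogeneous n d f" and f: "represents ts f"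
  obtains r gts g where "result (reduce_form n ts) = (r, gts)" "represents gts g"
    "homogeneous r d g" "length gts \<le> length ts" "r \<le> n"
    "if partials_independent n f then r = n \<and> g = f else r < n"
    "\<exists>P\<in>carrier_mat n n. invertible_mat P \<and> lin_subst n P f = g"
    "nondegenerate r g"
proof -
  define A where "A = partials_matrix n ts"
  define R where "R = result (rref n A)"
  define I where "I = map fst R"
  have vf: "vars f \<subseteq> {..<n}" using h by (simp add: homogeneous_def)
  interpret reduced_rows n A R
    unfolding R_def by (rule rref_correct) (auto simp: A_def partials_matrix_rows)
  have ker: "kernel c \<longleftrightarrow> (\<Sum>i<n. const (c i) * partial i f) = 0" for c
    unfolding kernel_def unfolding A_def by (rule partials_matrix_kernel[OF f])
  have ker_inv: "kernel c \<longleftrightarrow> invariant_along c f" for c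
    unfolding ker by (rule invariant_along_iff[OF vf, symmetric])
  have I: "distinct I" "set I = pivots"
    using distinct_pivots by (simp_all add: I_def pivots_def)
  have df: "distinct free" by (simp add: free_def)
  have len: "length I + length free = n"
  proof -
    have "length I = card pivots" using distinct_card[OF I(1)] I(2) by simp
    moreover have "length free = card ({..<n} - pivots)" using distinct_card[OF df] by (simp add: set_free)
    moreover have "pivots \<subseteq> {..<n}" using pivots_less by auto
    moreover from card_mono[OF _ this] have "card pivots \<le> n" by simp
    ultimately show ?thesis by (simp add: card_Diff_subset finite_subset)
  qed
  have indep: "partials_independent n f \<longleftrightarrow> length I = n"
  proof
    assume pi: "partials_independent n f"
    have "free = []"
    proof (rule ccontr)
      assume "free \<noteq> []"
      then obtain j where j: "j \<in> set free" by (cases free) auto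
      have "basis_entry j j = 0" using pi kernel_basis_entry[OF j] j
        unfolding ker partials_independent_def by (auto simp: set_free)
      thus False by (simp add: basis_entry_def)
    qed
    thus "length I = n" using len by simp
  next
    assume "length I = n"
    hence "free = []" using len by simp
    thus "partials_independent n f" unfolding partials_independent_def ker[symmetric]
      using kernel_eq_0 by simp
  qed
  have res: "result (reduce_form n ts) = (if length I = n then (n, ts) else (length I, restrict_vars I ts))"
    by (simp add: result_reduce_form I_def R_def A_def Let_def)
  show ?thesis
  proof (cases "length I = n")
    case True
    hence "free = []" using len by simp
    hence rigid: "c k = 0" if "invariant_along c f" "k < n" for c k
      using kernel_eq_0[of c k] that by (simp add: ker_inv)
    have "lin_subst n (1\<^sub>m n) f = f"
    proof (rule eval_ext)
      fix y
      show "eval y (lin_subst n (1\<^sub>m n) f) = eval y f"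
        unfolding eval_lin_subst[OF vf]
      proof (rule eval_cong)
        fix i assume "i \<in> vars f"
        hence i: "i < n" using vf by auto
        have "(\<Sum>j<n. 1\<^sub>m n $$ (i, j) * y j) = (\<Sum>j<n. if j = i then y j else 0)"
          using i by (intro sum.cong) auto
        thus "(\<Sum>j<n. 1\<^sub>m n $$ (i, j) * y j) = y i" using i by simp
      qed
    qed
    moreover have "invertible_mat (1\<^sub>m n :: complex mat)"
      by (auto simp: invertible_mat_def inverts_mat_def square_mat.simps intro!: exI[of _ "1\<^sub>m n"])
    ultimately have "\<exists>P\<in>carrier_mat n n. invertible_mat P \<and> lin_subst n P f = f"
      by (intro bexI[of _ "1\<^sub>m n"]) auto
    moreover have "nondegenerate n f" using rigid by (intro nondegenerateI[OF vf])
    ultimately show ?thesis using True h f indep by (intro that[of n ts f]) (auto simp: res)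
  next
    case False
    define r where "r = length I"
    define g where "g = Poly_Mapping.the_value (restrict_vars I ts)"
    note gprops = restrict_vars_correct[OF I(1) f, folded g_def]
    have rn: "r < n" using False len by (simp add: r_def)
    have vg: "vars g \<subseteq> {..<r}" using gprops(3)[OF h] by (simp add: homogeneous_def r_def)
    define P where "P = mat n n (\<lambda>(i, k). if k < r then (if I ! k = i then 1 else 0)
      else basis_entry (free ! (k - r)) i)"
    have Pc: "P \<in> carrier_mat n n" by (simp add: P_def)
    have Pf: "(\<Sum>k<n. P $$ (i, k) * y k) =
        spread I y i + (\<Sum>l<n - r. y (r + l) * basis_entry (free ! l) i)" if i: "i < n" for i y
    proof -
      have "{..<n} = {..<r} \<union> {r..<n}" using rn by auto
      hence "(\<Sum>k<n. P $$ (i, k) * y k) = (\<Sum>k<r. P $$ (i, k) * y k) + (\<Sum>k=r..<n. P $$ (i, k) * y k)"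
        by (simp add: sum.union_disjoint ivl_disj_int)
      also have "(\<Sum>k<r. P $$ (i, k) * y k) = spread I y i"
        unfolding spread_def r_def[symmetric] using i rn by (intro sum.cong) (auto simp: P_def)
      also have "(\<Sum>k=r..<n. P $$ (i, k) * y k) = (\<Sum>l<n - r. P $$ (i, l + r) * y (l + r))"
        using sum.shift_bounds_nat_ivl[of "\<lambda>k. P $$ (i, k) * y k" 0 r "n - r"] rn
        by (simp add: atLeast0LessThan)
      also have "\<dots> = (\<Sum>l<n - r. y (r + l) * basis_entry (free ! l) i)"
        using i rn by (intro sum.cong) (auto simp: P_def add.commute)
      finally show ?thesis .
    qed
    have fl: "free ! l \<in> set free" if "l < n - r" for l using that len by (simp add: r_def)
    have subst: "eval (\<lambda>i. \<Sum>k<n. P $$ (i, k) * y k) f = eval y g" for y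
    proof -
      have "eval (\<lambda>i. \<Sum>k<n. P $$ (i, k) * y k) f =
        eval (\<lambda>i. spread I y i + (\<Sum>l<n - r. y (r + l) * basis_entry (free ! l) i)) f"
        using vf by (intro eval_cong Pf) auto
      also have "\<dots> = eval (spread I y) f"
        by (rule eval_diff_directions) (use kernel_basis_entry fl in \<open>auto simp: ker_inv[symmetric]\<close>)
      finally show ?thesis by (simp add: gprops(2))
    qed
    have Pinv: "invertible_mat P"
    proof (rule invertible_matI[OF Pc])
      fix v k assume v: "\<And>i. i < n \<Longrightarrow> (\<Sum>k<n. P $$ (i, k) * v k) = 0" and k: "k < n"
      \<comment> \<open>In a free row all pivot columns of \<open>P\<close> vanish, and the kernel basis restricts to the identity.\<close>
      have low: "v (r + l) = 0" if l: "l < n - r" for l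
      proof -
        have i: "free ! l \<in> set free" by (rule fl[OF l])
        hence "free ! l < n" "free ! l \<notin> set I" by (auto simp: set_free I)
        hence "0 = (\<Sum>l'<n - r. v (r + l') * basis_entry (free ! l') (free ! l))"
          using v[of "free ! l"] by (simp add: Pf spread_notin)
        also have "\<dots> = (\<Sum>l'<n - r. if l' = l then v (r + l') else 0)"
        proof (intro sum.cong refl)
          fix l' assume "l' \<in> {..<n - r}"
          hence "free ! l = free ! l' \<longleftrightarrow> l' = l"
            using l len df by (auto simp: r_def nth_eq_iff_index_eq)
          thus "v (r + l') * basis_entry (free ! l') (free ! l) = (if l' = l then v (r + l') else 0)"
            by (simp add: basis_entry_free[OF i])
        qed
        finally show ?thesis using l by simp
      qed
      show "v k = 0"
      proof (cases "k < r")
        case True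
        hence "I ! k \<in> pivots" unfolding I(2)[symmetric] r_def by simp
        hence "I ! k < n" by (rule pivots_less)
        from v[OF this] have "spread I v (I ! k) = 0" unfolding Pf[OF \<open>I ! k < n\<close>] by (simp add: low)
        thus ?thesis using True I(1) by (simp add: spread_nth r_def)
      next
        case False
        thus ?thesis using low[of "k - r"] k by simp
      qed
    qed
    have "lin_subst n P f = g" by (rule eval_ext) (simp add: eval_lin_subst[OF vf] subst)
    hence P: "\<exists>P\<in>carrier_mat n n. invertible_mat P \<and> lin_subst n P f = g" using Pc Pinv by blast
    have "nondegenerate r g"
    proof (rule nondegenerateI[OF vg])
      fix c k assume c: "invariant_along c g" and k: "k < r"
      \<comment> \<open>Translating \<open>y\<close> by \<open>c\<close> in its first \<open>r\<close> coordinates translates \<open>Py\<close> by \<open>spread I c\<close>.\<close>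
      have "invariant_along (spread I c) f"
        unfolding invariant_along_def
      proof (intro allI)
        fix x t
        obtain y where y: "\<And>i. i < n \<Longrightarrow> (\<Sum>k<n. P $$ (i, k) * y k) = x i"
          using invertible_mat_surj[OF Pc Pinv] by metis
        define y' where "y' k = (if k < r then y k + t * c k else y k)" for k
        have "(\<Sum>k<n. P $$ (i, k) * y' k) = x i + t * spread I c i" if i: "i < n" for i
        proof -
          have "spread I y' i = spread I y i + t * spread I c i"
            unfolding spread_def sum_distrib_left sum.distrib[symmetric]
            by (intro sum.cong) (auto simp: y'_def r_def)
          moreover have "y' (r + l) = y (r + l)" for l by (simp add: y'_def)
          ultimately show ?thesis using y[OF i] by (simp add: Pf[OF i])
        qed
        hence "eval (\<lambda>i. x i + t * spread I c i) f = eval (\<lambda>i. \<Sum>k<n. P $$ (i, k) * y' k) f"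
          using vf by (intro eval_cong) auto
        also have "\<dots> = eval y' g" by (rule subst)
        also have "\<dots> = eval (\<lambda>k. y k + t * c k) g" using vg by (intro eval_cong) (auto simp: y'_def)
        also have "\<dots> = eval y g" using c by (simp add: invariant_along_def)
        also have "\<dots> = eval x f" unfolding subst[symmetric] using y vf by (intro eval_cong) auto
        finally show "eval (\<lambda>i. x i + t * spread I c i) f = eval x f" .
      qed
      hence ks: "kernel (spread I c)" by (simp add: ker_inv)
      have "I ! k \<in> pivots" using k unfolding I(2)[symmetric] r_def by simp
      hence "I ! k < n" by (rule pivots_less)
      hence "spread I c (I ! k) = 0"
        by (rule kernel_eq_0[OF ks, rotated]) (auto simp: set_free I(2)[symmetric] spread_notin)
      thus "c k = 0" using k I(1) by (simp add: spread_nth r_def)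
    qed
    moreover have "length (restrict_vars I ts) \<le> length ts" by (simp add: restrict_vars_eq)
    ultimately show ?thesis using False P gprops(1,3) h rn indep
      by (intro that[of r "restrict_vars I ts" g]) (auto simp: res r_def)
  qed
qed

section \<open>Counting monomials\<close>

definition monoms :: "nat \<Rightarrow> nat \<Rightarrow> monom set" where
  "monoms n k = {m. keys m \<subseteq> {..<n} \<and> mdeg m = k}"

lemma mdeg_add: "mdeg (a + b) = mdeg a + mdeg b"
proof -
  have "mdeg (a + b) = (\<Sum>i\<in>keys a \<union> keys b. lookup (a + b) i)"
    by (rule mdeg_superset) (auto simp: keys_add_nat)
  also have "\<dots> = mdeg a + mdeg b"
    by (simp add: lookup_add sum.distrib mdeg_superset[of a "keys a \<union> keys b"]
      mdeg_superset[of b "keys a \<union> keys b"])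
  finally show ?thesis .
qed

lemma mdeg_single [simp]: "mdeg (single i k) = k"
  by (simp add: mdeg_def)

text \<open>Choosing the factors of a monomial one after the other shows that there are at most \<open>n\<^sup>k\<close> of them.\<close>

lemma monoms_Suc: "monoms n (Suc k) \<subseteq> (\<lambda>(i, m). m + single i 1) ` ({..<n} \<times> monoms n k)"
proof
  fix m assume m: "m \<in> monoms n (Suc k)"
  have "keys m \<noteq> {}"
  proof
    assume "keys m = {}"
    hence "mdeg m = 0" by (simp add: mdeg_def)
    thus False using m by (simp add: monoms_def)
  qed
  then obtain i where i: "i \<in> keys m" by blast
  have eq: "m - single i 1 + single i 1 = m" using i by (intro monom_minus_plus) (simp add: in_keys_iff)
  have "mdeg (m - single i 1) = k"
    using arg_cong[OF eq, of mdeg] m by (simp add: mdeg_add monoms_def)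
  moreover have "keys (m - single i 1) \<subseteq> {..<n}"
    using m keys_add_nat[of "m - single i 1" "single i 1"] eq by (auto simp: monoms_def)
  ultimately have "(i, m - single i 1) \<in> {..<n} \<times> monoms n k"
    using i m by (auto simp: monoms_def)
  thus "m \<in> (\<lambda>(i, m). m + single i 1) ` ({..<n} \<times> monoms n k)"
    using eq by (intro image_eqI[of _ _ "(i, m - single i 1)"]) auto
qed

lemma finite_monoms: "finite (monoms n k)"
  and card_monoms_le_power: "card (monoms n k) \<le> n ^ k"
proof -
  have "finite (monoms n k) \<and> card (monoms n k) \<le> n ^ k"
  proof (induction k)
    case 0
    have "m = 0" if "m \<in> monoms n 0" for m
      using that by (intro poly_mapping_eqI) (auto simp: monoms_def mdeg_def in_keys_iff)
    hence "monoms n 0 \<subseteq> {0}" by auto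
    thus ?case using card_mono[of "{0}" "monoms n 0"] finite_subset by auto
  next
    case (Suc k)
    have "finite ({..<n} \<times> monoms n k)" using Suc by simp
    from finite_subset[OF monoms_Suc finite_imageI[OF this]] surj_card_le[OF this monoms_Suc] Suc
    show ?case by (auto simp: card_cartesian_product intro: order_trans)
  qed
  thus "finite (monoms n k)" "card (monoms n k) \<le> n ^ k" by auto
qed

text \<open>Every exponent is at most \<open>k\<close>. This bound is the useful one when \<open>n\<close> is fixed.\<close>

lemma card_monoms_le: "card (monoms n k) \<le> (k + 1) ^ n"
proof -
  let ?h = "\<lambda>m. restrict (lookup m) {..<n}"
  have "inj_on ?h (monoms n k)"
  proof (rule inj_onI, rule poly_mapping_eqI)
    fix m m' i assume m: "m \<in> monoms n k" "m' \<in> monoms n k" "?h m = ?h m'"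
    show "lookup m i = lookup m' i"
    proof (cases "i < n")
      case True
      thus ?thesis using fun_cong[OF m(3), of i] by simp
    next
      case False
      hence "i \<notin> keys m" "i \<notin> keys m'" using m by (auto simp: monoms_def)
      thus ?thesis by (simp add: in_keys_iff)
    qed
  qed
  moreover have "?h ` monoms n k \<subseteq> {..<n} \<rightarrow>\<^sub>E {..k}"
  proof (rule image_subsetI, unfold restrict_PiE_iff, rule ballI)
    fix m i assume "m \<in> monoms n k" "i \<in> {..<n}"
    hence m: "m \<in> monoms n k" "i < n" by auto
    have "lookup m i \<le> (\<Sum>i<n. lookup m i)" using m(2) by (intro member_le_sum) auto
    also have "\<dots> = mdeg m"
      using m(1) by (intro mdeg_superset[symmetric]) (auto simp: monoms_def)
    also have "\<dots> = k" using m(1) by (simp add: monoms_def)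
    finally show "lookup m i \<in> {..k}" by simp
  qed
  ultimately have "card (monoms n k) \<le> card ({..<n} \<rightarrow>\<^sub>E {..k} :: (nat \<Rightarrow> nat) set)"
    by (intro card_inj_on_le) (auto intro: finite_PiE)
  thus ?thesis by (simp add: card_PiE)
qed

lemma keys_homogeneous: "homogeneous n d f \<Longrightarrow> keys f \<subseteq> monoms n d"
  by (auto simp: homogeneous_def monoms_def vars_def)

lemma set_monomials: "set (monomials n k) = monoms n k"
  and length_monomials: "length (monomials n k) = card (monoms n k)"
  using finite_monoms[of n k] by (simp_all add: monomials_def monoms_def)

section \<open>The center\<close>

lemma div_mod_pair:
  fixes b n :: nat
  assumes "b < n"
  shows "(a * n + b) div n = a" "(a * n + b) mod n = b"
  using assms by (auto simp: mult.commute[of _ n])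

lemma pair_less_square: "a < n \<Longrightarrow> b < n \<Longrightarrow> a * n + b < n * (n :: nat)"
proof -
  assume "a < n" "b < n"
  hence "a * n + b < Suc a * n" by simp
  also have "\<dots> \<le> n * n" using \<open>a < n\<close> by (intro mult_le_mono) auto
  finally show ?thesis .
qed

lemma div_mod_less_square:
  fixes k n :: nat
  assumes "k < n * n"
  shows "k div n < n" "k mod n < n"
  using assms by (auto simp: less_mult_imp_div_less) (cases n; auto)

lemma sum_square: "(\<Sum>l<n * n. h (l div n) (l mod n)) = (\<Sum>a<n. \<Sum>b<n. h a (b::nat))"
proof -
  have "(\<Sum>l<n * n. h (l div n) (l mod n)) = (\<Sum>a<n. \<Sum>l=a * n..<a * n + n. h (l div n) (l mod n))"
    by (rule sum.nat_group[symmetric])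
  also have "\<dots> = (\<Sum>a<n. \<Sum>b<n. h a b)"
  proof (rule sum.cong[OF refl])
    fix a
    have "(\<Sum>l=a * n..<a * n + n. h (l div n) (l mod n)) = (\<Sum>l=0..<n. h ((l + a * n) div n) ((l + a * n) mod n))"
      using sum.shift_bounds_nat_ivl[of "\<lambda>l. h (l div n) (l mod n)" 0 "a * n" n] by (simp add: add.commute)
    also have "\<dots> = (\<Sum>b<n. h a b)"
      unfolding atLeast0LessThan by (rule sum.cong) (auto simp: div_mod_pair add.commute[of _ "a * n"])
    finally show "(\<Sum>l=a * n..<a * n + n. h (l div n) (l mod n)) = (\<Sum>b<n. h a b)" .
  qed
  finally show ?thesis .
qed

text \<open>The program numbers the unknown \<open>X\<^sub>a\<^sub>b\<close> by \<open>a * n + b\<close>.\<close>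

definition mat_of_fun :: "nat \<Rightarrow> (nat \<Rightarrow> complex) \<Rightarrow> complex mat" where
  "mat_of_fun n x = mat n n (\<lambda>(a, b). x (a * n + b))"

definition fun_of_mat :: "nat \<Rightarrow> complex mat \<Rightarrow> nat \<Rightarrow> complex" where
  "fun_of_mat n X l = X $$ (l div n, l mod n)"

lemma mat_of_fun_carrier [simp]: "mat_of_fun n x \<in> carrier_mat n n"
  "dim_row (mat_of_fun n x) = n" "dim_col (mat_of_fun n x) = n"
  by (simp_all add: mat_of_fun_def)

lemma mat_of_fun_index [simp]: "a < n \<Longrightarrow> b < n \<Longrightarrow> mat_of_fun n x $$ (a, b) = x (a * n + b)"
  by (simp add: mat_of_fun_def)

lemma mat_of_fun_of_mat: "X \<in> carrier_mat n n \<Longrightarrow> mat_of_fun n (fun_of_mat n X) = X"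
  by (rule eq_matI) (auto simp: fun_of_mat_def div_mod_pair)

text \<open>The coefficient of \<open>m\<close> in the entry \<open>(i, j)\<close> of \<open>HX\<close>.\<close>

definition hessian_times_coeff :: "nat \<Rightarrow> cpoly \<Rightarrow> complex mat \<Rightarrow> nat \<Rightarrow> nat \<Rightarrow> monom \<Rightarrow> complex" where
  "hessian_times_coeff n g X i j m = (\<Sum>a<n. lookup (partial i (partial a g)) m * X $$ (a, j))"

lemma center_iff:
  "X \<in> center n g \<longleftrightarrow> X \<in> carrier_mat n n \<and>
    (\<forall>i j m. i < j \<longrightarrow> j < n \<longrightarrow>
       hessian_times_coeff n g X i j m = hessian_times_coeff n g X j i m)"
proof (cases "X \<in> carrier_mat n n")
  case True
  define E where "E i j = (\<Sum>a<n. partial i (partial a g) * const (X $$ (a, j)))" for i j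
  define M where "M = hessian n g * map_mat const X"
  have M: "M \<in> carrier_mat n n"
    using True by (auto simp: M_def hessian_def intro!: mult_carrier_mat[of _ n n])
  have ent: "M $$ (i, j) = E i j" if "i < n" "j < n" for i j
    using True that by (simp add: M_def hessian_def scalar_prod_def atLeast0LessThan E_def)
  have "X \<in> center n g \<longleftrightarrow> transpose_mat M = M"
    using True by (simp add: center_def M_def)
  also have "\<dots> \<longleftrightarrow> (\<forall>i<n. \<forall>j<n. E j i = E i j)"
    using M by (auto simp: mat_eq_iff ent)
  also have "\<dots> \<longleftrightarrow> (\<forall>i j. i < j \<longrightarrow> j < n \<longrightarrow> E i j = E j i)"
  proof (intro iffI allI impI)
    fix i j assume "\<forall>i<n. \<forall>j<n. E j i = E i j" "i < j" "j < n"
    thus "E i j = E j i" by simp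
  next
    fix i j assume E: "\<forall>i j. i < j \<longrightarrow> j < n \<longrightarrow> E i j = E j i" and ij: "i < n" "j < n"
    show "E j i = E i j"
    proof (cases i j rule: linorder_cases)
      case less
      thus ?thesis using E[rule_format, of i j] ij by simp
    next
      case greater
      thus ?thesis using E[rule_format, of j i] ij by simp
    qed simp
  qed
  also have "\<dots> \<longleftrightarrow> (\<forall>i j m. i < j \<longrightarrow> j < n \<longrightarrow> lookup (E i j) m = lookup (E j i) m)"
    by (auto simp: poly_mapping_eq_iff fun_eq_iff)
  finally have iff: "X \<in> center n g \<longleftrightarrow>
    (\<forall>i j m. i < j \<longrightarrow> j < n \<longrightarrow> lookup (E i j) m = lookup (E j i) m)" .
  have "lookup (E i j) m = hessian_times_coeff n g X i j m" for i j m
    unfolding E_def lookup_sum hessian_times_coeff_def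
    by (intro sum.cong refl) (subst mult.commute, simp add: lookup_const_mult)
  thus ?thesis using True iff by simp
qed (auto simp: center_def)

definition hessian_terms :: "nat \<Rightarrow> complex terms \<Rightarrow> complex terms list list" where
  "hessian_terms n ts =
    map (\<lambda>i. map (\<lambda>j. result (partial_terms i (result (partial_terms j ts)))) [0..<n]) [0..<n]"

definition center_system :: "nat \<Rightarrow> nat \<Rightarrow> complex terms \<Rightarrow> complex list list" where
  "center_system n d ts =

    map (\<lambda>((i, j), m). result (center_equation n (hessian_terms n ts) i j m))
      (List.product (filter (\<lambda>(i, j). i < j) (List.product [0..<n] [0..<n])) (monomials n (d - 2)))"

lemma center_equation_row:
  assumes g: "represents ts g" and ij: "i < j" "j < n"
  shows "length (result (center_equation n (hessian_terms n ts) i j m)) = n * n"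
    and "row_form (n * n) (result (center_equation n (hessian_terms n ts) i j m)) x =
      (\<Sum>a<n. lookup (partial i (partial a g)) m * x (a * n + j)) -
      (\<Sum>a<n. lookup (partial j (partial a g)) m * x (a * n + i))"
proof -
  let ?H = "hessian_terms n ts"
  have entry: "result (coeff_of (?H ! i ! a) m) = lookup (partial i (partial a g)) m" if "i < n" "a < n" for i a
  proof -
    have "represents (?H ! i ! a) (partial i (partial a g))"
      using that by (simp add: hessian_terms_def represents_partial_terms[OF represents_partial_terms[OF g]])
    thus ?thesis by simp
  qed
  define h where "h a b = (if b = j then lookup (partial i (partial a g)) m
      else if b = i then - lookup (partial j (partial a g)) m else 0)" for a b
  have res: "result (center_equation n ?H i j m) = map (\<lambda>(a, b). h a b) (List.product [0..<n] [0..<n])"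
    unfolding center_equation_def result_mapM
    by (intro map_cong refl) (use ij in \<open>auto simp: h_def entry\<close>)
  show "length (result (center_equation n ?H i j m)) = n * n" unfolding res by simp
  have "row_form (n * n) (result (center_equation n ?H i j m)) x
    = (\<Sum>l<n * n. h (l div n) (l mod n) * x (l div n * n + l mod n))"
    unfolding row_form_def res
    by (intro sum.cong refl) (simp add: product_nth div_mod_less_square)
  also have "\<dots> = (\<Sum>a<n. \<Sum>b<n. h a b * x (a * n + b))"
    by (rule sum_square)
  also have "\<dots> = (\<Sum>a<n. lookup (partial i (partial a g)) m * x (a * n + j)
      - lookup (partial j (partial a g)) m * x (a * n + i))"
  proof (rule sum.cong[OF refl])
    fix a
    have "(\<Sum>b<n. h a b * x (a * n + b)) = (\<Sum>b<n. (if b = j then lookup (partial i (partial a g)) m * x (a * n + j) else 0)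
      + (if b = i then - lookup (partial j (partial a g)) m * x (a * n + i) else 0))"
      using ij by (intro sum.cong) (auto simp: h_def)
    thus "(\<Sum>b<n. h a b * x (a * n + b)) = lookup (partial i (partial a g)) m * x (a * n + j)
      - lookup (partial j (partial a g)) m * x (a * n + i)"
      using ij by (simp add: sum.distrib)
  qed
  finally show "row_form (n * n) (result (center_equation n ?H i j m)) x =
      (\<Sum>a<n. lookup (partial i (partial a g)) m * x (a * n + j)) -
      (\<Sum>a<n. lookup (partial j (partial a g)) m * x (a * n + i))"
    by (simp add: sum_subtractf)
qed

lemma center_system_rows:
  assumes "represents ts g" "r \<in> set (center_system n d ts)"
  shows "length r = n * n"
  using assms(2) by (auto simp: center_system_def center_equation_row[OF assms(1)])

lemma hessian_keys:
  assumes "homogeneous n d g" "m \<in> keys (partial i (partial a g))"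
  shows "m \<in> monoms n (d - 2)"
proof -
  have "m + single i 1 + single a 1 \<in> keys g"
    using assms(2) by (intro keys_partial) auto
  hence "m + single i 1 + single a 1 \<in> monoms n d" using keys_homogeneous[OF assms(1)] by blast
  thus ?thesis by (auto simp: monoms_def mdeg_add keys_add_nat)
qed

text \<open>Only monomials of degree \<open>d - 2\<close> have an equation in the system; for the others both sides vanish.\<close>

lemma center_system_kernel:
  assumes h: "homogeneous n d g" and g: "represents ts g"
  shows "(\<forall>r\<in>set (center_system n d ts). row_form (n * n) r x = 0) \<longleftrightarrow> mat_of_fun n x \<in> center n g"
proof -
  let ?L = "\<lambda>i j m. \<Sum>a<n. lookup (partial i (partial a g)) m * x (a * n + j)"
  have "(\<forall>r\<in>set (center_system n d ts). row_form (n * n) r x = 0) \<longleftrightarrow>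
    (\<forall>i j. \<forall>m\<in>monoms n (d - 2). i < j \<longrightarrow> j < n \<longrightarrow> ?L i j m = ?L j i m)"
    by (auto simp: center_system_def center_equation_row[OF g] set_monomials) (meson less_trans)
  also have "\<dots> \<longleftrightarrow> (\<forall>i j m. i < j \<longrightarrow> j < n \<longrightarrow> ?L i j m = ?L j i m)"
  proof -
    have z: "?L i j m = 0" if "m \<notin> monoms n (d - 2)" for i j m
    proof -
      have "lookup (partial i (partial a g)) m = 0" for a
        using hessian_keys[OF h, of m i a] that by (auto simp: in_keys_iff)
      thus ?thesis by simp
    qed
    have "?L i j m = ?L j i m" if "m \<notin> monoms n (d - 2)" for i j m by (simp only: z[OF that])
    thus ?thesis by blast
  qed
  also have "\<dots> \<longleftrightarrow> mat_of_fun n x \<in> center n g"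
  proof -
    have "hessian_times_coeff n g (mat_of_fun n x) i j m = ?L i j m" if "j < n" for i j m
      unfolding hessian_times_coeff_def using that by (intro sum.cong) auto
    thus ?thesis by (simp add: center_iff)
  qed
  finally show ?thesis .
qed

lemma result_compute_center:
  "result (compute_center n d ts) =
    map (\<lambda>v. map (\<lambda>a. map (\<lambda>b. v ! (a * n + b)) [0..<n]) [0..<n])
      (result (nullspace_basis (n * n) (result (rref (n * n) (center_system n d ts)))))"
  by (simp add: compute_center_def center_system_def hessian_terms_def case_prod_unfold comp_def)

lemma cost_compute_center:
  fixes ts :: "complex terms"
  assumes g: "represents ts g" and M: "card (monoms n (d - 2)) \<le> M"
  shows "cost (compute_center n d ts) \<le> n * length ts + n * (n * length ts)
    + n * n * M * (n * n) + n * n * (n * n * M * (2 * (n * n) + 1)) + n * n * (n * n)"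
proof -
  define ps where "ps = map (\<lambda>j. result (partial_terms j ts)) [0..<n]"
  define H where "H = map (\<lambda>i. map (\<lambda>p. result (partial_terms i p)) ps) [0..<n]"
  define eqs where "eqs = List.product (filter (\<lambda>(i, j). i < j) (List.product [0..<n] [0..<n])) (monomials n (d - 2))"
  have leqs: "length eqs \<le> n * n * M"
  proof -
    have "length (filter (\<lambda>(i, j). i < j) (List.product [0..<n] [0..<n])) \<le> n * n"
      using length_filter_le[of "\<lambda>(i, j). i < j" "List.product [0..<n] [0..<n]"] by simp
    thus ?thesis using M by (simp add: eqs_def length_monomials mult_le_mono)
  qed
  have A: "map (\<lambda>((i, j), m). result (center_equation n H i j m)) eqs = center_system n d ts"
    by (simp add: center_system_def eqs_def H_def ps_def hessian_terms_def comp_def)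
  have lA: "length (center_system n d ts) \<le> n * n * M" using leqs by (simp add: A[symmetric])
  have rows: "\<forall>r\<in>set (center_system n d ts). length r = n * n" using center_system_rows[OF g] by blast
  define R where "R = result (rref (n * n) (center_system n d ts))"
  interpret reduced_rows "n * n" "center_system n d ts" R
    unfolding R_def by (rule rref_correct[OF rows])
  have "cost (compute_center n d ts) = (\<Sum>j\<leftarrow>[0..<n]. cost (partial_terms j ts))
    + (\<Sum>i\<leftarrow>[0..<n]. cost (mapM (partial_terms i) ps))
    + (\<Sum>((i, j), m)\<leftarrow>eqs. cost (center_equation n H i j m))
    + cost (rref (n * n) (center_system n d ts)) + cost (nullspace_basis (n * n) R)"
    unfolding A[symmetric] R_def
    by (simp add: compute_center_def ps_def H_def eqs_def case_prod_unfold comp_def)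
  also have "\<dots> \<le> length [0..<n] * length ts + length [0..<n] * (length ps * length ts)
    + length eqs * (n * n) + n * n * (n * n * M * (2 * (n * n) + 1)) + n * n * (n * n)"
  proof (intro add_mono)
    show "(\<Sum>j\<leftarrow>[0..<n]. cost (partial_terms j ts)) \<le> length [0..<n] * length ts"
      by (rule sum_list_le_length) (rule cost_partial_terms)
    have "cost (mapM (partial_terms i) ps) \<le> length ps * length ts" for i
      unfolding cost_mapM
    proof (rule sum_list_le_length)
      fix p assume "p \<in> set ps"
      hence "length p \<le> length ts" using length_partial_terms by (auto simp: ps_def)
      thus "cost (partial_terms i p) \<le> length ts" using cost_partial_terms[of i p] by simp
    qed
    thus "(\<Sum>i\<leftarrow>[0..<n]. cost (mapM (partial_terms i) ps)) \<le> length [0..<n] * (length ps * length ts)"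
      by (rule sum_list_le_length)
    have "cost (center_equation n H i j m) \<le> length (List.product [0..<n] [0..<n]) * 1" for i j m
      unfolding center_equation_def cost_mapM by (rule sum_list_le_length) auto
    thus "(\<Sum>((i, j), m)\<leftarrow>eqs. cost (center_equation n H i j m)) \<le> length eqs * (n * n)"
      by (intro sum_list_le_length) (auto simp: case_prod_unfold)
    have "cost (rref (n * n) (center_system n d ts)) \<le> n * n * (length (center_system n d ts) * (2 * (n * n) + 1))"
      by (rule cost_rref[OF rows])
    also have "\<dots> \<le> n * n * (n * n * M * (2 * (n * n) + 1))"
      using lA by (intro mult_le_mono) auto
    finally show "cost (rref (n * n) (center_system n d ts)) \<le> \<dots>" .
    show "cost (nullspace_basis (n * n) R) \<le> n * n * (n * n)" by (rule cost_nullspace_basis)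
  qed
  also have "\<dots> \<le> n * length ts + n * (n * length ts)
    + n * n * M * (n * n) + n * n * (n * n * M * (2 * (n * n) + 1)) + n * n * (n * n)"
    using leqs by (auto simp: ps_def intro!: add_mono mult_le_mono)
  finally show ?thesis .
qed

lemma index_finsum_mat:
  assumes "finite A" "h \<in> A \<rightarrow> carrier_mat nr nc" "i < nr" "j < nc"
  shows "finsum (module_mat TYPE(complex) nr nc) h A $$ (i, j) = (\<Sum>v\<in>A. h v $$ (i, j))"
proof -
  interpret matrix_vs nr nc "TYPE(complex)" .
  show ?thesis using assms(1,2)
  proof (induction A)
    case (insert a A)
    hence h: "h a \<in> carrier_mat nr nc" "h \<in> A \<rightarrow> carrier_mat nr nc" by auto
    have "finsum V h A \<in> carrier_mat nr nc" using finsum_closed[OF h(2)] .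
    hence "dim_row (finsum V h A) = nr" "dim_col (finsum V h A) = nc" by auto
    thus ?case using insert h assms(3,4) finsum_insert[OF insert(1,2) h(2,1)] by simp
  qed (use assms(3,4) in simp)
qed

lemma hessian_times_coeff_add:
  assumes "X \<in> carrier_mat n n" "Y \<in> carrier_mat n n" "j < n"
  shows "hessian_times_coeff n g (X + Y) i j m = hessian_times_coeff n g X i j m + hessian_times_coeff n g Y i j m"
  unfolding hessian_times_coeff_def sum.distrib[symmetric]
  by (intro sum.cong refl) (use assms in \<open>auto simp: distrib_left\<close>)

lemma hessian_times_coeff_smult:
  assumes "X \<in> carrier_mat n n" "j < n"
  shows "hessian_times_coeff n g (c \<cdot>\<^sub>m X) i j m = c * hessian_times_coeff n g X i j m"
  unfolding hessian_times_coeff_def sum_distrib_left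
  by (intro sum.cong refl) (use assms in auto)

lemma center_add: "X \<in> center n g \<Longrightarrow> Y \<in> center n g \<Longrightarrow> X + Y \<in> center n g"
  by (simp add: center_iff hessian_times_coeff_add) metis

lemma center_smult: "X \<in> center n g \<Longrightarrow> c \<cdot>\<^sub>m X \<in> center n g"
  by (simp add: center_iff hessian_times_coeff_smult) metis

lemma center_zero: "0\<^sub>m n n \<in> center n g"
  by (simp add: center_iff hessian_times_coeff_def)

lemma center_submodule:
  "LinearCombinations.submodule class_ring (center n g) (module_mat TYPE(complex) n n)"
proof -
  interpret matrix_vs n n "TYPE(complex)" .
  show ?thesis
    by (rule LinearCombinations.submodule.intro)
      (auto simp: center_add center_smult center_zero module_axioms matrix_vs_simps, auto simp: center_def)
qed

lemma vectorspace_center: "vectorspace class_ring (center_space n g)"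
proof -
  interpret matrix_vs n n "TYPE(complex)" .
  show ?thesis
    unfolding center_space_def
    by (rule subspace_is_vs) (simp add: VectorSpace.subspace_def center_submodule vectorspace_axioms)
qed

text \<open>Independence and span are inherited from the space of all matrices, where the coefficients of a
  linear combination can be compared entry by entry.\<close>

theorem compute_center_correct:
  assumes h: "homogeneous n d g" and g: "represents ts g"
  defines "Xs \<equiv> result (compute_center n d ts)"
  shows "distinct (map (mat_of_rows_list n) Xs)"
    and "vectorspace.basis class_ring (center_space n g) (set (map (mat_of_rows_list n) Xs))"
    and "vectorspace.dim class_ring (center_space n g) = length Xs"
    and "\<And>X. X \<in> set Xs \<Longrightarrow> length X = n \<and> (\<forall>r\<in>set X. length r = n)"
proof -
  define A where "A = center_system n d ts"
  define R where "R = result (rref (n * n) A)"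
  interpret reduced_rows "n * n" A R
    unfolding R_def A_def using center_system_rows[OF g] by (intro rref_correct) blast
  have ker: "kernel x \<longleftrightarrow> mat_of_fun n x \<in> center n g" for x
    unfolding kernel_def unfolding A_def by (rule center_system_kernel[OF h g])
  have Xs: "Xs = map (\<lambda>j. map (\<lambda>a. map (\<lambda>b. map (basis_entry j) [0..<n * n] ! (a * n + b)) [0..<n]) [0..<n]) free"
    unfolding Xs_def result_compute_center A_def[symmetric] R_def[symmetric] result_nullspace_basis
    by simp
  define M where "M j = mat_of_fun n (basis_entry j)" for j
  have mats: "map (mat_of_rows_list n) Xs = map M free"
    unfolding Xs map_map M_def mat_of_fun_def mat_of_rows_list_def
    by (intro map_cong refl cong_mat) (auto simp: pair_less_square)
  show "length X = n \<and> (\<forall>r\<in>set X. length r = n)" if "X \<in> set Xs" for X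
    using that by (auto simp: Xs)
  have M_entry: "M j $$ (l div n, l mod n) = basis_entry j l" if "l < n * n" for j l
    using div_mod_less_square[OF that] by (simp add: M_def)
  have inj: "inj_on M (set free)"
  proof (rule inj_onI)
    fix j j' assume j: "j \<in> set free" "j' \<in> set free" "M j = M j'"
    have "j < n * n" using j by (auto simp: set_free)
    hence "basis_entry j j = basis_entry j' j" using M_entry[of j j] M_entry[of j j'] j(3) by simp
    thus "j = j'" using j(1) by (simp add: basis_entry_free split: if_splits)
  qed
  have dfree: "distinct free" by (simp add: free_def)
  show dist: "distinct (map (mat_of_rows_list n) Xs)"
    unfolding mats using inj dfree by (simp add: distinct_map)
  let ?B = "M ` set free"
  interpret V: matrix_vs n n "TYPE(complex)" .
  have Bcenter: "?B \<subseteq> center n g" using kernel_basis_entry by (auto simp: M_def ker[symmetric])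
  have Bc: "?B \<subseteq> carrier_mat n n" by (auto simp: M_def)
  have comb: "V.lincomb a ?B $$ (i, j) = (\<Sum>l\<in>set free. a (M l) * basis_entry l (i * n + j))"
    if "i < n" "j < n" for a i j
  proof -
    have "V.lincomb a ?B $$ (i, j) = (\<Sum>v\<in>?B. (a v \<cdot>\<^sub>m v) $$ (i, j))"
      unfolding V.lincomb_def by (rule index_finsum_mat) (use that Bc in auto)
    also have "\<dots> = (\<Sum>l\<in>set free. (a (M l) \<cdot>\<^sub>m M l) $$ (i, j))" by (simp add: sum.reindex inj)
    also have "\<dots> = (\<Sum>l\<in>set free. a (M l) * basis_entry l (i * n + j))"
      using that by (intro sum.cong) (auto simp: M_def mat_of_fun_def)
    finally show ?thesis .
  qed
  have indpt: "V.lin_indpt ?B"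
  proof (rule V.finite_lin_indpt2)
    fix a assume "V.lincomb a ?B = 0\<^sub>m n n"
    hence z: "(\<Sum>l\<in>set free. a (M l) * basis_entry l k) = 0" if "k < n * n" for k
      using comb[of "k div n" "k mod n" a] div_mod_less_square[OF that] by simp
    have "a (M k) = 0" if k: "k \<in> set free" for k
    proof -
      have "(\<Sum>l\<in>set free. a (M l) * basis_entry l k) = (\<Sum>l\<in>set free. if l = k then a (M l) else 0)"
        by (intro sum.cong) (auto simp: basis_entry_free[OF k])
      moreover have "k < n * n" using k by (simp add: set_free)
      ultimately show ?thesis using z[of k] k by simp
    qed
    thus "\<forall>v\<in>?B. a v = 0" by auto
  qed (use Bc in auto)
  have span: "V.span ?B = center n g"
  proof
    show "V.span ?B \<subseteq> center n g" by (rule V.span_is_subset[OF Bcenter center_submodule])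
    show "center n g \<subseteq> V.span ?B"
    proof
      fix X assume X: "X \<in> center n g"
      hence Xc: "X \<in> carrier_mat n n" by (simp add: center_def)
      define x where "x = fun_of_mat n X"
      have "kernel x" unfolding ker x_def mat_of_fun_of_mat[OF Xc] by (rule X)
      hence x: "x k = (\<Sum>j\<in>set free. x j * basis_entry j k)" if "k < n * n" for k
        using that unfolding kernel_expansion by blast
      define a where "a v = x (the_inv_into (set free) M v)" for v
      have "X = V.lincomb a ?B"
      proof (rule eq_matI)
        have lc: "V.lincomb a ?B \<in> carrier_mat n n" by (rule V.lincomb_closed) (use Bc in auto)
        thus "dim_row X = dim_row (V.lincomb a ?B)" "dim_col X = dim_col (V.lincomb a ?B)"
          using Xc by auto
        fix i j assume "i < dim_row (V.lincomb a ?B)" "j < dim_col (V.lincomb a ?B)"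
        hence ij: "i < n" "j < n" using lc by auto
        have "X $$ (i, j) = x (i * n + j)" using ij by (simp add: x_def fun_of_mat_def div_mod_pair)
        also have "\<dots> = (\<Sum>l\<in>set free. x l * basis_entry l (i * n + j))"
          by (rule x) (rule pair_less_square[OF ij])
        also have "\<dots> = V.lincomb a ?B $$ (i, j)"
          unfolding comb[OF ij] by (intro sum.cong) (auto simp: a_def the_inv_into_f_f[OF inj])
        finally show "X $$ (i, j) = V.lincomb a ?B $$ (i, j)" .
      qed
      thus "X \<in> V.span ?B" unfolding V.span_def by auto
    qed
  qed
  interpret C: vectorspace class_ring "center_space n g" by (rule vectorspace_center)
  note nd = V.span_li_not_depend[OF Bcenter center_submodule, folded center_space_def]
  have "C.basis ?B"
    unfolding C.basis_def nd using indpt span Bcenter by (simp add: center_space_def)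
  thus basis: "C.basis (set (map (mat_of_rows_list n) Xs))" by (simp add: mats)
  have "C.dim = card (set (map (mat_of_rows_list n) Xs))" by (rule C.dim_basis[OF _ basis]) simp
  also have "\<dots> = length Xs" using distinct_card[OF dist] by simp
  finally show "C.dim = length Xs" .
qed

section \<open>Minimal polynomials\<close>

lemma poly_at_mat_eq_0_iff:
  assumes X: "X \<in> carrier_mat n n" and deg: "degree p \<le> N"
  shows "poly_at_mat p X = 0\<^sub>m (dim_row X) (dim_row X) \<longleftrightarrow>
    (\<forall>a<n. \<forall>b<n. (\<Sum>k\<le>N. coeff p k * (X ^\<^sub>m k) $$ (a, b)) = 0)"
proof -
  have "(\<Sum>k\<le>degree p. coeff p k * (X ^\<^sub>m k) $$ (a, b)) = (\<Sum>k\<le>N. coeff p k * (X ^\<^sub>m k) $$ (a, b))" for a b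
    using deg by (intro sum.mono_neutral_left) (auto simp: coeff_eq_0)
  thus ?thesis using X by (auto simp: poly_at_mat_def mat_eq_iff)
qed

text \<open>Cayley-Hamilton. With \<open>B\<close> the adjugate of \<open>xI - X\<close>, the identity \<open>(xI - X) B = \<chi> I\<close> makes the
  sum of \<open>\<chi>\<^sub>l X\<^sup>l\<close> telescope.\<close>

lemma cayley_hamilton:
  fixes X :: "complex mat"
  assumes X: "X \<in> carrier_mat n n"
  shows "poly_at_mat (char_poly X) X = 0\<^sub>m (dim_row X) (dim_row X)"
proof -
  define C where "C = char_poly_matrix X"
  define B where "B = adj_mat C"
  define \<chi> where "\<chi> = char_poly X"
  define F where "F l = mat n n (\<lambda>(i, j). coeff (B $$ (i, j)) l)" for l
  have C: "C \<in> carrier_mat n n" using X by (simp add: C_def)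
  have B: "B \<in> carrier_mat n n" using adj_mat(1)[OF C] by (simp add: B_def)
  have F: "F l \<in> carrier_mat n n" for l by (simp add: F_def)
  have XF: "X * F l \<in> carrier_mat n n" for l using X F by (rule mult_carrier_mat)
  have ent: "[:0, 1:] * B $$ (i, j) - (\<Sum>k<n. [:X $$ (i, k):] * B $$ (k, j)) = (if i = j then \<chi> else 0)"
    if ij: "i < n" "j < n" for i j
  proof -
    have "(C * B) $$ (i, j) = (\<Sum>k<n. C $$ (i, k) * B $$ (k, j))"
      using C B ij by (simp add: scalar_prod_def atLeast0LessThan)
    also have "\<dots> = (\<Sum>k<n. (if k = i then [:0, 1:] * B $$ (i, j) else 0) - [:X $$ (i, k):] * B $$ (k, j))"
      using X ij by (intro sum.cong) (auto simp: C_def char_poly_matrix_def algebra_simps)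
    also have "\<dots> = [:0, 1:] * B $$ (i, j) - (\<Sum>k<n. [:X $$ (i, k):] * B $$ (k, j))"
      using ij by (simp add: sum_subtractf)
    also have "(C * B) $$ (i, j) = (if i = j then \<chi> else 0)"
      using adj_mat(2)[OF C] ij by (simp add: B_def \<chi>_def char_poly_def C_def)
    finally show ?thesis by simp
  qed
  have XF_index: "(X * F l) $$ (i, j) = (\<Sum>k<n. X $$ (i, k) * coeff (B $$ (k, j)) l)"
    if "i < n" "j < n" for i j l
    using X that by (simp add: F_def scalar_prod_def atLeast0LessThan)
  have co: "(if l = 0 then 0 else coeff (B $$ (i, j)) (l - 1)) - (X * F l) $$ (i, j) = (if i = j then coeff \<chi> l else 0)"
    if ij: "i < n" "j < n" for i j l
    using arg_cong[OF ent[OF ij], of "\<lambda>p. coeff p l"] XF_index[OF ij, of l]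
    by (cases l) (simp_all add: coeff_sum)
  have F0: "coeff \<chi> 0 \<cdot>\<^sub>m 1\<^sub>m n = - (X * F 0)"
  proof -
    define Y where "Y = X * F 0"
    have "Y \<in> carrier_mat n n" "\<And>i j. i < n \<Longrightarrow> j < n \<Longrightarrow> - Y $$ (i, j) = (if i = j then coeff \<chi> 0 else 0)"
      using XF[of 0] co[of _ _ 0] by (auto simp: Y_def simp del: index_mult_mat)
    thus ?thesis unfolding Y_def[symmetric] by (intro eq_matI) auto
  qed
  have FS: "coeff \<chi> (Suc l) \<cdot>\<^sub>m 1\<^sub>m n = F l - X * F (Suc l)" for l
    using XF[of "Suc l"] co[of _ _ "Suc l"] by (intro eq_matI) (auto simp: F_def)
  define S where "S N = mat n n (\<lambda>(a, b). \<Sum>k\<le>N. coeff \<chi> k * (X ^\<^sub>m k) $$ (a, b))" for N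
  have S: "S N = - (X ^\<^sub>m Suc N * F N)" for N
  proof (induction N)
    case 0
    have "S 0 = coeff \<chi> 0 \<cdot>\<^sub>m 1\<^sub>m n" using X by (intro eq_matI) (auto simp: S_def)
    also have "\<dots> = - (X ^\<^sub>m Suc 0 * F 0)" using X by (simp add: F0)
    finally show ?case .
  next
    case (Suc N)
    let ?P = "X ^\<^sub>m Suc N"
    have P: "?P \<in> carrier_mat n n" using X by (rule pow_carrier_mat)
    have "S (Suc N) = S N + coeff \<chi> (Suc N) \<cdot>\<^sub>m ?P"
      using P X by (intro eq_matI) (auto simp: S_def simp del: pow_mat.simps)
    also have "coeff \<chi> (Suc N) \<cdot>\<^sub>m ?P = ?P * (coeff \<chi> (Suc N) \<cdot>\<^sub>m 1\<^sub>m n)"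
      unfolding mult_smult_distrib[OF P one_carrier_mat] right_mult_one_mat[OF P] ..
    also have "\<dots> = ?P * F N - ?P * (X * F (Suc N))"
      unfolding FS by (rule mult_minus_distrib_mat[OF P F XF])
    also have "?P * (X * F (Suc N)) = X ^\<^sub>m Suc (Suc N) * F (Suc N)"
      using assoc_mult_mat[OF P X F] by simp
    finally have "S (Suc N) = - (?P * F N) + (?P * F N - X ^\<^sub>m Suc (Suc N) * F (Suc N))"
      unfolding Suc .
    also have "\<dots> = - (X ^\<^sub>m Suc (Suc N) * F (Suc N))"
    proof -
      have c: "?P * F N \<in> carrier_mat n n" using P F by (rule mult_carrier_mat)
      have "X ^\<^sub>m Suc (Suc N) * F (Suc N) \<in> carrier_mat n n"
        using pow_carrier_mat[OF X] F by (rule mult_carrier_mat)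
      thus ?thesis using c by (intro eq_matI) (auto simp del: pow_mat.simps index_mult_mat)
    qed
    finally show ?case .
  qed
  \<comment> \<open>At least the degree of \<open>\<chi>\<close>, and larger than the degree of every entry of \<open>B\<close>.\<close>
  define N where "N = n + (\<Sum>i<n. \<Sum>j<n. Suc (degree (B $$ (i, j))))"
  have "F N = 0\<^sub>m n n"
  proof (rule eq_matI)
    fix i j assume "i < dim_row (0\<^sub>m n n)" "j < dim_col (0\<^sub>m n n)"
    hence ij: "i < n" "j < n" by auto
    have "degree (B $$ (i, j)) < Suc (degree (B $$ (i, j)))" by simp
    also have "\<dots> \<le> (\<Sum>j<n. Suc (degree (B $$ (i, j))))" using ij by (intro member_le_sum) auto
    also have "\<dots> \<le> (\<Sum>i<n. \<Sum>j<n. Suc (degree (B $$ (i, j))))"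
      using ij by (intro member_le_sum[of i "{..<n}" "\<lambda>i. \<Sum>j<n. Suc (degree (B $$ (i, j)))"]) auto
    also have "\<dots> \<le> N" by (simp add: N_def)
    finally show "F N $$ (i, j) = 0\<^sub>m n n $$ (i, j)" using ij by (simp add: F_def coeff_eq_0)
  qed (auto simp: F_def)
  hence "X ^\<^sub>m Suc N * F N = 0\<^sub>m n n"
    using right_mult_zero_mat[OF pow_carrier_mat[OF X]] by (simp del: pow_mat.simps)
  hence "S N = 0\<^sub>m n n" unfolding S by auto
  hence "\<forall>a<n. \<forall>b<n. (\<Sum>k\<le>N. coeff \<chi> k * (X ^\<^sub>m k) $$ (a, b)) = 0"
    by (auto simp: S_def mat_eq_iff)
  moreover have "degree \<chi> \<le> N"
    using degree_monic_char_poly[OF X] by (simp add: \<chi>_def N_def)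
  ultimately show ?thesis using poly_at_mat_eq_0_iff[OF X] unfolding \<chi>_def by blast
qed

lemma fold_add: "fold (\<lambda>k s. s + h k) xs (z :: complex) = z + (\<Sum>k\<leftarrow>xs. h k)"
  by (induction xs arbitrary: z) (auto simp: add.assoc)

lemma cost_foldM_le:
  assumes "\<And>x s. x \<in> set xs \<Longrightarrow> cost (h x s) \<le> B"
  shows "cost (foldM h xs s) \<le> length xs * B"
  using assms by (induction xs arbitrary: s) (auto intro!: add_mono)

lemma length_mat_mult [simp]: "length (result (mat_mult n A B)) = n"
  by (simp add: mat_mult_def)

lemma nth_mat_mult:
  "a < n \<Longrightarrow> b < n \<Longrightarrow> result (mat_mult n A B) ! a ! b = (\<Sum>k<n. A ! a ! k * B ! k ! b)"
  by (simp add: mat_mult_def fold_add interv_sum_list_conv_sum_set_nat atLeast0LessThan)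

lemma cost_mat_mult: "cost (mat_mult n A (B :: complex list list)) \<le> n * (n * (n * 2))"
proof -
  have "cost (mat_mult n A B) \<le> length [0..<n] * (length [0..<n] * (length [0..<n] * 2))"
    unfolding mat_mult_def cost_mapM
    by (intro sum_list_le_length) (auto intro!: cost_foldM_le[where xs = "[0..<n]", simplified])
  thus ?thesis by simp
qed

lemma mat_of_rows_list_mult:
  assumes "length A = n" "length B = n"
  shows "mat_of_rows_list n (result (mat_mult n A B)) = mat_of_rows_list n A * mat_of_rows_list n B"
  using assms
  by (intro eq_matI) (auto simp: mat_of_rows_list_def nth_mat_mult scalar_prod_def atLeast0LessThan)

lemma mat_of_rows_list_one: "mat_of_rows_list n (result (mat_one n)) = 1\<^sub>m n"
  by (intro eq_matI) (auto simp: mat_of_rows_list_def mat_one_def)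

lemma mat_of_rows_list_carrier: "length A = n \<Longrightarrow> mat_of_rows_list n A \<in> carrier_mat n n"
  by (auto simp: mat_of_rows_list_def)

lemma mat_powers_correct:
  assumes "length X = n" "length Q = n"
  shows "length (result (mat_powers n X k Q)) = Suc k"
    and "j \<le> k \<Longrightarrow> length (result (mat_powers n X k Q) ! j) = n"
    and "j \<le> k \<Longrightarrow> mat_of_rows_list n (result (mat_powers n X k Q) ! j) =
      mat_of_rows_list n X ^\<^sub>m j * mat_of_rows_list n Q"
proof -
  let ?X = "mat_of_rows_list n X"
  have X: "?X \<in> carrier_mat n n" using assms(1) by (rule mat_of_rows_list_carrier)
  have "length (result (mat_powers n X k Q)) = Suc k \<and>
    (\<forall>j\<le>k. length (result (mat_powers n X k Q) ! j) = n \<and>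
       mat_of_rows_list n (result (mat_powers n X k Q) ! j) = ?X ^\<^sub>m j * mat_of_rows_list n Q)"
    using assms(2)
  proof (induction k arbitrary: Q)
    case 0
    thus ?case using X mat_of_rows_list_carrier[of Q n] by simp
  next
    case (Suc k)
    let ?Q = "mat_of_rows_list n Q"
    have Q: "?Q \<in> carrier_mat n n" using Suc.prems by (rule mat_of_rows_list_carrier)
    have IH: "length (result (mat_powers n X k (result (mat_mult n X Q)))) = Suc k"
      "\<And>j. j \<le> k \<Longrightarrow> length (result (mat_powers n X k (result (mat_mult n X Q))) ! j) = n"
      "\<And>j. j \<le> k \<Longrightarrow> mat_of_rows_list n (result (mat_powers n X k (result (mat_mult n X Q))) ! j) = ?X ^\<^sub>m j * (?X * ?Q)"
      using Suc.IH[of "result (mat_mult n X Q)"] mat_of_rows_list_mult[OF assms(1) Suc.prems] by auto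
    have "length (result (mat_powers n X (Suc k) Q) ! j) = n \<and>
       mat_of_rows_list n (result (mat_powers n X (Suc k) Q) ! j) = ?X ^\<^sub>m j * ?Q" if "j \<le> Suc k" for j
    proof (cases j)
      case 0
      thus ?thesis using Suc.prems X Q by simp
    next
      case (Suc i)
      have "?X ^\<^sub>m i * (?X * ?Q) = ?X ^\<^sub>m i * ?X * ?Q"
        using assoc_mult_mat[OF pow_carrier_mat[OF X] X Q] by simp
      thus ?thesis using IH(2,3)[of i] that Suc by simp
    qed
    thus ?case using IH(1) by simp
  qed
  thus "length (result (mat_powers n X k Q)) = Suc k"
    and "j \<le> k \<Longrightarrow> length (result (mat_powers n X k Q) ! j) = n"
    and "j \<le> k \<Longrightarrow> mat_of_rows_list n (result (mat_powers n X k Q) ! j) =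
      mat_of_rows_list n X ^\<^sub>m j * mat_of_rows_list n Q" by auto
qed

lemma cost_mat_powers: "cost (mat_powers n X k (Q :: complex list list)) \<le> k * (n * (n * (n * 2)))"
  by (induction k arbitrary: Q) (auto intro: add_mono cost_mat_mult)

definition powers_matrix :: "nat \<Rightarrow> complex list list \<Rightarrow> complex list list" where
  "powers_matrix n X = map (\<lambda>(a, b). map (\<lambda>Q. Q ! a ! b) (result (mat_powers n X n (result (mat_one n)))))
     (List.product [0..<n] [0..<n])"

lemma powers_matrix_kernel:
  assumes X: "length X = n"
  shows "r \<in> set (powers_matrix n X) \<Longrightarrow> length r = n + 1"
    and "(\<forall>r\<in>set (powers_matrix n X). row_form (n + 1) r x = 0) \<longleftrightarrow>
      (\<forall>a<n. \<forall>b<n. (\<Sum>k\<le>n. x k * (mat_of_rows_list n X ^\<^sub>m k) $$ (a, b)) = 0)"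
proof -
  let ?X = "mat_of_rows_list n X"
  define Qs where "Qs = result (mat_powers n X n (result (mat_one n)))"
  have one: "length (result (mat_one n)) = n" by (simp add: mat_one_def)
  have Xc: "?X \<in> carrier_mat n n" using X by (rule mat_of_rows_list_carrier)
  note P = mat_powers_correct[OF X one, where k = n, folded Qs_def]
  have len: "length Qs = n + 1" using P(1) by simp
  have ent: "Qs ! k ! a ! b = (?X ^\<^sub>m k) $$ (a, b)" if "a < n" "b < n" "k \<le> n" for a b k
  proof -
    have "Qs ! k ! a ! b = mat_of_rows_list n (Qs ! k) $$ (a, b)"
      using that P(2)[of k] by (simp add: mat_of_rows_list_def)
    also have "mat_of_rows_list n (Qs ! k) = ?X ^\<^sub>m k"
      using P(3)[of k] that right_mult_one_mat[OF pow_carrier_mat[OF Xc]]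
      by (simp add: mat_of_rows_list_one)
    finally show ?thesis .
  qed
  show "length r = n + 1" if "r \<in> set (powers_matrix n X)"
    using that by (auto simp: powers_matrix_def Qs_def[symmetric] len)
  have "row_form (n + 1) (map (\<lambda>Q. Q ! a ! b) Qs) x = (\<Sum>k\<le>n. x k * (?X ^\<^sub>m k) $$ (a, b))"
    if "a < n" "b < n" for a b
    unfolding row_form_def using that len
    by (intro sum.cong) (auto simp: ent mult.commute)
  thus "(\<forall>r\<in>set (powers_matrix n X). row_form (n + 1) r x = 0) \<longleftrightarrow>
      (\<forall>a<n. \<forall>b<n. (\<Sum>k\<le>n. x k * (?X ^\<^sub>m k) $$ (a, b)) = 0)"
    by (auto simp: powers_matrix_def Qs_def[symmetric])
qed

lemma length_powers_matrix [simp]: "length (powers_matrix n X) = n * n"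
  by (simp add: powers_matrix_def)

lemma result_min_poly:
  "result (min_poly n X) = (let R = result (rref (n + 1) (powers_matrix n X));
     k = (LEAST k. k \<notin> fst ` set R) in 1 # rev (map (\<lambda>i. - (snd (R ! i) ! k)) [0..<k]))"
  by (simp add: min_poly_def powers_matrix_def Let_def)

text \<open>Applied to the pivot columns: for \<open>i\<close> below the first column without pivot, row number \<open>i\<close> has its pivot in column \<open>i\<close>.\<close>

lemma strict_sorted_prefix:
  fixes xs :: "nat list"
  assumes s: "sorted_wrt (<) xs" and sub: "{..<k} \<subseteq> set xs" and i: "i < k"
  shows "i < length xs \<and> xs ! i = i"
  using i
proof (induction i rule: less_induct)
  case (less i)
  from less.prems sub obtain j where j: "j < length xs" "xs ! j = i" by (force simp: in_set_conv_nth)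
  have "j \<le> i" using sorted_wrt_less_idx[OF s j(1)] j(2) by simp
  moreover have "\<not> j < i" using less.IH[of j] less.prems j by auto
  ultimately show ?case using j by auto
qed

text \<open>Kernel vectors of the matrix of powers are the coefficient vectors of annihilating polynomials
  of degree at most \<open>n\<close>. An annihilator of degree below the first free column \<open>k\<close> would be a kernel vector
  supported on pivot columns, hence zero; and the null space vector of column \<open>k\<close> is monic of degree \<open>k\<close>.\<close>

theorem min_poly_correct:
  assumes X: "length X = n"
  shows "is_min_poly (mat_of_rows_list n X) (Poly (rev (result (min_poly n X))))"
    and "\<exists>cs. result (min_poly n X) = 1 # cs \<and> length cs \<le> n"
proof -
  let ?X = "mat_of_rows_list n X"
  define A where "A = powers_matrix n X"
  define R where "R = result (rref (n + 1) A)"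
  have Xc: "?X \<in> carrier_mat n n" using X by (rule mat_of_rows_list_carrier)
  interpret reduced_rows "n + 1" A R
    unfolding R_def A_def by (rule rref_correct) (use powers_matrix_kernel(1)[OF X] in blast)
  have ker: "kernel x \<longleftrightarrow> (\<forall>a<n. \<forall>b<n. (\<Sum>k\<le>n. x k * (?X ^\<^sub>m k) $$ (a, b)) = 0)" for x
    unfolding kernel_def unfolding A_def by (rule powers_matrix_kernel(2)[OF X])
  have ker_poly: "kernel (coeff p) \<longleftrightarrow> poly_at_mat p ?X = 0\<^sub>m (dim_row ?X) (dim_row ?X)"
    if "degree p \<le> n" for p
    unfolding ker by (rule poly_at_mat_eq_0_iff[OF Xc that, symmetric])
  have "\<exists>k\<le>n. k \<notin> pivots"
  proof (rule ccontr)
    assume "\<not> (\<exists>k\<le>n. k \<notin> pivots)"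
    hence "set free = {}" unfolding set_free by auto
    moreover have "degree (char_poly ?X) \<le> n" "coeff (char_poly ?X) n = 1"
      using degree_monic_char_poly[OF Xc] by auto
    moreover have "kernel (coeff (char_poly ?X))"
      using ker_poly cayley_hamilton[OF Xc] calculation by blast
    ultimately show False using kernel_eq_0[of "coeff (char_poly ?X)" n] by simp
  qed
  define k where "k = (LEAST k. k \<notin> pivots)"
  have k: "k \<le> n" "k \<notin> pivots" "\<And>i. i < k \<Longrightarrow> i \<in> pivots"
    using \<open>\<exists>k\<le>n. k \<notin> pivots\<close> LeastI_ex[of "\<lambda>k. k \<notin> pivots"] Least_le[of "\<lambda>k. k \<notin> pivots"] not_less_Least[of _ "\<lambda>k. k \<notin> pivots"]
    unfolding k_def by (blast intro: order_trans)+
  hence kf: "k \<in> set free" unfolding set_free by simp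
  define cs where "cs = map (\<lambda>i. - (snd (R ! i) ! k)) [0..<k]"
  have res: "result (min_poly n X) = 1 # rev cs"
    unfolding result_min_poly Let_def cs_def k_def pivots_def unfolding R_def A_def by simp
  thus "\<exists>cs. result (min_poly n X) = 1 # cs \<and> length cs \<le> n" using k(1) by (simp add: cs_def)
  define p where "p = Poly (cs @ [1])"
  have p: "Poly (rev (result (min_poly n X))) = p" by (simp add: res p_def)
  have coeff_p: "coeff p i = basis_entry k i" if i: "i \<le> n" for i
  proof (cases "i < k")
    case True
    have "{..<k} \<subseteq> set (map fst R)" using k(3) by (auto simp: pivots_def)
    from strict_sorted_prefix[OF sorted_pivots this True]
    have "i < length R" "fst (R ! i) = i" by auto
    hence "(i, snd (R ! i)) \<in> set R" by (metis nth_mem prod.collapse)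
    thus ?thesis using True by (simp add: p_def cs_def nth_default_def nth_append basis_entry_pivot[OF _ kf])
  next
    case False
    show ?thesis
    proof (cases "i = k")
      case True
      thus ?thesis by (simp add: p_def cs_def nth_default_def nth_append basis_entry_def)
    next
      case False
      with \<open>\<not> i < k\<close> have "i > k" by simp
      moreover have "basis_entry k i = 0"
      proof (cases "i \<in> pivots")
        case True
        then obtain r where r: "(i, r) \<in> set R" by (auto simp: pivots_def)
        thus ?thesis using basis_entry_pivot[OF r kf] nth_before_pivot[OF r \<open>i > k\<close>] by simp
      next
        case False
        hence "i \<in> set free" unfolding set_free using i by simp
        from basis_entry_free[OF this] show ?thesis using \<open>i > k\<close> by simp
      qed
      ultimately show ?thesis by (simp add: p_def cs_def nth_default_def)
    qed
  qed
  have ck: "coeff p k = 1" using coeff_p[OF k(1)] by (simp add: basis_entry_def)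
  have deg: "degree p = k"
  proof (rule antisym)
    show "degree p \<le> k" by (rule degree_le) (simp add: p_def cs_def nth_default_def)
    show "k \<le> degree p" using ck by (intro le_degree) simp
  qed
  have "kernel (coeff p)"
    using kernel_basis_entry[OF kf] unfolding ker by (simp add: coeff_p)
  hence "poly_at_mat p ?X = 0\<^sub>m (dim_row ?X) (dim_row ?X)" using ker_poly deg k(1) by simp
  moreover have "degree p \<le> degree q" if q: "q \<noteq> 0" "poly_at_mat q ?X = 0\<^sub>m (dim_row ?X) (dim_row ?X)" for q
  proof (rule ccontr)
    assume "\<not> degree p \<le> degree q"
    hence dq: "degree q < k" by (simp add: deg)
    hence "kernel (coeff q)" using q(2) ker_poly k(1) by simp
    moreover have "coeff q j = 0" if "j \<in> set free" for j
    proof -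
      have "\<not> j < k" using that k(3)[of j] unfolding set_free by blast
      thus ?thesis using dq by (simp add: coeff_eq_0)
    qed
    ultimately have "coeff q (degree q) = 0" using kernel_eq_0[of "coeff q" "degree q"] dq k(1) by simp
    thus False using q(1) by simp
  qed
  ultimately show "is_min_poly ?X (Poly (rev (result (min_poly n X))))"
    unfolding p is_min_poly_def using deg ck by auto
qed

lemma cost_min_poly:
  assumes X: "length X = n"
  shows "cost (min_poly n X) \<le> n * (n * (n * (n * 2))) + (n + 1) * (n * n * (2 * (n + 1) + 1)) + (n + 1)"
proof -
  define R where "R = result (rref (n + 1) (powers_matrix n X))"
  have rows: "\<forall>r\<in>set (powers_matrix n X). length r = n + 1" using powers_matrix_kernel(1)[OF X] by blast
  interpret reduced_rows "n + 1" "powers_matrix n X" R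
    unfolding R_def by (rule rref_correct[OF rows])
  define k where "k = (LEAST k. k \<notin> fst ` set R)"
  have "k \<le> n + 1" unfolding k_def using pivots_less[of "n + 1"] by (intro Least_le) (auto simp: pivots_def)
  have "cost (min_poly n X) = cost (mat_powers n X n (result (mat_one n)))
    + cost (rref (n + 1) (powers_matrix n X)) + k"
    by (simp add: min_poly_def powers_matrix_def R_def Let_def k_def mat_one_def sum_list_triv comp_def)
  also have "\<dots> \<le> n * (n * (n * (n * 2))) + (n + 1) * (length (powers_matrix n X) * (2 * (n + 1) + 1)) + (n + 1)"
    by (intro add_mono cost_mat_powers cost_rref[OF rows] \<open>k \<le> n + 1\<close>)
  finally show ?thesis by simp
qed

section \<open>Greatest common divisors\<close>

text \<open>A definition rather than an abbreviation, so that simplification does not expand \<open>rev\<close>.\<close>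

definition poly_of :: "complex list \<Rightarrow> complex poly" where
  "poly_of l = Poly (rev l)"

text \<open>Only for such lists does the length determine the degree.\<close>

definition stripped :: "complex list \<Rightarrow> bool" where
  "stripped l \<longleftrightarrow> l = [] \<or> hd l \<noteq> 0"

lemma poly_of_Nil [simp]: "poly_of [] = 0"
  by (simp add: poly_of_def)

lemma coeff_poly_of: "coeff (poly_of l) i = (if i < length l then l ! (length l - 1 - i) else 0)"
  by (auto simp: poly_of_def nth_default_def rev_nth)

lemma poly_of_append: "poly_of (u @ v) = poly_of u * Polynomial.monom 1 (length v) + poly_of v"
  by (rule poly_eqI) (auto simp: coeff_poly_of coeff_monom_mult mult.commute[of _ "Polynomial.monom 1 _"] nth_append)

lemma poly_of_Cons: "poly_of (x # v) = Polynomial.monom x (length v) + poly_of v"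
  by (rule poly_eqI) (auto simp: coeff_poly_of nth_Cons')

lemma stripped_degree:
  assumes "stripped (x # l)"
  shows "degree (poly_of (x # l)) = length l" "lead_coeff (poly_of (x # l)) = x"
proof -
  have c: "coeff (poly_of (x # l)) (length l) = x" by (simp add: coeff_poly_of)
  show d: "degree (poly_of (x # l)) = length l"
  proof (rule antisym)
    show "degree (poly_of (x # l)) \<le> length l" by (rule degree_le) (simp add: coeff_poly_of)
    show "length l \<le> degree (poly_of (x # l))" using c assms by (intro le_degree) (simp add: stripped_def)
  qed
  show "lead_coeff (poly_of (x # l)) = x" unfolding d by (rule c)
qed

lemma stripped_eq_0: "stripped l \<Longrightarrow> poly_of l = 0 \<longleftrightarrow> l = []"
proof (cases l)
  case (Cons x l')
  assume "stripped l"
  hence "lead_coeff (poly_of l) = x" "x \<noteq> 0"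
    using stripped_degree(2)[of x l'] Cons by (simp_all add: stripped_def)
  thus ?thesis using Cons by auto
qed simp

lemma strip_correct:
  "poly_of (result (strip l)) = poly_of l" "stripped (result (strip l))"
  "length (result (strip l)) \<le> length l" "cost (strip l) \<le> length l"
proof -
  have "poly_of (result (strip l)) = poly_of l \<and> stripped (result (strip l)) \<and>
    length (result (strip l)) \<le> length l \<and> cost (strip l) \<le> length l"
  proof (induction l)
    case (Cons x l)
    thus ?case by (auto simp: poly_of_Cons stripped_def)
  qed (simp add: stripped_def)
  thus "poly_of (result (strip l)) = poly_of l" "stripped (result (strip l))"
    "length (result (strip l)) \<le> length l" "cost (strip l) \<le> length l" by auto
qed

lemma poly_deriv_correct:
  "poly_of (result (poly_deriv p)) = pderiv (poly_of p)" "stripped (result (poly_deriv p))"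
  "length (result (poly_deriv p)) \<le> length p" "cost (poly_deriv p) \<le> 2 * length p"
proof -
  define q where "q = map (\<lambda>i. of_nat (length p - 1 - i) * p ! i) [0..<length p - 1]"
  have res: "result (poly_deriv p) = result (strip q)" by (simp add: poly_deriv_def q_def)
  have lq: "length q = length p - 1" by (simp add: q_def)
  have "poly_of q = pderiv (poly_of p)"
  proof (rule poly_eqI)
    fix i
    show "coeff (poly_of q) i = coeff (pderiv (poly_of p)) i"
    proof (cases "Suc i < length p")
      case True
      have "length p - Suc (length p - Suc (Suc i)) = Suc i" "length p - Suc (Suc i) < length p - 1"
        using True by simp_all
      hence "q ! (length p - Suc (Suc i)) = of_nat (Suc i) * p ! (length p - Suc (Suc i))"
        unfolding q_def by simp
      thus ?thesis using True by (simp add: coeff_pderiv coeff_poly_of lq)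
    qed (simp add: coeff_pderiv coeff_poly_of lq)
  qed
  thus "poly_of (result (poly_deriv p)) = pderiv (poly_of p)" "stripped (result (poly_deriv p))"
    by (simp_all add: res strip_correct)
  show "length (result (poly_deriv p)) \<le> length p" using strip_correct(3)[of q] lq res by simp
  have "cost (poly_deriv p) = length q + cost (strip q)"
    by (simp add: poly_deriv_def q_def sum_list_triv)
  thus "cost (poly_deriv p) \<le> 2 * length p" using strip_correct(4)[of q] lq by simp
qed

lemma poly_of_map2:
  "length u = length w \<Longrightarrow>
   poly_of (map (\<lambda>(x, y). x - q * y) (zip u w)) = poly_of u - Polynomial.smult q (poly_of w)"
  by (rule poly_eqI) (auto simp: coeff_poly_of)

text \<open>The step subtracts \<open>q x\<^sup>k b\<close> from \<open>a\<close>, where \<open>q\<close> is the quotient of the leading coefficients and \<open>k\<close> the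
  difference of the lengths. The leading term cancels and is dropped.\<close>

lemma division_step_correct:
  assumes b: "stripped b" "b \<noteq> []" and len: "length b \<le> length a"
  shows "length (result (division_step b a)) = length a - 1"
    and "\<exists>q. poly_of (result (division_step b a)) = poly_of a - q * poly_of b"
    and "cost (division_step b a) \<le> 1 + 2 * length b"
proof -
  obtain y w where bw: "b = y # w" using b by (cases b) auto
  obtain x s where as: "a = x # s" using b len by (cases a) auto
  have y: "y \<noteq> 0" using b by (simp add: bw stripped_def)
  define q where "q = x / y"
  define u v where "u = take (length w) s" and "v = drop (length w) s"
  have s: "s = u @ v" by (simp add: u_def v_def)
  have lu: "length u = length w" using len by (simp add: u_def as bw)
  have res: "result (division_step b a) = map (\<lambda>(x, y). x - q * y) (zip u w) @ v"
    by (simp add: division_step_def as bw q_def case_prod_unfold s zip_append1 lu)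
  show "length (result (division_step b a)) = length a - 1"
    unfolding res by (simp add: lu as s)
  have "poly_of a = Polynomial.monom x (length w + length v) + poly_of u * Polynomial.monom 1 (length v) + poly_of v"
    by (simp add: as s poly_of_Cons poly_of_append lu)
  moreover have "poly_of b = Polynomial.monom y (length w) + poly_of w"
    by (simp add: bw poly_of_Cons)
  moreover have "poly_of (result (division_step b a)) =
      (poly_of u - Polynomial.smult q (poly_of w)) * Polynomial.monom 1 (length v) + poly_of v"
    unfolding res poly_of_append by (simp add: poly_of_map2 lu)
  moreover have "Polynomial.monom q (length v) * Polynomial.monom y (length w) = Polynomial.monom x (length w + length v)"
    using y by (simp add: mult_monom q_def add.commute)
  moreover have "Polynomial.monom q (length v) = Polynomial.smult q (Polynomial.monom 1 (length v))"
    by (simp add: smult_monom)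
  ultimately have "poly_of (result (division_step b a)) = poly_of a - Polynomial.monom q (length v) * poly_of b"
    by (simp add: algebra_simps)
  thus "\<exists>q. poly_of (result (division_step b a)) = poly_of a - q * poly_of b" by blast
  have "cost (division_step b a) = 1 + 2 * length (zip s w)"
    by (simp add: division_step_def as bw case_prod_unfold sum_list_triv)
  thus "cost (division_step b a) \<le> 1 + 2 * length b" by (simp add: bw)
qed

lemma poly_rem_correct:
  assumes b: "stripped b" "b \<noteq> []"
  shows "stripped (result (poly_rem a b))" "length (result (poly_rem a b)) < length b"
    and "gcd (poly_of b) (poly_of (result (poly_rem a b))) = gcd (poly_of a) (poly_of b)"
    and "cost (poly_rem a b) \<le> (length a + 1) * (1 + 2 * length b) + length a"
proof -
  define T where "T = length a + 1 - length b"
  define S where "S t = result (foldM (\<lambda>_. division_step b) [0..<t] a)" for t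
  have S: "length (S t) = length a - t \<and> (\<exists>q. poly_of (S t) = poly_of a - q * poly_of b) \<and>
    cost (foldM (\<lambda>_. division_step b) [0..<t] a) \<le> t * (1 + 2 * length b)" if "t \<le> T" for t
    using that
  proof (induction t)
    case 0
    thus ?case by (auto simp: S_def intro: exI[of _ 0])
  next
    case (Suc t)
    then obtain q where IH: "length (S t) = length a - t" "poly_of (S t) = poly_of a - q * poly_of b"
      "cost (foldM (\<lambda>_. division_step b) [0..<t] a) \<le> t * (1 + 2 * length b)" by auto
    have len: "length b \<le> length (S t)" using Suc.prems IH(1) by (simp add: T_def)
    note step = division_step_correct[OF b len]
    have SS: "S (Suc t) = result (division_step b (S t))" by (simp add: S_def)
    obtain q' where q': "poly_of (result (division_step b (S t))) = poly_of (S t) - q' * poly_of b"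
      using step(2) by blast
    have "poly_of (S (Suc t)) = poly_of a - (q + q') * poly_of b"
      unfolding SS q' IH(2) by (simp add: algebra_simps)
    moreover have "cost (foldM (\<lambda>_. division_step b) [0..<Suc t] a) =
      cost (foldM (\<lambda>_. division_step b) [0..<t] a) + cost (division_step b (S t))"
      by (simp add: S_def)
    ultimately show ?case using step(1,3) IH(1,3) SS by auto
  qed
  obtain q where q: "poly_of (S T) = poly_of a - q * poly_of b" using S[of T] by auto
  have res: "result (poly_rem a b) = result (strip (S T))"
    by (simp add: poly_rem_def S_def T_def)
  show "stripped (result (poly_rem a b))" unfolding res by (rule strip_correct)
  have "length (S T) < length b" using S[of T] b by (cases b) (auto simp: T_def)
  thus "length (result (poly_rem a b)) < length b" using strip_correct(3)[of "S T"] res by simp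
  have "poly_of a = q * poly_of b + poly_of (S T)" by (simp add: q)
  hence "gcd (poly_of b) (poly_of a) = gcd (poly_of b) (poly_of (S T))" by (simp only: gcd_add_mult)
  thus "gcd (poly_of b) (poly_of (result (poly_rem a b))) = gcd (poly_of a) (poly_of b)"
    by (simp add: res strip_correct gcd.commute)
  have "cost (poly_rem a b) = cost (foldM (\<lambda>_. division_step b) [0..<T] a) + cost (strip (S T))"
    by (simp add: poly_rem_def S_def T_def)
  also have "\<dots> \<le> T * (1 + 2 * length b) + length (S T)"
    using S[of T] strip_correct(4)[of "S T"] by simp
  also have "\<dots> \<le> (length a + 1) * (1 + 2 * length b) + length a"
    using S[of T] by (intro add_mono mult_le_mono) (auto simp: T_def)
  finally show "cost (poly_rem a b) \<le> (length a + 1) * (1 + 2 * length b) + length a" .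
qed

lemma euclid_correct:
  assumes "stripped a" "stripped b" "length b \<le> k"
  shows "stripped (result (euclid k a b)) \<and>
    normalize (poly_of (result (euclid k a b))) = gcd (poly_of a) (poly_of b)"
  using assms
proof (induction k arbitrary: a b)
  case (Suc k)
  show ?case
  proof (cases "b = []")
    case False
    note rem = poly_rem_correct[OF Suc.prems(2) False, of a]
    from Suc.IH[OF Suc.prems(2) rem(1)] rem(2,3) Suc.prems(3) False show ?thesis by simp
  qed (use Suc.prems in simp)
qed simp

lemma euclid_cost:
  assumes "length a \<le> L" "length b \<le> L" "stripped b"
  shows "cost (euclid k a b) \<le> k * ((L + 1) * (1 + 2 * L) + L) \<and> length (result (euclid k a b)) \<le> L"
  using assms
proof (induction k arbitrary: a b)
  case (Suc k)
  show ?case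
  proof (cases "b = []")
    case False
    note rem = poly_rem_correct[OF Suc.prems(3) False, of a]
    have "cost (poly_rem a b) \<le> (length a + 1) * (1 + 2 * length b) + length a" by (rule rem(4))
    also have "\<dots> \<le> (L + 1) * (1 + 2 * L) + L"
      using Suc.prems by (intro add_mono mult_le_mono) auto
    finally have "cost (poly_rem a b) \<le> (L + 1) * (1 + 2 * L) + L" .
    moreover have "length (result (poly_rem a b)) \<le> L" using rem(2) Suc.prems(2) by simp
    ultimately show ?thesis using Suc.IH[OF Suc.prems(2) _ rem(1)] False
      by (auto intro: add_mono)
  qed (use Suc.prems in simp)
qed simp

lemma normalize_poly_of:
  assumes "stripped (x # l)"
  shows "normalize (poly_of (x # l)) = poly_of (map (\<lambda>y. y / x) (x # l))"
proof -
  have x: "x \<noteq> 0" using assms by (simp add: stripped_def)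
  show ?thesis
  proof (rule poly_eqI)
    fix i
    have "coeff (normalize (poly_of (x # l))) i = coeff (poly_of (x # l)) i / x"
      unfolding coeff_normalize stripped_degree(2)[OF assms] by simp
    thus "coeff (normalize (poly_of (x # l))) i = coeff (poly_of (map (\<lambda>y. y / x) (x # l))) i"
      by (simp add: coeff_poly_of nth_Cons' del: coeff_normalize)
  qed
qed

lemma poly_gcd_correct:
  assumes p: "stripped p" "p \<noteq> []" and q: "stripped q"
  shows "poly_of (result (poly_gcd p q)) = gcd (poly_of p) (poly_of q)"
    and "length (result (poly_gcd p q)) = 1 \<longleftrightarrow> gcd (poly_of p) (poly_of q) = 1"
proof -
  define g where "g = result (euclid (length q) p q)"
  have g: "stripped g" "normalize (poly_of g) = gcd (poly_of p) (poly_of q)"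
    using euclid_correct[OF p(1) q order_refl] by (auto simp: g_def)
  have "gcd (poly_of p) (poly_of q) \<noteq> 0" using stripped_eq_0[OF p(1)] p(2) by simp
  hence "g \<noteq> []" using g(2) by auto
  then obtain x l where gx: "g = x # l" by (cases g) auto
  have res: "result (poly_gcd p q) = map (\<lambda>y. y / x) (x # l)"
    using gx by (simp add: poly_gcd_def g_def)
  show eq: "poly_of (result (poly_gcd p q)) = gcd (poly_of p) (poly_of q)"
    unfolding res using normalize_poly_of[of x l] g by (simp add: gx)
  have x: "x \<noteq> 0" using g(1) by (simp add: gx stripped_def)
  have "stripped (result (poly_gcd p q))" using x by (simp add: res stripped_def)
  hence d: "degree (poly_of (result (poly_gcd p q))) = length l"
    unfolding res using stripped_degree(1) by simp
  show "length (result (poly_gcd p q)) = 1 \<longleftrightarrow> gcd (poly_of p) (poly_of q) = 1"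
  proof
    assume "length (result (poly_gcd p q)) = 1"
    hence "result (poly_gcd p q) = [1]" using x by (simp add: res)
    thus "gcd (poly_of p) (poly_of q) = 1" using eq by (simp add: poly_of_def one_pCons)
  next
    assume "gcd (poly_of p) (poly_of q) = 1"
    hence "length l = 0" using d eq by simp
    thus "length (result (poly_gcd p q)) = 1" by (simp add: res)
  qed
qed

lemma cost_poly_gcd:
  assumes "length p \<le> L" "length q \<le> L" "stripped q"
  shows "cost (poly_gcd p q) \<le> L * ((L + 1) * (1 + 2 * L) + L) + L"
proof -
  note e = euclid_cost[OF assms, of "length q"]
  have "cost (poly_gcd p q) = cost (euclid (length q) p q) + length (result (euclid (length q) p q))"
    by (simp add: poly_gcd_def sum_list_triv)
  also have "\<dots> \<le> length q * ((L + 1) * (1 + 2 * L) + L) + L" using e by simp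
  also have "\<dots> \<le> L * ((L + 1) * (1 + 2 * L) + L) + L" using assms(2) by (intro add_mono mult_le_mono) auto
  finally show ?thesis .
qed

section \<open>The criterion\<close>

lemma result_center_criterion:
  fixes n d r :: nat and ts g :: "complex terms"
  assumes "result (reduce_form n ts) = (r, g)"
  defines "Xs \<equiv> result (compute_center r d g)"
  defines "ps \<equiv> map (\<lambda>X. result (min_poly r X)) Xs"
  defines "gs \<equiv> map (\<lambda>p. result (poly_gcd p (result (poly_deriv p)))) ps"
  shows "result (center_criterion n d ts) =
    (if length Xs \<noteq> r then
       \<lparr>red_vars = r, red_form = g, center_basis = Xs, min_polys = [], gcds = [],
        reports_diagonalizable = False\<rparr>
     else
       \<lparr>red_vars = r, red_form = g, center_basis = Xs, min_polys = ps, gcds = gs,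
        reports_diagonalizable = (\<forall>q\<in>set gs. length q = 1)\<rparr>)"
  using assms(1) by (simp add: center_criterion_def Xs_def ps_def gs_def)

lemma cost_center_criterion:
  fixes n d r :: nat and ts g :: "complex terms"
  assumes "result (reduce_form n ts) = (r, g)"
  defines "Xs \<equiv> result (compute_center r d g)"
  defines "ps \<equiv> map (\<lambda>X. result (min_poly r X)) Xs"
  shows "cost (center_criterion n d ts) =
    cost (reduce_form n ts) + cost (compute_center r d g) +
    (if length Xs \<noteq> r then 0 else (\<Sum>X\<leftarrow>Xs. cost (min_poly r X)) +
       (\<Sum>p\<leftarrow>ps. cost (poly_deriv p) + cost (poly_gcd p (result (poly_deriv p)))))"
  using assms(1) by (simp add: center_criterion_def Xs_def ps_def)

theorem criterion_correct:
  assumes h: "homogeneous n d f"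
  shows "carries_out_criterion n f (criterion_result n d f)"
proof -
  let ?ts = "Poly_Mapping.items f"
  obtain r gts g where red: "result (reduce_form n ?ts) = (r, gts)" and g: "represents gts g"
    and hg: "homogeneous r d g"
    and indep: "if partials_independent n f then r = n \<and> g = f else r < n"
    and P: "\<exists>P\<in>carrier_mat n n. invertible_mat P \<and> lin_subst n P f = g"
    and nd: "nondegenerate r g"
    using reduce_form_correct[OF h represents_items[of f]] by metis
  define Xs where "Xs = result (compute_center r d gts)"
  define ps where "ps = map (\<lambda>X. result (min_poly r X)) Xs"
  define gs where "gs = map (\<lambda>p. result (poly_gcd p (result (poly_deriv p)))) ps"
  note res = result_center_criterion[OF red, of d, folded Xs_def, folded ps_def, folded gs_def]
  note C = compute_center_correct[OF hg g, folded Xs_def]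
  define out where "out = criterion_result n d f"
  have out: "out = (if length Xs \<noteq> r then
       \<lparr>red_vars = r, red_form = gts, center_basis = Xs, min_polys = [], gcds = [],
        reports_diagonalizable = False\<rparr>
     else
       \<lparr>red_vars = r, red_form = gts, center_basis = Xs, min_polys = ps, gcds = gs,
        reports_diagonalizable = (\<forall>q\<in>set gs. length q = 1)\<rparr>)"
    unfolding out_def criterion_result_def by (rule res)
  have common: "red_vars out = r" "red_form out = gts" "center_basis out = Xs"
    by (simp_all add: out)
  have gv: "Poly_Mapping.the_value gts = g" by (rule represents_the_value[OF g])
  have step3: "if length Xs \<noteq> r then \<not> reports_diagonalizable out
      else list_all2 is_min_poly (map (mat_of_rows_list r) Xs) (map (\<lambda>p. Poly (rev p)) (min_polys out)) \<and>
        map (\<lambda>q. Poly (rev q)) (gcds out) = map (\<lambda>p. gcd p (pderiv p)) (map (\<lambda>p. Poly (rev p)) (min_polys out)) \<and>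
        (reports_diagonalizable out \<longleftrightarrow>
          (\<forall>p\<in>set (map (\<lambda>p. Poly (rev p)) (min_polys out)). gcd p (pderiv p) = 1))"
  proof (cases "length Xs = r")
    case True
    hence mp: "min_polys out = ps" "gcds out = gs" "reports_diagonalizable out \<longleftrightarrow> (\<forall>q\<in>set gs. length q = 1)"
      by (simp_all add: out)
    have gcds: "poly_of (result (poly_gcd p (result (poly_deriv p)))) = gcd (poly_of p) (pderiv (poly_of p))"
      "length (result (poly_gcd p (result (poly_deriv p)))) = 1 \<longleftrightarrow> gcd (poly_of p) (pderiv (poly_of p)) = 1"
      if p: "p \<in> set ps" for p
    proof -
      obtain X where "X \<in> set Xs" "p = result (min_poly r X)" using p by (auto simp: ps_def)
      moreover from C(4)[OF this(1)] have "length X = r" by blast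
      ultimately obtain cs where "p = 1 # cs" using min_poly_correct(2)[of X r] by blast
      hence "stripped p" "p \<noteq> []" by (simp_all add: stripped_def)
      from poly_gcd_correct[OF this poly_deriv_correct(2)[of p]]
      show "poly_of (result (poly_gcd p (result (poly_deriv p)))) = gcd (poly_of p) (pderiv (poly_of p))"
        "length (result (poly_gcd p (result (poly_deriv p)))) = 1 \<longleftrightarrow> gcd (poly_of p) (pderiv (poly_of p)) = 1"
        by (simp_all add: poly_deriv_correct(1))
    qed
    have "list_all2 is_min_poly (map (mat_of_rows_list r) Xs) (map (\<lambda>p. Poly (rev p)) ps)"
      unfolding ps_def list.rel_map using min_poly_correct(1) C(4) by (auto intro!: list.rel_refl_strong)
    moreover have "map (\<lambda>q. Poly (rev q)) gs = map (\<lambda>p. gcd p (pderiv p)) (map (\<lambda>p. Poly (rev p)) ps)"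
      unfolding gs_def map_map using gcds(1) by (intro map_cong) (auto simp: poly_of_def)
    moreover have "(\<forall>q\<in>set gs. length q = 1) \<longleftrightarrow>
        (\<forall>p\<in>set (map (\<lambda>p. Poly (rev p)) ps). gcd p (pderiv p) = 1)"
      using gcds(2) by (auto simp: gs_def poly_of_def)
    ultimately show ?thesis using True mp by simp
  qed (simp add: out)
  have vg: "vars g \<subseteq> {..<r}" using hg by (simp add: homogeneous_def)
  show ?thesis
    unfolding carries_out_criterion_def Let_def out_def[symmetric] common gv C(3)
    using indep P vg nd C(1,2) step3 by (intro conjI)
qed

lemma monoms_mono: "r \<le> n \<Longrightarrow> monoms r k \<subseteq> monoms n k"
  by (auto simp: monoms_def)

text \<open>All sizes after the reduction are bounded by those before it. The term \<open>n\<^sup>6 M\<close> stems from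
  eliminating \<open>n\<^sup>2\<close> unknowns from \<open>O(n\<^sup>2 M)\<close> equations of length \<open>n\<^sup>2\<close>, and \<open>n\<^sup>5\<close> from processing at most
  \<open>n\<close> matrices with \<open>O(n\<^sup>4)\<close> operations each.\<close>

lemma criterion_cost_le:
  assumes h: "homogeneous n d f" and n: "n \<ge> 1"
  shows "criterion_cost n d f \<le>
    6 * (n ^ 3 * card (keys f)) + 4 * (n ^ 6 * card (monoms n (d - 2))) + 55 * n ^ 5"
proof -
  let ?ts = "Poly_Mapping.items f"
  define t where "t = card (keys f)"
  define M where "M = card (monoms n (d - 2))"
  have lt: "length ?ts = t" by (simp add: t_def length_items)
  obtain r gts g where red: "result (reduce_form n ?ts) = (r, gts)" and g: "represents gts g"
    and hg: "homogeneous r d g" and lg: "length gts \<le> t" and r: "r \<le> n"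
    using reduce_form_correct[OF h represents_items[of f]] lt by metis
  define Xs where "Xs = result (compute_center r d gts)"
  define ps where "ps = map (\<lambda>X. result (min_poly r X)) Xs"
  have np: "n ^ j \<le> n ^ k" if "j \<le> k" for j k using n that by (intro power_increasing)
  have c1: "cost (reduce_form n ?ts) \<le> 4 * (n ^ 3 * t)"
  proof -
    have "n * t \<le> n ^ 3 * t" using np[of 1 3] by simp
    moreover have "n * (n * t * (2 * n + 1)) = 2 * (n ^ 3 * t) + n ^ 2 * t"
      by (simp add: algebra_simps power2_eq_square power3_eq_cube)
    moreover have "n ^ 2 * t \<le> n ^ 3 * t" using np[of 2 3] by simp
    ultimately show ?thesis using cost_reduce_form[of n ?ts] unfolding lt by linarith
  qed
  have Mr: "card (monoms r (d - 2)) \<le> M"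
    unfolding M_def by (rule card_mono[OF finite_monoms monoms_mono[OF r]])
  have c2: "cost (compute_center r d gts) \<le> 2 * (n ^ 3 * t) + 4 * (n ^ 6 * M) + n ^ 5"
  proof -
    have "r * length gts \<le> n * t" "r * (r * length gts) \<le> n * (n * t)"
      using r lg by (intro mult_le_mono; simp)+
    moreover have "n * t \<le> n ^ 3 * t" using np[of 1 3] by simp
    moreover have "n * (n * t) \<le> n ^ 3 * t" using np[of 2 3] by (simp add: power2_eq_square mult.assoc[symmetric])
    moreover have "r * r * M * (r * r) \<le> n * n * M * (n * n)" using r by (intro mult_le_mono) auto
    moreover have "n * n * M * (n * n) = n ^ 4 * M" by (simp add: power4_eq_xxxx algebra_simps)
    moreover have "n ^ 4 * M \<le> n ^ 6 * M" using np[of 4 6] by simp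
    moreover have "r * r * (r * r * M * (2 * (r * r) + 1)) \<le> n * n * (n * n * M * (2 * (n * n) + 1))"
      using r by (intro mult_le_mono add_mono) auto
    moreover have "n * n * (n * n * M * (2 * (n * n) + 1)) = 2 * (n ^ 6 * M) + n ^ 4 * M"
      by (simp add: algebra_simps power_numeral_reduce)
    moreover have "r * r * (r * r) \<le> n * n * (n * n)" using r by (intro mult_le_mono) auto
    moreover have "n * n * (n * n) = n ^ 4" by (simp add: power4_eq_xxxx algebra_simps)
    moreover have "n ^ 4 \<le> n ^ 5" using np[of 4 5] by simp
    ultimately show ?thesis using cost_compute_center[OF g Mr] by linarith
  qed
  have lX: "length X = r" if "X \<in> set Xs" for X
    using compute_center_correct(4)[OF hg g] that by (simp add: Xs_def)
  have r1: "r + 1 \<le> 2 * n" "r + 1 + 1 \<le> 3 * n" "2 * (r + 1) + 1 \<le> 5 * n" "1 + 2 * (r + 1) \<le> 5 * n" using r n by auto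
  have c3: "(\<Sum>X\<leftarrow>Xs. cost (min_poly r X)) \<le> 14 * n ^ 5" if "length Xs = r"
  proof -
    have "cost (min_poly r X) \<le> 14 * n ^ 4" if "X \<in> set Xs" for X
    proof -
      have "r * (r * (r * (r * 2))) \<le> n * (n * (n * (n * 2)))" using r by (intro mult_le_mono) auto
      moreover have "(r + 1) * (r * r * (2 * (r + 1) + 1)) \<le> (2 * n) * (n * n * (5 * n))"
        using r r1 by (intro mult_le_mono) auto
      moreover have "n * (n * (n * (n * 2))) = 2 * n ^ 4" "(2 * n) * (n * n * (5 * n)) = 10 * n ^ 4"
        by (simp_all add: power4_eq_xxxx algebra_simps)
      moreover have "r + 1 \<le> 2 * n ^ 4" using r1(1) np[of 1 4] by simp
      ultimately show ?thesis using cost_min_poly[OF lX[OF that]] by linarith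
    qed
    hence "(\<Sum>X\<leftarrow>Xs. cost (min_poly r X)) \<le> length Xs * (14 * n ^ 4)" by (rule sum_list_le_length)
    also have "\<dots> \<le> n * (14 * n ^ 4)" using that r by (intro mult_le_mono) auto
    also have "\<dots> = 14 * n ^ 5" by (simp add: power_numeral_reduce)
    finally show ?thesis .
  qed
  have c4: "(\<Sum>p\<leftarrow>ps. cost (poly_deriv p) + cost (poly_gcd p (result (poly_deriv p)))) \<le> 40 * n ^ 5"
    if "length Xs = r"
  proof -
    have "cost (poly_deriv p) + cost (poly_gcd p (result (poly_deriv p))) \<le> 40 * n ^ 4" if p: "p \<in> set ps" for p
    proof -
      obtain X where X: "X \<in> set Xs" "p = result (min_poly r X)" using p by (auto simp: ps_def)
      obtain cs where "p = 1 # cs" "length cs \<le> r" using min_poly_correct(2)[OF lX[OF X(1)]] X(2) by blast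
      hence lp: "length p \<le> r + 1" by simp
      note D = poly_deriv_correct[of p]
      have "cost (poly_gcd p (result (poly_deriv p))) \<le>
        (r + 1) * ((r + 1 + 1) * (1 + 2 * (r + 1)) + (r + 1)) + (r + 1)"
        by (rule cost_poly_gcd) (use lp D(2,3) in auto)
      also have "\<dots> \<le> (2 * n) * ((3 * n) * (5 * n) + 2 * n) + 2 * n"
        using r1 by (intro add_mono mult_le_mono)
      also have "\<dots> = 30 * n ^ 3 + 4 * n ^ 2 + 2 * n"
        by (simp add: algebra_simps power2_eq_square power3_eq_cube)
      finally have "cost (poly_gcd p (result (poly_deriv p))) \<le> 30 * n ^ 3 + 4 * n ^ 2 + 2 * n" .
      moreover have "cost (poly_deriv p) \<le> 4 * n" using D(4) lp r1(1) by linarith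
      moreover have "n ^ 3 \<le> n ^ 4" "n ^ 2 \<le> n ^ 4" "n \<le> n ^ 4" using np[of 3 4] np[of 2 4] np[of 1 4] by simp_all
      ultimately show ?thesis by linarith
    qed
    hence "(\<Sum>p\<leftarrow>ps. cost (poly_deriv p) + cost (poly_gcd p (result (poly_deriv p)))) \<le> length ps * (40 * n ^ 4)"
      by (rule sum_list_le_length)
    also have "\<dots> \<le> n * (40 * n ^ 4)" using that r by (intro mult_le_mono) (auto simp: ps_def)
    also have "\<dots> = 40 * n ^ 5" by (simp add: power_numeral_reduce)
    finally show ?thesis .
  qed
  have c34: "(if length Xs \<noteq> r then 0 else (\<Sum>X\<leftarrow>Xs. cost (min_poly r X)) +
       (\<Sum>p\<leftarrow>ps. cost (poly_deriv p) + cost (poly_gcd p (result (poly_deriv p)))))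
    \<le> 14 * n ^ 5 + 40 * n ^ 5"
    using add_mono[OF c3 c4] by (simp only: split: if_split) blast
  have "criterion_cost n d f \<le> 4 * (n ^ 3 * t) + (2 * (n ^ 3 * t) + 4 * (n ^ 6 * M) + n ^ 5)
    + (14 * n ^ 5 + 40 * n ^ 5)"
    unfolding criterion_cost_def cost_center_criterion[OF red, of d, folded Xs_def, folded ps_def]
    by (intro add_mono c1 c2 c34)
  thus ?thesis unfolding t_def M_def by linarith
qed

theorem mainTheorem2:
  shows "(\<forall>n\<ge>1. \<forall>d\<ge>3. \<forall>f. homogeneous n d f \<longrightarrow>
            carries_out_criterion n f (criterion_result n d f))
       \<and> (\<exists>C::nat. \<forall>n\<ge>1. \<forall>d\<ge>3. \<forall>f. homogeneous n d f \<longrightarrow>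
            criterion_cost n d f \<le> C * (n ^ 3 * d ^ 3 * card (keys f) + n ^ (d + 4)))
       \<and> (\<forall>n\<ge>1. \<exists>(C::nat) k. \<forall>d\<ge>3. \<forall>f. homogeneous n d f \<longrightarrow>
            criterion_cost n d f \<le> C * d ^ k)
       \<and> (\<forall>d\<ge>3. \<exists>(C::nat) k. \<forall>n\<ge>1. \<forall>f. homogeneous n d f \<longrightarrow>
            criterion_cost n d f \<le> C * n ^ k)"
proof (intro conjI)
  show "\<forall>n\<ge>1. \<forall>d\<ge>3. \<forall>f. homogeneous n d f \<longrightarrow> carries_out_criterion n f (criterion_result n d f)"
    using criterion_correct by blast
  have general: "criterion_cost n d f \<le> 6 * (n ^ 3 * card (keys f)) + 59 * n ^ (d + 4)"
    if "n \<ge> 1" "d \<ge> 3" "homogeneous n d f" for n d f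
  proof -
    have "n ^ 6 * card (monoms n (d - 2)) \<le> n ^ 6 * n ^ (d - 2)"
      by (intro mult_le_mono card_monoms_le_power order_refl)
    also have "\<dots> = n ^ (d + 4)" using that(2) by (simp add: power_add[symmetric] add.commute)
    finally have "n ^ 6 * card (monoms n (d - 2)) \<le> n ^ (d + 4)" .
    moreover have "n ^ 5 \<le> n ^ (d + 4)" using that by (intro power_increasing) auto
    ultimately show ?thesis using criterion_cost_le[OF that(3,1)] by linarith
  qed
  have "criterion_cost n d f \<le> 59 * (n ^ 3 * d ^ 3 * card (keys f) + n ^ (d + 4))"
    if "n \<ge> 1" "d \<ge> 3" "homogeneous n d f" for n d f
  proof -
    have "n ^ 3 * card (keys f) \<le> n ^ 3 * d ^ 3 * card (keys f)" using that(2) by simp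
    thus ?thesis using general[OF that] unfolding distrib_left by linarith
  qed
  thus "\<exists>C::nat. \<forall>n\<ge>1. \<forall>d\<ge>3. \<forall>f. homogeneous n d f \<longrightarrow>
            criterion_cost n d f \<le> C * (n ^ 3 * d ^ 3 * card (keys f) + n ^ (d + 4))" by blast
  show "\<forall>n\<ge>1. \<exists>(C::nat) k. \<forall>d\<ge>3. \<forall>f. homogeneous n d f \<longrightarrow> criterion_cost n d f \<le> C * d ^ k"
  proof (intro allI impI)
    fix n :: nat assume n: "n \<ge> 1"
    have "criterion_cost n d f \<le> (6 * (n ^ 3 * 2 ^ n) + 4 * n ^ 6 + 55 * n ^ 5) * d ^ n"
      if d: "d \<ge> 3" and h: "homogeneous n d f" for d f
    proof -
      have "card (keys f) \<le> card (monoms n d)"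
        by (rule card_mono[OF finite_monoms keys_homogeneous[OF h]])
      also have "\<dots> \<le> (d + 1) ^ n" by (rule card_monoms_le)
      also have "\<dots> \<le> (2 * d) ^ n" using d by (intro power_mono) auto
      also have "\<dots> = 2 ^ n * d ^ n" by (rule power_mult_distrib)
      finally have "n ^ 3 * card (keys f) \<le> n ^ 3 * (2 ^ n * d ^ n)" by simp
      moreover have "card (monoms n (d - 2)) \<le> (d - 2 + 1) ^ n" by (rule card_monoms_le)
      moreover have "(d - 2 + 1) ^ n \<le> d ^ n" using d by (intro power_mono) auto
      ultimately have 1: "n ^ 3 * card (keys f) \<le> n ^ 3 * 2 ^ n * d ^ n"
        "n ^ 6 * card (monoms n (d - 2)) \<le> n ^ 6 * d ^ n" by (simp_all add: mult.assoc)
      have 2: "n ^ 5 \<le> n ^ 5 * d ^ n" using d by simp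
      show ?thesis using criterion_cost_le[OF h n] 1 2 unfolding add_mult_distrib mult.assoc by linarith
    qed
    thus "\<exists>(C::nat) k. \<forall>d\<ge>3. \<forall>f. homogeneous n d f \<longrightarrow> criterion_cost n d f \<le> C * d ^ k" by blast
  qed
  show "\<forall>d\<ge>3. \<exists>(C::nat) k. \<forall>n\<ge>1. \<forall>f. homogeneous n d f \<longrightarrow> criterion_cost n d f \<le> C * n ^ k"
  proof (intro allI impI)
    fix d :: nat assume d: "d \<ge> 3"
    have "criterion_cost n d f \<le> 65 * n ^ (d + 4)" if n: "n \<ge> 1" and h: "homogeneous n d f" for n f
    proof -
      have "card (keys f) \<le> card (monoms n d)"
        by (rule card_mono[OF finite_monoms keys_homogeneous[OF h]])
      also have "\<dots> \<le> n ^ d" by (rule card_monoms_le_power)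
      finally have "n ^ 3 * card (keys f) \<le> n ^ 3 * n ^ d" by simp
      also have "\<dots> = n ^ (d + 3)" by (simp add: power_add)
      also have "\<dots> \<le> n ^ (d + 4)" using n by (intro power_increasing) auto
      finally show ?thesis using general[OF n d h] by linarith
    qed
    thus "\<exists>(C::nat) k. \<forall>n\<ge>1. \<forall>f. homogeneous n d f \<longrightarrow> criterion_cost n d f \<le> C * n ^ k" by blast
  qed
qed

end
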